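(* Let $q$ be prime and $m\geq 3$. Define $\mathbf{Wide}^*(q,m;1)$ to be the set of $m$-tuples $(\chi_1,\ldots,\chi_m)$ of primitive Dirichlet characters modulo $q$ with $\chi_1\cdots\chi_m=1$ (the trivial character). Then, uniformly in the range $m=o(q^{1/2}\log q)$, $$\#\{(\chi_i)_i\in \mathbf{Wide}^*(q, m;1) : L(\chi_1,1/2)\cdots L(\chi_m,1/2)\neq 0 \} \gg q^{m-1}/(\log q)^m,$$ as $q\rightarrow \infty$.
   Context: $L(\chi,s)$ denotes the Dirichlet $L$-function of the Dirichlet character $\chi$. *)

theory Defs
  imports "HOL-Analysis.Analysis" "HOL-Library.Landau_Symbols" "HOL-Number_Theory.Number_Theory"
begin

definition dirichlet_char :: "nat \<Rightarrow> (nat \<Rightarrow> complex) \<Rightarrow> bool" where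
  "dirichlet_char q chi \<longleftrightarrow> q \<ge> 1 \<and>
     (\<forall>n. chi (n + q) = chi n) \<and>
     (\<forall>m n. chi (m * n) = chi m * chi n) \<and>
     (\<forall>n. chi n = 0 \<longleftrightarrow> \<not> coprime n q)"

definition principal_char :: "nat \<Rightarrow> nat \<Rightarrow> complex" where
  "principal_char q n = (if coprime n q then 1 else 0)"

definition primitive_char :: "nat \<Rightarrow> (nat \<Rightarrow> complex) \<Rightarrow> bool" where
  "primitive_char q chi \<longleftrightarrow> dirichlet_char q chi \<and>
     (\<forall>d. d dvd q \<and> d < q \<longrightarrow>
        \<not> (\<forall>a. coprime a q \<and> [a = 1] (mod d) \<longrightarrow> chi a = 1))"

text \<open>Dirichlet L-function as the limit of the partial sums of its Dirichlet series
  (this converges and agrees with the analytic continuation for non-principal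
  characters and Re s > 0, in particular at s = 1/2).\<close>
definition dirichlet_L :: "(nat \<Rightarrow> complex) \<Rightarrow> complex \<Rightarrow> complex" where
  "dirichlet_L chi s = lim (\<lambda>N. \<Sum>n\<in>{1..N}. chi n / (of_nat n) powr s)"

definition wide_star :: "nat \<Rightarrow> nat \<Rightarrow> (nat \<Rightarrow> complex) list set" where
  "wide_star q m = {cs. length cs = m \<and> (\<forall>c\<in>set cs. primitive_char q c) \<and>
      (\<forall>n. (\<Prod>c\<leftarrow>cs. c n) = principal_char q n)}"

end

theory Submission
  imports Defs "HOL-Real_Asymp.Real_Asymp"
begin

text \<open>
  Let \<open>A\<close> be the set of primitive characters with \<open>L(\<chi>, 1/2) \<noteq> 0\<close>. It suffices to show, for large
  \<open>q\<close>, that \<open>card A \<ge> q / log q\<close> and that for every character \<open>\<psi>\<close> there are \<open>\<gg> q\<^sup>2 / (log q)\<^sup>3\<close> triples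
  in \<open>A\<close> with product \<open>\<psi>\<close>: in an \<open>m\<close>-tuple one chooses \<open>m - 3\<close> members of \<open>A\<close> freely and completes
  them by a triple.

  Both bounds come from the Cauchy-Schwarz inequality. For the lower moments \<open>L\<close> is replaced by
  \<open>(1 - \<chi>(2) 2\<^sup>-\<^sup>1\<^sup>/\<^sup>2) L(\<chi>, 1/2)\<close>, the series over odd \<open>n\<close>. This halves the second moment, which makes
  the constant in \<open>q / log q\<close> harmless, and it makes the main term \<open>\<Sum> \<psi>(n) n\<^sup>-\<^sup>3\<^sup>/\<^sup>2\<close> of the cubic moment
  nonzero for trivial reasons, since the odd \<open>n \<ge> 3\<close> contribute less than 1.

  The second moment of triples needs the bound \<open>O(q\<^sup>2 (log q)\<^sup>3)\<close>. As in an approximate functional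
  equation, a Gauss sum expresses \<open>L\<close> by character sums of effective length \<open>\<surd>q\<close>, so that the moment is at
  most \<open>q\<^sup>2 \<Sum>\<^sub>b R(b)\<^sup>3\<close>, where \<open>R(b)\<close> sums \<open>(m n)\<^sup>-\<^sup>1\<^sup>/\<^sup>2\<close> over \<open>m \<equiv> b n\<close> with \<open>m, n\<close> up to about \<open>\<surd>q\<close>. Each
  class \<open>b\<close> contains boundedly many reduced fractions \<open>m/n\<close> of this height, whence \<open>R(b)\<^sup>3\<close> is at most
  \<open>(log q)\<^sup>3\<close> times the sum of \<open>(m n)\<^sup>-\<^sup>3\<^sup>/\<^sup>2\<close> over reduced fractions.
\<close>

section \<open>Characters modulo an odd prime\<close>

text \<open>The constant has to be uniform in \<open>m\<close>, while the density of nonvanishing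
  characters enters to the power \<open>m - 3\<close>. So the density must be at least 1 / log q
  with leading constant 1, not just a multiple of it. Cauchy-Schwarz applied to \<open>L\<close>
  itself yields about 1 / log q; the odd series yields about 2 / log q, and this surplus absorbs
  every error term. Pairs would be too short for the completion: summing over k characters with
  product \<psi> turns coefficients u(n) into the sum of \<psi>(n) u(n)^k. For k = 2 the terms have
  size 1/n and the sum behaves like L(\<psi>, 1), which has no cheap lower bound; for k = 3 the
  series converges absolutely. One logarithm per character is already the loss allowed by the
  target, so the second moment of triples may lose no more. With coefficients n^(-1/2) up to
  \<open>q\<close>, \<open>R(b)\<close> would have a mean of constant size and its cubes would add
  up to a multiple of \<open>q\<close>; this forces the dual representation of length about sqrt
  q.\<close>

definition characters :: "nat \<Rightarrow> (nat \<Rightarrow> complex) set" where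
  "characters q = {chi. dirichlet_char q chi}"

definition fourier :: "nat \<Rightarrow> (nat \<Rightarrow> complex) \<Rightarrow> (nat \<Rightarrow> complex) \<Rightarrow> complex" where
  "fourier q u chi = (\<Sum>a\<in>{1..<q}. u a * chi a)"

lemma charactersI:
  assumes "q \<ge> 1" "\<And>n. chi (n + q) = chi n" "\<And>m n. chi (m * n) = chi m * chi n"
    and "\<And>n. chi n = 0 \<longleftrightarrow> \<not> coprime n q"
  shows "chi \<in> characters q"
  unfolding characters_def dirichlet_char_def by (intro CollectI conjI allI assms)

lemma
  assumes "chi \<in> characters q"
  shows character_modulus: "q \<ge> 1"
    and character_periodic: "chi (n + q) = chi n"
    and character_mult: "chi (m * n) = chi m * chi n"
    and character_eq_0_iff: "chi n = 0 \<longleftrightarrow> \<not> coprime n q"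
proof -
  note * = assms[unfolded characters_def dirichlet_char_def mem_Collect_eq]
  show "q \<ge> 1" by (rule *[THEN conjunct1])
  show "chi (n + q) = chi n" by (rule *[THEN conjunct2, THEN conjunct1, rule_format])
  show "chi (m * n) = chi m * chi n"
    by (rule *[THEN conjunct2, THEN conjunct2, THEN conjunct1, rule_format])
  show "chi n = 0 \<longleftrightarrow> \<not> coprime n q"
    by (rule *[THEN conjunct2, THEN conjunct2, THEN conjunct2, rule_format])
qed

lemma principal_char_in_characters:
  assumes "q \<ge> 1"
  shows "principal_char q \<in> characters q"
proof (rule charactersI)
  show "principal_char q (n + q) = principal_char q n" for n
    unfolding principal_char_def coprime_iff_gcd_eq_1 by simp
qed (use assms in \<open>simp_all add: principal_char_def\<close>)

lemma characters_mult:
  assumes "chi \<in> characters q" "psi \<in> characters q"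
  shows "(\<lambda>n. chi n * psi n) \<in> characters q"
  using character_modulus[OF assms(1)]
  by (rule charactersI)
     (simp_all add: character_periodic[OF assms(1)] character_periodic[OF assms(2)]
        character_mult[OF assms(1)] character_mult[OF assms(2)]
        character_eq_0_iff[OF assms(1)] character_eq_0_iff[OF assms(2)])

lemma characters_cnj:
  assumes "chi \<in> characters q"
  shows "(\<lambda>n. cnj (chi n)) \<in> characters q"
  using character_modulus[OF assms]
  by (rule charactersI)
     (simp_all add: character_periodic[OF assms] character_mult[OF assms] character_eq_0_iff[OF assms])

lemma character_mod:
  assumes "chi \<in> characters q"
  shows "chi (n mod q) = chi n"
proof -
  have per: "chi (m + k * q) = chi m" for m k
  proof (induction k)
    case (Suc k)
    have "chi (m + Suc k * q) = chi ((m + k * q) + q)" by (simp add: algebra_simps)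
    also have "\<dots> = chi (m + k * q)"
      by (rule character_periodic[OF assms])
    finally show ?case using Suc by simp
  qed simp
  have "chi n = chi (n mod q + (n div q) * q)" by simp
  also have "\<dots> = chi (n mod q)" by (rule per)
  finally show ?thesis by simp
qed

lemma character_cong: "chi \<in> characters q \<Longrightarrow> [m = n] (mod q) \<Longrightarrow> chi m = chi n"
  using character_mod[of chi q m] character_mod[of chi q n] by (simp add: cong_def)

lemma character_1:
  assumes "chi \<in> characters q"
  shows "chi 1 = 1"
proof -
  have "chi 1 * chi 1 = chi 1" using character_mult[OF assms, of 1 1] by simp
  moreover have "chi 1 \<noteq> 0" using character_eq_0_iff[OF assms, of 1] by simp
  ultimately show ?thesis by simp
qed

lemma character_power:
  assumes "chi \<in> characters q"
  shows "chi (n ^ k) = chi n ^ k"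
  using character_1[OF assms] by (induction k) (simp_all add: character_mult[OF assms])

lemma character_root_of_unity:
  assumes "chi \<in> characters q" "coprime n q"
  shows "chi n ^ totient q = 1"
proof -
  have cong: "[n ^ totient q = 1] (mod q)" using assms by (intro euler_theorem)
  show ?thesis
    using character_cong[OF assms(1) cong] character_power[OF assms(1)] character_1[OF assms(1)] by simp
qed

lemma norm_character:
  assumes "chi \<in> characters q" "coprime n q"
  shows "norm (chi n) = 1"
proof -
  have "totient q \<noteq> 0" using character_modulus[OF assms(1)] by simp
  thus ?thesis
    using power_eq_1_iff[OF character_root_of_unity[OF assms]] by auto
qed

lemma norm_character_le:
  assumes "chi \<in> characters q"
  shows "norm (chi n) \<le> 1"
  using norm_character[OF assms, of n] character_eq_0_iff[OF assms, of n] by (cases "coprime n q") auto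

text \<open>A character is determined by its values on \<open>{..<q}\<close>, each of which is 0 or
  a root of unity of order dividing \<open>totient q\<close>.\<close>

lemma finite_characters:
  assumes "q \<ge> 1"
  shows "finite (characters q)"
proof -
  let ?Z = "{z::complex. z = 0 \<or> z ^ totient q = 1}"
  have "{z::complex. z = 0 \<or> z ^ totient q = 1} = {0} \<union> {z. z ^ totient q = 1}" by auto
  moreover have "finite {z::complex. z ^ totient q = 1}"
    using assms by (intro finite_roots_unity) (simp_all add: Suc_le_eq)
  ultimately have finZ: "finite ?Z" by simp
  have "inj_on (\<lambda>chi. restrict chi {..<q}) (characters q)"
  proof (rule inj_onI)
    fix chi psi assume h: "chi \<in> characters q" "psi \<in> characters q"
      and eq: "restrict chi {..<q} = restrict psi {..<q}"
    show "chi = psi"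
    proof
      fix n
      have "chi (n mod q) = psi (n mod q)"
        using fun_cong[OF eq, of "n mod q"] assms by simp
      thus "chi n = psi n" using character_mod[OF h(1)] character_mod[OF h(2)] by simp
    qed
  qed
  moreover have "(\<lambda>chi. restrict chi {..<q}) ` characters q \<subseteq> PiE {..<q} (\<lambda>_. ?Z)"
  proof (intro image_subsetI PiE_I)
    fix chi n assume chi: "chi \<in> characters q" and "n \<in> {..<q}"
    thus "restrict chi {..<q} n \<in> ?Z"
      using character_root_of_unity[OF chi, of n] character_eq_0_iff[OF chi, of n] by auto
  qed auto
  ultimately show ?thesis
    using finZ by (meson finite_PiE finite_imageD finite_lessThan finite_subset)
qed

locale odd_prime_modulus =
  fixes q :: nat
  assumes prime: "prime q" and odd_q: "odd q"
begin

lemma q_gt_2: "q > 2"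
proof -
  have "q \<noteq> 2" using odd_q by auto
  thus ?thesis using prime_ge_2_nat[OF prime] by simp
qed

lemma q_pos: "q > 0" "q \<ge> 1" "q \<noteq> 0"
  using q_gt_2 by auto

lemma coprime_q_iff: "coprime n q \<longleftrightarrow> \<not> q dvd n"
proof
  assume cop: "coprime n q"
  show "\<not> q dvd n"
  proof
    assume "q dvd n"
    hence "is_unit q" by (rule coprime_common_divisor[OF cop _ dvd_refl])
    with not_prime_unit prime show False by blast
  qed
next
  assume "\<not> q dvd n"
  from prime_imp_coprime[OF prime this] show "coprime n q" by (rule coprime_commute[THEN iffD1])
qed

lemma coprime_q: "n \<in> {1..<q} \<Longrightarrow> coprime n q"
  using nat_dvd_not_less[of n q] unfolding coprime_q_iff by simp

lemma cong_imp_eq: "a \<in> {1..<q} \<Longrightarrow> b \<in> {1..<q} \<Longrightarrow> [a = b] (mod q) \<Longrightarrow> a = b"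
  unfolding cong_def by simp

lemma finite_chars [simp]: "finite (characters q)"
  by (rule finite_characters[OF q_pos(2)])

text \<open>The discrete logarithm to a primitive root, followed by a primitive root of unity of
  order \<open>totient q\<close>. Faithfulness is what separates residues in
  \<open>sum_over_characters\<close>.\<close>

lemma faithful_character:
  obtains chi where "chi \<in> characters q" "\<And>a. chi a = 1 \<Longrightarrow> [a = 1] (mod q)"
proof -
  obtain g where g: "residue_primroot q g"
    using prime_primitive_root_exists[OF _ prime] q_gt_2 by auto
  define N where "N = totient q"
  have N: "N > 0" using q_pos by (simp add: N_def)
  have cop: "coprime q g" and ordg: "ord q g = N"
    using g by (auto simp: residue_primroot_def N_def)
  have bij: "bij_betw (\<lambda>i. g ^ i mod q) {..<N} (totatives q)"
    unfolding N_def using q_gt_2 g by (intro residue_primroot_is_generator) auto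
  \<comment> \<open>\<open>SOME\<close> fixes the logarithm only modulo \<open>N\<close>; since
    \<open>e\<close> has period \<open>N\<close>, \<open>chi\<close> is multiplicative all the
    same.\<close>
  define ind where "ind a = (SOME k. [g ^ k = a] (mod q))" for a
  have ind: "[g ^ ind a = a] (mod q)" if "coprime a q" for a
  proof -
    have "a mod q \<in> totatives q"
      using that q_pos by (auto simp: totatives_def coprime_q_iff dvd_mod_iff mod_greater_zero_iff_not_dvd
          intro: less_imp_le)
    then obtain k where "g ^ k mod q = a mod q" using bij unfolding bij_betw_def by (metis (no_types, lifting) imageE)
    hence "[g ^ k = a] (mod q)" by (simp add: cong_def)
    thus ?thesis unfolding ind_def by (rule someI)
  qed
  define e where "e k = cis (2 * pi * real k / real N)" for k :: nat
  have e_add: "e (j + k) = e j * e k" for j k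
    by (simp add: e_def cis_mult add_divide_distrib ring_distribs)
  have e_N: "e (N * k) = 1" for k
    using N cis_multiple_2pi[of "of_nat k"] by (simp add: e_def field_simps)
  have e_cong: "e j = e k" if "[j = k] (mod N)" for j k
  proof -
    have "e i = e (i mod N)" for i
      using e_add[of "i mod N" "N * (i div N)"] e_N by simp
    thus ?thesis using that by (metis cong_def)
  qed
  have e_1: "[k = 0] (mod N)" if "e k = 1" for k
  proof -
    have "cos (2 * pi * real k / real N) = 1"
      using that by (simp add: e_def complex_eq_iff)
    then obtain m :: int where "2 * pi * real k / real N = of_int m * 2 * pi"
      by (auto simp: cos_one_2pi_int)
    hence "real k = of_int m * real N" using N by (simp add: field_simps)
    hence "real_of_int (int k) = of_int (m * int N)" by simp
    hence "int k = m * int N" by (simp only: of_int_eq_iff)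
    hence "int N dvd int k" by simp
    thus ?thesis by (simp add: cong_0_iff)
  qed
  define chi where "chi a = (if coprime a q then e (ind a) else 0)" for a
  have ind_eq: "[ind a = k] (mod N)" if "coprime a q" "[g ^ k = a] (mod q)" for a k
    using order_divides_expdiff[OF cop, of "ind a" k] ind[OF that(1)] that(2) ordg
    by (metis cong_sym cong_trans)
  have "dirichlet_char q chi"
    unfolding dirichlet_char_def
  proof (intro conjI allI)
    fix n
    have cop_eq: "coprime (n + q) q \<longleftrightarrow> coprime n q"
      by (simp add: coprime_q_iff)
    show "chi (n + q) = chi n"
    proof (cases "coprime n q")
      case True
      have "[ind (n + q) = ind n] (mod N)"
        using ind[OF True] by (intro ind_eq) (use cop_eq True in \<open>auto simp: cong_def\<close>)
      thus ?thesis using True cop_eq e_cong by (simp add: chi_def)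
    qed (use cop_eq in \<open>simp add: chi_def\<close>)
  next
    fix m n
    show "chi (m * n) = chi m * chi n"
    proof (cases "coprime m q \<and> coprime n q")
      case True
      have "[g ^ (ind m + ind n) = m * n] (mod q)"
        unfolding power_add using True ind by (intro cong_mult) auto
      hence "[ind (m * n) = ind m + ind n] (mod N)"
        using True by (intro ind_eq) auto
      thus ?thesis using True e_cong[of "ind (m * n)" "ind m + ind n"] by (simp add: chi_def e_add)
    qed (auto simp: chi_def)
  next
    fix n show "(chi n = 0) = (\<not> coprime n q)" by (simp add: chi_def e_def)
  qed (use q_pos in simp)
  moreover have "[a = 1] (mod q)" if "chi a = 1" for a
  proof -
    have a: "coprime a q" using that by (auto simp: chi_def split: if_splits)
    have "[ind a = 0] (mod N)" using that a by (intro e_1) (simp add: chi_def)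
    hence "[g ^ ind a = g ^ 0] (mod q)" using order_divides_expdiff[OF cop, of "ind a" 0] ordg by simp
    thus ?thesis using ind[OF a] by (metis cong_sym cong_trans power_0)
  qed
  ultimately show ?thesis using that unfolding characters_def by blast
qed

lemma bij_mult_mod:
  assumes "coprime c q"
  shows "bij_betw (\<lambda>a. c * a mod q) {1..<q} {1..<q}"
proof -
  have inj: "inj_on (\<lambda>a. c * a mod q) {1..<q}"
  proof (rule inj_onI)
    fix x y assume *: "x \<in> {1..<q}" "y \<in> {1..<q}" "c * x mod q = c * y mod q"
    hence "[c * x = c * y] (mod q)" by (simp add: cong_def)
    hence "[x = y] (mod q)" using assms by (simp add: cong_mult_lcancel_nat)
    thus "x = y" using * cong_imp_eq by blast
  qed
  moreover have "(\<lambda>a. c * a mod q) ` {1..<q} \<subseteq> {1..<q}"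
  proof
    fix y assume "y \<in> (\<lambda>a. c * a mod q) ` {1..<q}"
    then obtain x where x: "x \<in> {1..<q}" "y = c * x mod q" by auto
    have "\<not> q dvd c * x" using x assms coprime_q coprime_q_iff prime by (metis coprime_mult_left_iff)
    thus "y \<in> {1..<q}" using x q_pos by (simp add: Suc_le_eq mod_greater_zero_iff_not_dvd)
  qed
  ultimately show ?thesis
    by (simp add: bij_betw_def card_image card_subset_eq)
qed

lemma sum_character:
  assumes "chi \<in> characters q" "chi \<noteq> principal_char q"
  shows "(\<Sum>a\<in>{1..<q}. chi a) = 0"
proof -
  obtain c where c: "coprime c q" "chi c \<noteq> 1"
    using assms character_eq_0_iff by (fastforce simp: principal_char_def fun_eq_iff)
  have "(\<Sum>a\<in>{1..<q}. chi a) = (\<Sum>a\<in>{1..<q}. chi (c * a mod q))"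
    by (rule sum.reindex_bij_betw[OF bij_mult_mod[OF c(1)], symmetric])
  also have "\<dots> = chi c * (\<Sum>a\<in>{1..<q}. chi a)"
    using assms by (simp add: character_mod character_mult sum_distrib_left)
  finally show ?thesis using c by auto
qed

lemma sum_principal_char: "(\<Sum>a\<in>{1..<q}. principal_char q a) = of_nat (q - 1)"
proof -
  have "(\<Sum>a\<in>{1..<q}. principal_char q a) = (\<Sum>a\<in>{1..<q}. 1)"
    by (intro sum.cong) (use coprime_q in \<open>auto simp: principal_char_def\<close>)
  thus ?thesis by simp
qed

text \<open>Multiplication by the conjugate is the inverse map: on residues prime to
  \<open>q\<close> the values of \<open>psi\<close> have norm 1, elsewhere every character
  vanishes.\<close>

lemma bij_character_mult:
  assumes "psi \<in> characters q"
  shows "bij_betw (\<lambda>chi n. psi n * chi n) (characters q) (characters q)"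
proof -
  have canc: "cnj (psi n) * (psi n * chi n) = chi n" "psi n * (cnj (psi n) * chi n) = chi n"
    if "chi \<in> characters q" for chi n
  proof -
    have "cnj (psi n) * psi n * chi n = chi n"
    proof (cases "coprime n q")
      case True
      thus ?thesis using norm_character[OF assms True]
        by (metis complex_norm_square mult.commute mult_1 of_real_1 power_one)
    qed (use that character_eq_0_iff in auto)
    thus "cnj (psi n) * (psi n * chi n) = chi n" "psi n * (cnj (psi n) * chi n) = chi n"
      by (simp_all add: mult_ac)
  qed
  show ?thesis
    by (rule bij_betw_byWitness[where f' = "\<lambda>chi n. cnj (psi n) * chi n"])
       (use assms canc characters_mult characters_cnj[OF assms] in auto)
qed

lemma sum_over_characters:
  assumes "\<not> [a = 1] (mod q)"
  shows "(\<Sum>chi\<in>characters q. chi a) = 0"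
proof -
  obtain psi where psi: "psi \<in> characters q" "psi a \<noteq> 1"
    using faithful_character assms by metis
  have "(\<Sum>chi\<in>characters q. chi a) = (\<Sum>chi\<in>characters q. psi a * chi a)"
    by (rule sum.reindex_bij_betw[OF bij_character_mult[OF psi(1)], symmetric])
  also have "\<dots> = psi a * (\<Sum>chi\<in>characters q. chi a)" by (simp add: sum_distrib_left)
  finally show ?thesis using psi by auto
qed

text \<open>Summing \<open>chi a\<close> over all characters and residues in both orders: one order
  leaves only \<open>a = 1\<close>, the other only the principal character.\<close>

lemma card_characters: "card (characters q) = q - 1"
proof -
  have "of_nat (card (characters q)) = (\<Sum>a\<in>{1..<q}. if a = 1 then of_nat (card (characters q)) else (0::complex))"
    using q_gt_2 by simp
  also have "\<dots> = (\<Sum>a\<in>{1..<q}. \<Sum>chi\<in>characters q. chi a)"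
  proof (intro sum.cong refl)
    fix a assume a: "a \<in> {1..<q}"
    show "(if a = 1 then of_nat (card (characters q)) else 0) = (\<Sum>chi\<in>characters q. chi a)"
    proof (cases "a = 1")
      case True
      have "(\<Sum>chi\<in>characters q. chi 1) = (\<Sum>chi\<in>characters q. 1)"
        by (intro sum.cong refl character_1)
      thus ?thesis using True by simp
    next
      case False
      hence "\<not> [a = 1] (mod q)" using cong_imp_eq[of a 1] a q_gt_2 by auto
      thus ?thesis using False sum_over_characters by simp
    qed
  qed
  also have "\<dots> = (\<Sum>chi\<in>characters q. \<Sum>a\<in>{1..<q}. chi a)" by (rule sum.swap)
  also have "\<dots> = (\<Sum>chi\<in>characters q. if chi = principal_char q then of_nat (q - 1) else 0)"
    by (intro sum.cong refl) (use sum_character sum_principal_char in auto)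
  also have "\<dots> = of_nat (q - 1)"
    using principal_char_in_characters[of q] q_pos by (simp del: of_nat_diff)
  finally show ?thesis by (simp only: of_nat_eq_iff)
qed

lemma character_orthogonality:
  assumes "a \<in> {1..<q}" "b \<in> {1..<q}"
  shows "(\<Sum>chi\<in>characters q. chi a * cnj (chi b)) = (if a = b then of_nat (q - 1) else 0)"
proof -
  have cb: "coprime b q" using assms coprime_q by blast
  obtain c where c: "[b * c = 1] (mod q)" using cong_solve_coprime_nat[OF cb] by auto
  have eq: "chi a * cnj (chi b) = chi (a * c)" if chi: "chi \<in> characters q" for chi
  proof -
    have "chi b * chi c = 1"
      using character_cong[OF chi c] character_1[OF chi] character_mult[OF chi] by simp
    moreover have "cnj (chi b) * chi b = 1"
      using norm_character[OF chi cb] by (metis complex_norm_square mult.commute of_real_1 power_one)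
    ultimately have "cnj (chi b) = chi c" by (metis mult.assoc mult.right_neutral mult_1)
    thus ?thesis using character_mult[OF chi] by simp
  qed
  have sum: "(\<Sum>chi\<in>characters q. chi a * cnj (chi b)) = (\<Sum>chi\<in>characters q. chi (a * c))"
    using eq by (intro sum.cong) auto
  show ?thesis
  proof (cases "a = b")
    case True
    have "chi (a * c) = 1" if "chi \<in> characters q" for chi
      using character_cong[OF that c] character_1[OF that] True by simp
    hence "(\<Sum>chi\<in>characters q. chi (a * c)) = (\<Sum>chi\<in>characters q. 1)" by (intro sum.cong refl)
    thus ?thesis using True sum card_characters by simp
  next
    case False
    have "\<not> [a * c = 1] (mod q)"
    proof
      assume "[a * c = 1] (mod q)"
      hence "[a * c * b = 1 * b] (mod q)" by (rule cong_scalar_right)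
      moreover have "[a * (b * c) = a * 1] (mod q)" using c by (rule cong_scalar_left)
      ultimately have "[a = b] (mod q)" by (metis cong_sym cong_trans mult.assoc mult.commute mult_1)
      thus False using assms cong_imp_eq False by blast
    qed
    thus ?thesis using False sum sum_over_characters by simp
  qed
qed

section \<open>Fourier analysis on the group of reduced residues\<close>

lemma fourier_inversion:
  assumes "c \<in> {1..<q}"
  shows "(\<Sum>chi\<in>characters q. fourier q u chi * cnj (chi c)) = of_nat (q - 1) * u c"
proof -
  have "(\<Sum>chi\<in>characters q. fourier q u chi * cnj (chi c))
      = (\<Sum>chi\<in>characters q. \<Sum>a\<in>{1..<q}. u a * (chi a * cnj (chi c)))"
    by (simp add: fourier_def sum_distrib_right mult.assoc)
  also have "\<dots> = (\<Sum>a\<in>{1..<q}. u a * (\<Sum>chi\<in>characters q. chi a * cnj (chi c)))"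
    by (subst sum.swap) (simp add: sum_distrib_left)
  also have "\<dots> = (\<Sum>a\<in>{1..<q}. u a * (if a = c then of_nat (q - 1) else 0))"
    using assms by (intro sum.cong refl) (simp add: character_orthogonality)
  also have "\<dots> = (\<Sum>a\<in>{1..<q}. if a = c then u a * of_nat (q - 1) else 0)"
    by (intro sum.cong) auto
  also have "\<dots> = u c * of_nat (q - 1)"
    using assms by (simp del: of_nat_diff)
  finally show ?thesis by (simp add: mult.commute)
qed

lemma fourier_sum: "(\<Sum>chi\<in>characters q. fourier q u chi) = of_nat (q - 1) * u 1"
proof -
  have "(\<Sum>chi\<in>characters q. fourier q u chi) = (\<Sum>chi\<in>characters q. fourier q u chi * cnj (chi 1))"
  proof (intro sum.cong refl)
    fix chi assume "chi \<in> characters q"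
    from character_1[OF this] show "fourier q u chi = fourier q u chi * cnj (chi 1)" by simp
  qed
  thus ?thesis using fourier_inversion[of 1 u] q_gt_2 by simp
qed

lemma fourier_parseval:
  "(\<Sum>chi\<in>characters q. (norm (fourier q u chi))\<^sup>2) = real (q - 1) * (\<Sum>a\<in>{1..<q}. (norm (u a))\<^sup>2)"
proof -
  have "complex_of_real (\<Sum>chi\<in>characters q. (norm (fourier q u chi))\<^sup>2)
      = (\<Sum>chi\<in>characters q. fourier q u chi * cnj (fourier q u chi))"
    by (simp only: of_real_sum complex_norm_square)
  also have "\<dots> = (\<Sum>chi\<in>characters q. \<Sum>a\<in>{1..<q}. cnj (u a) * (fourier q u chi * cnj (chi a)))"
    by (subst (2) fourier_def) (simp add: sum_distrib_left mult.left_commute)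
  also have "\<dots> = (\<Sum>a\<in>{1..<q}. cnj (u a) * (\<Sum>chi\<in>characters q. fourier q u chi * cnj (chi a)))"
    by (subst sum.swap) (simp add: sum_distrib_left)
  also have "\<dots> = (\<Sum>a\<in>{1..<q}. of_nat (q - 1) * (u a * cnj (u a)))"
  proof (intro sum.cong refl)
    fix a assume "a \<in> {1..<q}"
    from fourier_inversion[OF this, of u]
    show "cnj (u a) * (\<Sum>chi\<in>characters q. fourier q u chi * cnj (chi a)) = of_nat (q - 1) * (u a * cnj (u a))"
      by (simp only: mult_ac)
  qed
  also have "\<dots> = complex_of_real (real (q - 1) * (\<Sum>a\<in>{1..<q}. (norm (u a))\<^sup>2))"
    by (simp only: of_real_sum of_real_mult of_real_of_nat_eq complex_norm_square sum_distrib_left)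
  finally show ?thesis by (simp only: of_real_eq_iff)
qed

text \<open>Both character sums are Fourier inversions at the same residue \<open>c\<close>, so a
  convolution over triples with product \<open>psi\<close> becomes a pointwise cube. It serves
  twice: with the coefficients of the odd series for the cubic moment, with correlations for the
  second moment.\<close>

lemma fourier_triple:
  assumes "psi \<in> characters q"
  shows "(\<Sum>chi1\<in>characters q. \<Sum>chi2\<in>characters q. fourier q u chi1 * fourier q u chi2 *
            fourier q u (\<lambda>n. psi n * cnj (chi1 n) * cnj (chi2 n)))
         = of_nat (q - 1) ^ 2 * (\<Sum>a\<in>{1..<q}. psi a * u a ^ 3)"
proof -
  let ?X = "characters q" and ?F = "fourier q u"
  have "(\<Sum>chi1\<in>?X. \<Sum>chi2\<in>?X. ?F chi1 * ?F chi2 * ?F (\<lambda>n. psi n * cnj (chi1 n) * cnj (chi2 n)))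
      = (\<Sum>chi1\<in>?X. \<Sum>chi2\<in>?X. \<Sum>c\<in>{1..<q}.
           u c * psi c * ((?F chi1 * cnj (chi1 c)) * (?F chi2 * cnj (chi2 c))))"
    by (subst (3) fourier_def) (simp add: sum_distrib_left mult_ac)
  also have "\<dots> = (\<Sum>chi1\<in>?X. \<Sum>c\<in>{1..<q}. \<Sum>chi2\<in>?X.
           u c * psi c * ((?F chi1 * cnj (chi1 c)) * (?F chi2 * cnj (chi2 c))))"
    by (intro sum.cong refl sum.swap)
  also have "\<dots> = (\<Sum>c\<in>{1..<q}. \<Sum>chi1\<in>?X. \<Sum>chi2\<in>?X.
           u c * psi c * ((?F chi1 * cnj (chi1 c)) * (?F chi2 * cnj (chi2 c))))"
    by (rule sum.swap)
  also have "\<dots> = (\<Sum>c\<in>{1..<q}. u c * psi c * ((\<Sum>chi1\<in>?X. ?F chi1 * cnj (chi1 c)) * (\<Sum>chi2\<in>?X. ?F chi2 * cnj (chi2 c))))"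
    by (intro sum.cong refl, subst sum_product) (simp add: sum_distrib_left)
  also have "\<dots> = (\<Sum>c\<in>{1..<q}. of_nat (q - 1) ^ 2 * (psi c * u c ^ 3))"
  proof (intro sum.cong refl)
    fix c assume c: "c \<in> {1..<q}"
    show "u c * psi c * ((\<Sum>chi1\<in>?X. ?F chi1 * cnj (chi1 c)) * (\<Sum>chi2\<in>?X. ?F chi2 * cnj (chi2 c)))
        = of_nat (q - 1) ^ 2 * (psi c * u c ^ 3)"
      unfolding fourier_inversion[OF c] by (simp only: power2_eq_square power3_eq_cube mult_ac)
  qed
  finally show ?thesis by (simp add: sum_distrib_left)
qed

end

section \<open>Reduced fractions in a residue class\<close>

text \<open>Majorant \<open>m\<^sup>-\<^sup>1\<^sup>/\<^sup>2 min(1, (\<surd>q/m)\<^sup>3\<^sup>/\<^sup>2)\<close> of the coefficients of both parts of the dual representation.\<close>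

definition kap :: "nat \<Rightarrow> nat \<Rightarrow> real" where
  "kap q m = min (1 / sqrt m) (sqrt (sqrt q) ^ 3 / m\<^sup>2)"

definition ratio_class :: "nat \<Rightarrow> nat \<Rightarrow> nat \<Rightarrow> (nat \<times> nat) set" where
  "ratio_class q H b = {p \<in> {1..H} \<times> {1..H}. [fst p = b * snd p] (mod q)}"

definition coprime_ratios :: "nat \<Rightarrow> nat \<Rightarrow> nat \<Rightarrow> (nat \<times> nat) set" where
  "coprime_ratios q H b = {p \<in> ratio_class q H b. coprime (fst p) (snd p)}"

text \<open>The least \<open>j\<close> with max(m, n) \<le> 2^j sqrt q, squared in order to stay
  within the natural numbers.\<close>

definition dyadic_level :: "nat \<Rightarrow> nat \<times> nat \<Rightarrow> nat" where
  "dyadic_level q p = (LEAST j. (max (fst p) (snd p))\<^sup>2 \<le> 4 ^ j * q)"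

text \<open>The ratio must be below 1/4, since of order 4^j fractions can have level
  \<open>j\<close>, and at least 2^(-9/4) = 0.210..., since the squared weight has to dominate the
  decay in \<open>kap_cube_le\<close>; 2/9 lies in between. The factor 5 exceeds 9/2 and so makes up
  for a shift by one level.\<close>

definition dyadic_weight :: "nat \<Rightarrow> nat \<times> nat \<Rightarrow> real" where
  "dyadic_weight q p = 5 * (2 / 9) ^ dyadic_level q p"

text \<open>The mean value \<open>l\<close> of \<open>x/w\<close> gives the tangent line of \<open>t\<^sup>3\<close> that proves this case of Jensen's inequality.\<close>

lemma cube_sum_le:
  fixes x w :: "'a \<Rightarrow> real"
  assumes fin: "finite S" and w: "\<And>i. i \<in> S \<Longrightarrow> w i > 0" and x: "\<And>i. i \<in> S \<Longrightarrow> x i \<ge> 0"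
  shows "(\<Sum>i\<in>S. x i) ^ 3 \<le> (\<Sum>i\<in>S. w i)\<^sup>2 * (\<Sum>i\<in>S. x i ^ 3 / (w i)\<^sup>2)"
proof (cases "S = {}")
  case False
  define W where "W = (\<Sum>i\<in>S. w i)"
  define X where "X = (\<Sum>i\<in>S. x i)"
  define l where "l = X / W"
  have W: "W > 0" unfolding W_def using fin False w by (intro sum_pos)
  have X: "X \<ge> 0" unfolding X_def using x by (intro sum_nonneg)
  have l: "l \<ge> 0" using X W by (simp add: l_def)
  have pt: "x i ^ 3 / (w i)\<^sup>2 \<ge> 3 * l\<^sup>2 * x i - 2 * l ^ 3 * w i" if i: "i \<in> S" for i
  proof -
    define t where "t = x i / w i"
    have t: "t \<ge> 0" "x i = t * w i" using w[OF i] x[OF i] by (auto simp: t_def)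
    have "(t - l)\<^sup>2 * (t + 2 * l) \<ge> 0" using t l by simp
    hence "t ^ 3 \<ge> 3 * l\<^sup>2 * t - 2 * l ^ 3" by (simp add: power2_eq_square power3_eq_cube algebra_simps)
    hence "w i * t ^ 3 \<ge> w i * (3 * l\<^sup>2 * t - 2 * l ^ 3)" using w[OF i] by (intro mult_left_mono) auto
    moreover have "x i ^ 3 / (w i)\<^sup>2 = w i * t ^ 3"
      using w[OF i] unfolding t(2) by (simp add: power2_eq_square power3_eq_cube)
    ultimately show ?thesis by (simp add: t(2) algebra_simps)
  qed
  have "(\<Sum>i\<in>S. x i ^ 3 / (w i)\<^sup>2) \<ge> (\<Sum>i\<in>S. 3 * l\<^sup>2 * x i - 2 * l ^ 3 * w i)"
    using pt by (intro sum_mono)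
  hence "(\<Sum>i\<in>S. x i ^ 3 / (w i)\<^sup>2) \<ge> 3 * l\<^sup>2 * X - 2 * l ^ 3 * W"
    by (simp add: sum_subtractf X_def W_def sum_distrib_left)
  hence "W\<^sup>2 * (\<Sum>i\<in>S. x i ^ 3 / (w i)\<^sup>2) \<ge> W\<^sup>2 * (3 * l\<^sup>2 * X - 2 * l ^ 3 * W)"
    by (intro mult_left_mono) auto
  moreover have "W\<^sup>2 * (3 * l\<^sup>2 * X - 2 * l ^ 3 * W) = X ^ 3"
    using W by (simp add: l_def field_simps power2_eq_square power3_eq_cube)
  ultimately show ?thesis by (simp add: W_def X_def)
qed simp

text \<open>Distinct slopes \<open>n/m\<close> differ by at least \<open>q/Z\<^sup>2\<close>, so at most \<open>Z\<^sup>2/q + 1\<close> of them fit into \<open>[0,1]\<close>.\<close>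

lemma card_separated_slopes:
  fixes Z :: real and q :: nat
  assumes q: "q > 0" and Z: "Z > 0" and fin: "finite S"
    and box: "\<And>m n. (m, n) \<in> S \<Longrightarrow> 0 < m \<and> n \<le> m \<and> real m \<le> Z"
    and sep: "\<And>m n m' n'. (m, n) \<in> S \<Longrightarrow> (m', n') \<in> S \<Longrightarrow> (m, n) \<noteq> (m', n') \<Longrightarrow>
                \<bar>int n * int m' - int n' * int m\<bar> \<ge> int q"
  shows "real (card S) \<le> Z\<^sup>2 / q + 1"
proof -
  \<comment> \<open>Scaling by Z^2 / q turns the minimal gap between slopes into 1, so that the
    floor becomes injective.\<close>
  define f where "f p = nat \<lfloor>real (snd p) / real (fst p) * (Z\<^sup>2 / q)\<rfloor>" for p :: "nat \<times> nat"
  have nn: "0 \<le> real (snd p) / real (fst p) * (Z\<^sup>2 / q)" for p :: "nat \<times> nat" by simp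
  have "inj_on f S"
  proof (rule inj_onI, rule ccontr)
    fix p p' assume pp: "p \<in> S" "p' \<in> S" "f p = f p'" "p \<noteq> p'"
    obtain m n m' n' where mn: "p = (m, n)" "p' = (m', n')" by fastforce
    have b: "0 < m" "0 < m'" "real m \<le> Z" "real m' \<le> Z" using box pp mn by auto
    have "\<lfloor>real n / real m * (Z\<^sup>2 / q)\<rfloor> = \<lfloor>real n' / real m' * (Z\<^sup>2 / q)\<rfloor>"
      using pp(3) nn[of p] nn[of p'] unfolding f_def mn by (simp add: nat_eq_iff)
    hence "\<bar>real n / real m * (Z\<^sup>2 / q) - real n' / real m' * (Z\<^sup>2 / q)\<bar> < 1" by linarith
    also have "real n / real m * (Z\<^sup>2 / q) - real n' / real m' * (Z\<^sup>2 / q)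
        = (real n * real m' - real n' * real m) * (Z\<^sup>2 / (real m * real m')) / q"
      using b q by (simp add: field_simps)
    finally have "\<bar>real n * real m' - real n' * real m\<bar> * (Z\<^sup>2 / (real m * real m')) / q < 1"
      by (simp add: abs_mult)
    moreover have "\<bar>real n * real m' - real n' * real m\<bar> \<ge> real q"
    proof -
      have "\<bar>int n * int m' - int n' * int m\<bar> \<ge> int q"
        using sep[of m n m' n'] pp mn by simp
      hence "real_of_int \<bar>int n * int m' - int n' * int m\<bar> \<ge> real_of_int (int q)" by (simp only: of_int_le_iff)
      thus ?thesis by simp
    qed
    moreover have "Z\<^sup>2 / (real m * real m') \<ge> 1"
      using b mult_mono[of "real m" Z "real m'" Z] by (simp add: power2_eq_square)
    ultimately have lt: "\<bar>real n * real m' - real n' * real m\<bar> * (Z\<^sup>2 / (real m * real m')) / q < 1"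
      and le: "real q * 1 \<le> \<bar>real n * real m' - real n' * real m\<bar> * (Z\<^sup>2 / (real m * real m'))"
      by (blast, intro mult_mono) auto
    from divide_right_mono[OF le, of "real q"] q lt show False by simp
  qed
  moreover have "f ` S \<subseteq> {0..nat \<lfloor>Z\<^sup>2 / q\<rfloor>}"
  proof
    fix y assume "y \<in> f ` S"
    then obtain m n where mn: "(m, n) \<in> S" "y = f (m, n)" by fastforce
    have "real n / real m \<le> 1" using box[OF mn(1)] by simp
    hence "real n / real m * (Z\<^sup>2 / q) \<le> 1 * (Z\<^sup>2 / q)" by (intro mult_right_mono) auto
    thus "y \<in> {0..nat \<lfloor>Z\<^sup>2 / q\<rfloor>}" unfolding mn(2) f_def by (simp add: nat_mono floor_mono)
  qed
  ultimately have "card S \<le> card {0..nat \<lfloor>Z\<^sup>2 / q\<rfloor>}"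
    by (metis card_image card_mono finite_atLeastAtMost)
  hence "card S \<le> nat \<lfloor>Z\<^sup>2 / q\<rfloor> + 1" by simp
  hence "real (card S) \<le> real (nat \<lfloor>Z\<^sup>2 / q\<rfloor> + 1)" by (rule of_nat_mono)
  hence "real (card S) \<le> real (nat \<lfloor>Z\<^sup>2 / q\<rfloor>) + 1" by (simp only: of_nat_add of_nat_1)
  also have "real (nat \<lfloor>Z\<^sup>2 / q\<rfloor>) \<le> Z\<^sup>2 / q" by (intro of_nat_floor) simp
  finally show ?thesis by simp
qed

text \<open>The sum up to n is at most 3 - 2 / sqrt n. With x and y the roots of consecutive
  integers, the induction step is 1 / y^3 \<le> 2 / x - 2 / y.\<close>

lemma sum_inverse_three_halves: "(\<Sum>m\<in>{1..H}. 1 / (real m * sqrt m)) \<le> 3"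
proof -
  have "(\<Sum>m\<in>{1..Suc H}. 1 / (real m * sqrt m)) \<le> 3 - 2 / sqrt (Suc H)" for H
  proof (induction H)
    case (Suc H)
    define x where "x = sqrt (real (Suc H))"
    define y where "y = sqrt (real (Suc (Suc H)))"
    have x: "x > 0" and y: "y > 0" and xy: "y\<^sup>2 = x\<^sup>2 + 1" by (simp_all add: x_def y_def)
    have le: "x \<le> y" by (simp add: x_def y_def)
    have "(y - x) * (y + x) = 1" using xy by (simp add: power2_eq_square algebra_simps)
    moreover have "(y - x) * (y + x) \<le> (y - x) * (2 * y)" using le by (intro mult_left_mono) auto
    ultimately have "1 \<le> 2 * y * (y - x)" by (simp add: mult_ac)
    hence "x \<le> 2 * y * (y - x) * y"
      using le y mult_right_mono[of 1 "2 * y * (y - x)" y] by linarith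
    hence "1 / (y\<^sup>2 * y) \<le> 2 / x - 2 / y"
      using x y by (simp add: field_simps power2_eq_square)
    moreover have "real (Suc (Suc H)) = y\<^sup>2" by (simp add: y_def)
    ultimately have "1 / (real (Suc (Suc H)) * sqrt (Suc (Suc H))) \<le> 2 / x - 2 / y"
      unfolding y_def[symmetric] by simp
    with Suc show ?case by (simp add: x_def y_def)
  qed simp
  note * = this
  show ?thesis
  proof (cases H)
    case (Suc H')
    have "2 / sqrt (Suc H') \<ge> 0" by simp
    thus ?thesis using *[of H'] unfolding Suc by linarith
  qed simp
qed

lemma kap_nonneg: "kap q m \<ge> 0"
  by (simp add: kap_def)

text \<open>Allows the gcd to be taken out of a pair. The first branch of the minimum scales exactly
  by g^(-1/2), the second even by g^(-2).\<close>

lemma kap_mult_le: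
  assumes "g > 0"
  shows "kap q (g * m) \<le> kap q m / sqrt g"
proof (cases "m = 0")
  case False
  have "sqrt (real g) \<le> real g ^ 2"
  proof -
    have "sqrt (real g) \<le> real g" using assms by (intro real_le_lsqrt) (auto simp: power2_eq_square)
    also have "real g \<le> real g ^ 2" using assms by (simp add: power2_eq_square)
    finally show ?thesis .
  qed
  hence "1 / real g ^ 2 \<le> 1 / sqrt g" using assms by (intro divide_left_mono) auto
  hence "sqrt (sqrt q) ^ 3 / m\<^sup>2 * (1 / real g ^ 2) \<le> sqrt (sqrt q) ^ 3 / m\<^sup>2 * (1 / sqrt g)"
    by (intro mult_left_mono) auto
  thus ?thesis unfolding kap_def by (auto simp: real_sqrt_mult min_def field_simps)
qed (simp add: kap_def)

lemma (in odd_prime_modulus) ratio_class_cross: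
  assumes "(m, n) \<in> ratio_class q H b" "(m', n') \<in> ratio_class q H b"
  shows "int q dvd int n * int m' - int n' * int m"
proof -
  have "[m = b * n] (mod q)" "[m' = b * n'] (mod q)" using assms by (auto simp: ratio_class_def)
  hence "[n * m' = n * (b * n')] (mod q)" "[n' * m = n' * (b * n)] (mod q)"
    by (auto intro: cong_scalar_left)
  hence "[n * m' = n' * m] (mod q)"
    by (metis cong_sym cong_trans mult.commute mult.left_commute)
  hence "[int (n * m') = int (n' * m)] (mod int q)" by (simp only: cong_int_iff)
  thus ?thesis by (simp add: cong_iff_dvd_diff)
qed

lemma finite_ratio_class [simp]: "finite (ratio_class q H b)"
  by (rule finite_subset[of _ "{1..H} \<times> {1..H}"]) (auto simp: ratio_class_def)

lemma finite_coprime_ratios [simp]: "finite (coprime_ratios q H b)"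
  by (rule finite_subset[of _ "ratio_class q H b"]) (auto simp: coprime_ratios_def)

lemma coprime_cross_eq:
  fixes m n m' n' :: nat
  assumes "coprime m n" "coprime m' n'" "n * m' = n' * m" "m > 0" "m' > 0"
  shows "(m, n) = (m', n')"
proof -
  have "m dvd m'" using assms(1,3) by (metis coprime_dvd_mult_right_iff dvd_triv_right)
  moreover have "m' dvd m" using assms(2,3) by (metis coprime_dvd_mult_right_iff dvd_triv_right)
  ultimately have "m = m'" by (rule dvd_antisym)
  thus ?thesis using assms by simp
qed

text \<open>Distinct reduced fractions have a nonzero determinant, and within one class it is a
  multiple of \<open>q\<close>, hence at least \<open>q\<close> in absolute value. The box is cut
  along the diagonal and one half is reflected, so that all slopes lie in [0,1]; counting the
  diagonal twice does no harm.\<close>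

lemma (in odd_prime_modulus) card_coprime_ratios_box:
  fixes Z :: real
  assumes Z: "Z > 0"
  shows "real (card {p \<in> coprime_ratios q H b. real (max (fst p) (snd p)) \<le> Z}) \<le> 2 * (Z\<^sup>2 / q + 1)"
proof -
  define S where "S = {p \<in> coprime_ratios q H b. real (max (fst p) (snd p)) \<le> Z}"
  define S1 where "S1 = {p \<in> S. snd p \<le> fst p}"
  define S2 where "S2 = prod.swap ` {p \<in> S. fst p \<le> snd p}"
  have fin: "finite S" unfolding S_def by simp
  have sep: "\<bar>int n * int m' - int n' * int m\<bar> \<ge> int q"
    if "(m, n) \<in> S" "(m', n') \<in> S" "(m, n) \<noteq> (m', n')" for m n m' n'
  proof -
    have "n * m' \<noteq> n' * m"
    proof
      assume eq: "n * m' = n' * m"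
      have "(m, n) = (m', n')"
        by (rule coprime_cross_eq[OF _ _ eq])
           (use that in \<open>auto simp: S_def coprime_ratios_def ratio_class_def\<close>)
      thus False using that by blast
    qed
    hence "int n * int m' - int n' * int m \<noteq> 0" by (simp flip: of_nat_mult)
    moreover have "int q dvd int n * int m' - int n' * int m"
      using that by (intro ratio_class_cross) (auto simp: S_def coprime_ratios_def)
    ultimately show ?thesis by (metis abs_of_nat dvd_imp_le_int)
  qed
  have "real (card S1) \<le> Z\<^sup>2 / q + 1"
  proof (rule card_separated_slopes)
    show "0 < m \<and> n \<le> m \<and> real m \<le> Z" if "(m, n) \<in> S1" for m n
      using that by (auto simp: S1_def S_def coprime_ratios_def ratio_class_def)
    show "\<bar>int n * int m' - int n' * int m\<bar> \<ge> int q"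
      if "(m, n) \<in> S1" "(m', n') \<in> S1" "(m, n) \<noteq> (m', n')" for m n m' n'
      using that by (intro sep) (auto simp: S1_def)
  qed (use fin Z q_pos in \<open>auto simp: S1_def\<close>)
  moreover have "real (card S2) \<le> Z\<^sup>2 / q + 1"
  proof (rule card_separated_slopes)
    show "0 < m \<and> n \<le> m \<and> real m \<le> Z" if "(m, n) \<in> S2" for m n
      using that by (auto simp: S2_def S_def coprime_ratios_def ratio_class_def)
    show "\<bar>int n * int m' - int n' * int m\<bar> \<ge> int q"
      if "(m, n) \<in> S2" "(m', n') \<in> S2" "(m, n) \<noteq> (m', n')" for m n m' n'
    proof -
      have "\<bar>int m * int n' - int m' * int n\<bar> \<ge> int q"
        using that by (intro sep) (auto simp: S2_def)
      thus ?thesis by (simp add: abs_minus_commute mult.commute)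
    qed
  qed (use fin Z q_pos in \<open>auto simp: S2_def\<close>)
  moreover have "card S \<le> card S1 + card S2"
  proof -
    have "S = S1 \<union> {p \<in> S. fst p \<le> snd p}" by (auto simp: S1_def)
    hence "card S \<le> card S1 + card {p \<in> S. fst p \<le> snd p}" by (metis card_Un_le)
    also have "card {p \<in> S. fst p \<le> snd p} = card S2"
      unfolding S2_def by (rule card_image[symmetric]) (auto intro: inj_onI)
    finally show ?thesis by simp
  qed
  moreover have "real (card S) \<le> real (card S1) + real (card S2)"
    using calculation(3) by linarith
  ultimately have "real (card S) \<le> 2 * (Z\<^sup>2 / q + 1)" by argo
  thus ?thesis unfolding S_def .
qed

text \<open>M < 2^M shows that the least level exists and is at most M, so that fractions of height
  at most \<open>H\<close> occupy finitely many levels.\<close>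

lemma dyadic_level_le: "q > 0 \<Longrightarrow> (max (fst p) (snd p))\<^sup>2 \<le> 4 ^ dyadic_level q p * q"
  and dyadic_level_bound: "q > 0 \<Longrightarrow> dyadic_level q p \<le> max (fst p) (snd p)"
proof -
  assume q: "q > 0"
  let ?M = "max (fst p) (snd p)"
  have "?M < 2 ^ ?M" by (rule less_exp)
  hence "?M\<^sup>2 \<le> (2 ^ ?M)\<^sup>2" by (rule power_mono[OF less_imp_le]) simp
  also have "\<dots> = 4 ^ ?M" by (simp add: power2_eq_square flip: power_mult_distrib)
  also have "\<dots> \<le> 4 ^ ?M * q" using q by simp
  finally have *: "?M\<^sup>2 \<le> 4 ^ ?M * q" .
  show "?M\<^sup>2 \<le> 4 ^ dyadic_level q p * q" unfolding dyadic_level_def by (rule LeastI[where P = "\<lambda>j. ?M\<^sup>2 \<le> 4 ^ j * q", OF *])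
  show "dyadic_level q p \<le> ?M" unfolding dyadic_level_def by (rule Least_le[where P = "\<lambda>j. ?M\<^sup>2 \<le> 4 ^ j * q", OF *])
qed

text \<open>At level \<open>j\<close> a box of side 2^j sqrt q holds at most 2 (4^j + 1) \<le> 4 *
  4^j fractions of weight 5 (2/9)^j; the resulting series 20 (8/9)^j sums to at most 20 * 9.\<close>

lemma (in odd_prime_modulus) sum_dyadic_weight:
  "(\<Sum>p\<in>coprime_ratios q H b. dyadic_weight q p) \<le> 180"
proof -
  let ?P = "coprime_ratios q H b"
  have sq: "(2 ^ j * sqrt q)\<^sup>2 = 4 ^ j * real q" for j
  proof -
    have "((2::real) ^ j)\<^sup>2 = (2\<^sup>2) ^ j" by (simp only: mult.commute flip: power_mult)
    thus ?thesis by (simp add: power_mult_distrib)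
  qed
  have sub: "dyadic_level q ` ?P \<subseteq> {..H}"
  proof
    fix j assume "j \<in> dyadic_level q ` ?P"
    then obtain p where p: "p \<in> ?P" "j = dyadic_level q p" by blast
    have "max (fst p) (snd p) \<le> H" using p by (auto simp: coprime_ratios_def ratio_class_def)
    hence "dyadic_level q p \<le> H" using dyadic_level_bound[OF q_pos(1), of p] by (rule le_trans[rotated])
    thus "j \<in> {..H}" using p by simp
  qed
  have "(\<Sum>p\<in>?P. dyadic_weight q p)
      = (\<Sum>j\<in>{..H}. \<Sum>p\<in>{p \<in> ?P. dyadic_level q p = j}. dyadic_weight q p)"
    by (rule sum.group[symmetric]) (use sub in auto)
  also have "\<dots> \<le> (\<Sum>j\<in>{..H}. 20 * (8 / 9) ^ j)"
  proof (rule sum_mono)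
    fix j :: nat
    have "(\<Sum>p\<in>{p \<in> ?P. dyadic_level q p = j}. dyadic_weight q p)
        = real (card {p \<in> ?P. dyadic_level q p = j}) * (5 * (2 / 9) ^ j)"
      by (simp add: dyadic_weight_def)
    also have "real (card {p \<in> ?P. dyadic_level q p = j})
        \<le> real (card {p \<in> ?P. real (max (fst p) (snd p)) \<le> 2 ^ j * sqrt q})"
    proof (intro of_nat_mono card_mono subsetI)
      fix p assume p: "p \<in> {p \<in> ?P. dyadic_level q p = j}"
      hence "(max (fst p) (snd p))\<^sup>2 \<le> 4 ^ j * q" using dyadic_level_le[of q p] q_pos by simp
      hence "real ((max (fst p) (snd p))\<^sup>2) \<le> real (4 ^ j * q)" by (rule of_nat_mono)
      hence "(real (max (fst p) (snd p)))\<^sup>2 \<le> (2 ^ j * sqrt q)\<^sup>2"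
        unfolding sq by simp
      hence "real (max (fst p) (snd p)) \<le> 2 ^ j * sqrt q"
        by (rule power2_le_imp_le) simp
      thus "p \<in> {p \<in> ?P. real (max (fst p) (snd p)) \<le> 2 ^ j * sqrt q}" using p by simp
    qed simp
    also have "\<dots> \<le> 2 * ((2 ^ j * sqrt q)\<^sup>2 / q + 1)"
      by (rule card_coprime_ratios_box) (use q_pos in simp)
    also have "(2 ^ j * sqrt q)\<^sup>2 / q = 4 ^ j"
      using q_pos unfolding sq by simp
    also have "2 * (4 ^ j + 1) \<le> 4 * (4 ^ j :: real)" by simp
    also have "4 * (4 ^ j :: real) * (5 * (2 / 9) ^ j) = 20 * (8 / 9) ^ j"
      by (simp flip: power_mult_distrib)
    finally show "(\<Sum>p\<in>{p \<in> ?P. dyadic_level q p = j}. dyadic_weight q p) \<le> 20 * (8 / 9) ^ j"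
      by (simp add: mult_right_mono)
  qed
  also have "\<dots> = 20 * (\<Sum>j\<le>H. (8 / 9 :: real) ^ j)" by (simp add: sum_distrib_left)
  also have "\<dots> \<le> 180" by (simp add: sum_gp0)
  finally show ?thesis .
qed

text \<open>With \<open>M\<close> the larger entry and y = q^(1/4) / M^(1/2), the second branch of
  \<open>kap\<close> at \<open>M\<close> is y^3 / sqrt M. Hence the cube of the product is at most
  min(1, y^9) (m n)^(-3/2), and it remains to dominate min(1, y^9) by the squared weight.\<close>

lemma kap_cube_le:
  assumes q: "q > 0" and mn: "m > 0" "n > 0"
  shows "(kap q m * kap q n) ^ 3 / (dyadic_weight q (m, n))\<^sup>2 \<le> 1 / (real m * sqrt m) * (1 / (real n * sqrt n))"
proof -
  define M where "M = max m n"
  have M: "M > 0" using mn by (simp add: M_def)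
  define j where "j = dyadic_level q (m, n)"
  define y where "y = sqrt (sqrt q) / sqrt M"
  have y: "y \<ge> 0" by (simp add: y_def)
  have y4: "y ^ 4 = real q / (real M)\<^sup>2"
  proof -
    have "y ^ 4 = (y\<^sup>2)\<^sup>2" by simp
    also have "y\<^sup>2 = sqrt q / M" by (simp add: y_def power_divide)
    also have "(sqrt q / M)\<^sup>2 = real q / (real M)\<^sup>2" by (simp add: power_divide)
    finally show ?thesis .
  qed
  define e where "e k = 1 / (real k * sqrt k)" for k
  have cube: "(1 / sqrt (real k)) ^ 3 = e k" for k
    by (simp add: e_def power3_eq_cube)
  have k1: "kap q k ^ 3 \<le> e k" for k
    using power_mono[of "kap q k" "1 / sqrt k" 3] kap_nonneg unfolding cube by (simp add: kap_def)
  have k2: "kap q M ^ 3 \<le> y ^ 9 * e M"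
  proof -
    have "kap q M \<le> sqrt (sqrt q) ^ 3 / M\<^sup>2" by (simp add: kap_def)
    also have "\<dots> = y ^ 3 * (1 / sqrt M)"
      using M by (simp add: y_def power_divide power3_eq_cube power2_eq_square flip: real_sqrt_mult)
    finally have "kap q M ^ 3 \<le> (y ^ 3 * (1 / sqrt M)) ^ 3" by (intro power_mono kap_nonneg)
    also have "\<dots> = y ^ 9 * e M" unfolding power_mult_distrib cube by (simp flip: power_mult)
    finally show ?thesis .
  qed
  have e: "e k \<ge> 0" for k by (simp add: e_def)
  have min: "(kap q m * kap q n) ^ 3 \<le> min 1 (y ^ 9) * (e m * e n)"
  proof -
    have "(kap q m * kap q n) ^ 3 \<le> y ^ 9 * (e m * e n)"
    proof (cases "n \<le> m")
      case True
      hence "M = m" by (simp add: M_def)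
      hence "kap q m ^ 3 * kap q n ^ 3 \<le> (y ^ 9 * e m) * e n"
        using k1[of n] k2 e y kap_nonneg by (intro mult_mono) auto
      thus ?thesis by (simp add: power_mult_distrib mult_ac)
    next
      case False
      hence "M = n" by (simp add: M_def)
      hence "kap q m ^ 3 * kap q n ^ 3 \<le> e m * (y ^ 9 * e n)"
        using k1[of m] k2 e y kap_nonneg by (intro mult_mono) auto
      thus ?thesis by (simp add: power_mult_distrib mult_ac)
    qed
    moreover have "(kap q m * kap q n) ^ 3 \<le> 1 * (e m * e n)"
      unfolding power_mult_distrib using k1 e kap_nonneg by (simp add: mult_mono)
    ultimately show ?thesis by (simp add: min_def)
  qed
  have w: "min 1 (y ^ 9) \<le> (dyadic_weight q (m, n))\<^sup>2"
  proof (cases j)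
    case 0
    thus ?thesis by (simp add: dyadic_weight_def j_def[symmetric])
  next
    case (Suc i)
    have "\<not> M\<^sup>2 \<le> 4 ^ i * q"
    proof
      assume "M\<^sup>2 \<le> 4 ^ i * q"
      hence "dyadic_level q (m, n) \<le> i" unfolding dyadic_level_def by (intro Least_le) (simp add: M_def)
      thus False using Suc by (simp add: j_def)
    qed
    hence "real (M\<^sup>2) > real (4 ^ i * q)" by (simp only: of_nat_less_iff not_le)
    hence "(real M)\<^sup>2 \<ge> 4 ^ i * real q" by simp
    hence "y ^ 4 \<le> (1 / 4) ^ i"
      unfolding y4 using M by (simp add: field_simps power_divide)
    \<comment> \<open>71/100 is a rational just above 2^(-1/2) whose ninth power is still below
      4/81, the square of 2/9.\<close>
    also have "(1 / 4 :: real) ^ i \<le> ((71 / 100) ^ 4) ^ i" by (intro power_mono) (simp_all add: eval_nat_numeral)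
    also have "\<dots> = ((71 / 100) ^ i) ^ 4" by (simp add: mult.commute flip: power_mult)
    finally have "y \<le> (71 / 100) ^ i" by (rule power_le_imp_le_base[of _ 3, simplified]) simp
    hence "y ^ 9 \<le> ((71 / 100) ^ i) ^ 9" using y by (intro power_mono)
    also have "\<dots> = ((71 / 100) ^ 9) ^ i" by (simp add: mult.commute flip: power_mult)
    also have "\<dots> \<le> (4 / 81 :: real) ^ i" by (intro power_mono) (simp_all add: eval_nat_numeral)
    also have "\<dots> \<le> (100 / 81) * (4 / 81 :: real) ^ i" by simp
    also have "\<dots> = 25 * (4 / 81) ^ Suc i" by simp
    also have "\<dots> = (dyadic_weight q (m, n))\<^sup>2"
    proof -
      have "((2 / 9 :: real) ^ Suc i)\<^sup>2 = ((2 / 9)\<^sup>2) ^ Suc i" by (simp only: mult.commute flip: power_mult)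
      also have "(2 / 9 :: real)\<^sup>2 = 4 / 81" by (simp add: power2_eq_square)
      finally show ?thesis unfolding dyadic_weight_def j_def[symmetric] Suc power_mult_distrib by simp
    qed
    finally show ?thesis by simp
  qed
  have "(dyadic_weight q (m, n))\<^sup>2 > 0" by (simp add: dyadic_weight_def)
  moreover have "(kap q m * kap q n) ^ 3 \<le> (dyadic_weight q (m, n))\<^sup>2 * (e m * e n)"
    using min w e by (smt (verit) mult_right_mono mult_nonneg_nonneg)
  ultimately show ?thesis unfolding e_def by (simp add: divide_le_eq mult.commute)
qed

context odd_prime_modulus
begin

text \<open>\<open>cube_sum_le\<close> with the dyadic weights, whose total is bounded independently
  of \<open>b\<close>. With equal weights the square of the number of fractions would be lost, which
  is not bounded at large height.\<close>

lemma sum_kap_coprime_cube: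
  "(\<Sum>p\<in>coprime_ratios q H b. kap q (fst p) * kap q (snd p)) ^ 3
    \<le> 180\<^sup>2 * (\<Sum>p\<in>coprime_ratios q H b. 1 / (real (fst p) * sqrt (fst p)) * (1 / (real (snd p) * sqrt (snd p))))"
proof -
  let ?P = "coprime_ratios q H b"
  let ?x = "\<lambda>p. kap q (fst p) * kap q (snd p)"
  let ?e = "\<lambda>p. 1 / (real (fst p) * sqrt (fst p)) * (1 / (real (snd p) * sqrt (snd p)))"
  have "(\<Sum>p\<in>?P. ?x p) ^ 3 \<le> (\<Sum>p\<in>?P. dyadic_weight q p)\<^sup>2 * (\<Sum>p\<in>?P. ?x p ^ 3 / (dyadic_weight q p)\<^sup>2)"
    by (rule cube_sum_le) (auto simp: dyadic_weight_def kap_nonneg)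
  also have "\<dots> \<le> 180\<^sup>2 * (\<Sum>p\<in>?P. ?e p)"
  proof (rule mult_mono)
    show "(\<Sum>p\<in>?P. dyadic_weight q p)\<^sup>2 \<le> 180\<^sup>2"
      using sum_dyadic_weight by (intro power_mono sum_nonneg) (auto simp: dyadic_weight_def)
    show "(\<Sum>p\<in>?P. ?x p ^ 3 / (dyadic_weight q p)\<^sup>2) \<le> (\<Sum>p\<in>?P. ?e p)"
    proof (rule sum_mono)
      fix p assume "p \<in> ?P"
      hence "fst p > 0" "snd p > 0" by (auto simp: coprime_ratios_def ratio_class_def)
      thus "?x p ^ 3 / (dyadic_weight q p)\<^sup>2 \<le> ?e p"
        using kap_cube_le[of q "fst p" "snd p"] q_pos by simp
    qed
  qed (auto intro!: sum_nonneg simp: kap_nonneg)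
  finally show ?thesis .
qed

text \<open>Write a pair as g times a reduced pair. As g \<le> H < q is invertible, the reduced pair
  stays in the class, and each \<open>kap\<close> yields a factor g^(-1/2). Summing 1 / g produces
  the harmonic number, the source of the logarithms in the second moment.\<close>

lemma sum_kap_ratio_class_le:
  assumes "H < q"
  shows "(\<Sum>p\<in>ratio_class q H b. kap q (fst p) * kap q (snd p))
    \<le> harm H * (\<Sum>p\<in>coprime_ratios q H b. kap q (fst p) * kap q (snd p))"
proof -
  let ?R = "ratio_class q H b" and ?P = "coprime_ratios q H b"
  let ?x = "\<lambda>p. kap q (fst p) * kap q (snd p)"
  define f where "f p = (gcd (fst p) (snd p), (fst p div gcd (fst p) (snd p), snd p div gcd (fst p) (snd p)))"
    for p :: "nat \<times> nat"
  have inv: "p = (fst (f p) * fst (snd (f p)), fst (f p) * snd (snd (f p)))" for p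
    by (simp add: f_def)
  have inj: "inj_on f ?R"
  proof (rule inj_onI)
    fix p p' assume eq: "f p = f p'"
    have "p = (fst (f p) * fst (snd (f p)), fst (f p) * snd (snd (f p)))" by (rule inv)
    also have "\<dots> = p'" unfolding eq by (rule inv[symmetric])
    finally show "p = p'" .
  qed
  have mem: "f p \<in> {1..H} \<times> ?P" and le: "?x p \<le> 1 / real (fst (f p)) * ?x (snd (f p))" if p: "p \<in> ?R" for p
  proof -
    define g where "g = gcd (fst p) (snd p)"
    define m where "m = fst p div g"
    define n where "n = snd p div g"
    have pos: "fst p \<ge> 1" "snd p \<ge> 1" "fst p \<le> H" "snd p \<le> H" and cong: "[fst p = b * snd p] (mod q)"
      using p by (auto simp: ratio_class_def)
    have g: "g \<ge> 1" using pos by (simp add: g_def Suc_le_eq)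
    have gH: "g \<le> H" using pos gcd_le1_nat[of "fst p" "snd p"] unfolding g_def by linarith
    have eq: "fst p = g * m" "snd p = g * n" by (simp_all add: g_def m_def n_def)
    have mn: "m \<ge> 1" "n \<ge> 1" using pos unfolding eq by (simp_all add: Suc_le_eq)
    have "m \<le> fst p" "n \<le> snd p" using g unfolding eq by simp_all
    hence mnH: "m \<le> H" "n \<le> H" using pos by linarith+
    have cop: "coprime m n" using pos unfolding m_def n_def g_def by (intro div_gcd_coprime) auto
    have "coprime g q" using g gH assms by (intro coprime_q) auto
    moreover have "[g * m = g * (b * n)] (mod q)" using cong unfolding eq by (simp add: mult.left_commute)
    ultimately have "[m = b * n] (mod q)" by (simp add: cong_mult_lcancel_nat)
    thus "f p \<in> {1..H} \<times> ?P"
      using g gH mn mnH cop by (simp add: f_def g_def[symmetric] m_def[symmetric] n_def[symmetric] coprime_ratios_def ratio_class_def)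
    have "?x p \<le> (kap q m / sqrt g) * (kap q n / sqrt g)"
      unfolding eq using g by (intro mult_mono kap_mult_le kap_nonneg divide_nonneg_nonneg) auto
    also have "\<dots> = 1 / real g * (kap q m * kap q n)" using g by (simp add: field_simps)
    finally show "?x p \<le> 1 / real (fst (f p)) * ?x (snd (f p))"
      by (simp add: f_def g_def[symmetric] m_def[symmetric] n_def[symmetric])
  qed
  have "(\<Sum>p\<in>?R. ?x p) \<le> (\<Sum>p\<in>?R. 1 / real (fst (f p)) * ?x (snd (f p)))"
    using le by (rule sum_mono)
  also have "\<dots> = (\<Sum>t\<in>f ` ?R. 1 / real (fst t) * ?x (snd t))"
    by (rule sum.reindex[OF inj, unfolded o_def, symmetric])
  also have "\<dots> \<le> (\<Sum>t\<in>{1..H} \<times> ?P. 1 / real (fst t) * ?x (snd t))"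
  proof (rule sum_mono2)
    show "f ` ?R \<subseteq> {1..H} \<times> ?P" using mem by (rule image_subsetI)
    show "0 \<le> 1 / real (fst t) * ?x (snd t)" for t by (simp add: kap_nonneg)
  qed simp
  also have "\<dots> = (\<Sum>g\<in>{1..H}. \<Sum>p\<in>?P. 1 / real g * ?x p)"
    by (simp add: sum.cartesian_product case_prod_unfold)
  also have "\<dots> = (\<Sum>g\<in>{1..H}. 1 / real g) * (\<Sum>p\<in>?P. ?x p)"
    by (simp only: sum_product)
  also have "(\<Sum>g\<in>{1..H}. 1 / real g) = harm H" by (simp add: harm_def inverse_eq_divide)
  finally show ?thesis .
qed

text \<open>A pair determines its class because its second entry is invertible. So the classes are
  disjoint, and the total is at most the square of the sum of m^(-3/2).\<close>

lemma sum_coprime_ratios_three_halves: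
  assumes "H < q"
  shows "(\<Sum>b\<in>{1..<q}. \<Sum>p\<in>coprime_ratios q H b. 1 / (real (fst p) * sqrt (fst p)) * (1 / (real (snd p) * sqrt (snd p)))) \<le> 9"
proof -
  let ?e = "\<lambda>m::nat. 1 / (real m * sqrt m)"
  have "(\<Sum>b\<in>{1..<q}. \<Sum>p\<in>coprime_ratios q H b. ?e (fst p) * ?e (snd p))
      = (\<Sum>p\<in>(\<Union>b\<in>{1..<q}. coprime_ratios q H b). ?e (fst p) * ?e (snd p))"
  proof (rule sum.UNION_disjoint[symmetric])
    show "\<forall>b\<in>{1..<q}. \<forall>c\<in>{1..<q}. b \<noteq> c \<longrightarrow> coprime_ratios q H b \<inter> coprime_ratios q H c = {}"
    proof (intro ballI impI, rule ccontr)
      fix b c assume bc: "b \<in> {1..<q}" "c \<in> {1..<q}" "b \<noteq> c" "coprime_ratios q H b \<inter> coprime_ratios q H c \<noteq> {}"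
      then obtain p where "p \<in> coprime_ratios q H b" "p \<in> coprime_ratios q H c" by blast
      then obtain m n where "[m = b * n] (mod q)" "[m = c * n] (mod q)" "n \<in> {1..H}"
        by (cases p) (auto simp: coprime_ratios_def ratio_class_def)
      hence "[b * n = c * n] (mod q)" "coprime n q"
        using assms by (auto intro: cong_trans cong_sym coprime_q)
      hence "[b = c] (mod q)" by (simp add: cong_mult_rcancel_nat)
      thus False using bc cong_imp_eq by blast
    qed
  qed auto
  also have "\<dots> \<le> (\<Sum>p\<in>{1..H} \<times> {1..H}. ?e (fst p) * ?e (snd p))"
    by (rule sum_mono2) (auto simp: coprime_ratios_def ratio_class_def)
  also have "\<dots> = (\<Sum>m\<in>{1..H}. ?e m) * (\<Sum>m\<in>{1..H}. ?e m)"
    by (simp only: sum_product sum.cartesian_product case_prod_unfold)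
  also have "\<dots> \<le> 3 * 3"
    by (intro mult_mono sum_inverse_three_halves sum_nonneg) auto
  finally show ?thesis by simp
qed

text \<open>The constant is 180^2 from the weights times 9 from the sum over reduced
  fractions.\<close>

lemma sum_kap_ratio_class_cube:
  assumes "H < q"
  shows "(\<Sum>b\<in>{1..<q}. (\<Sum>p\<in>ratio_class q H b. kap q (fst p) * kap q (snd p)) ^ 3) \<le> 291600 * harm H ^ 3"
proof -
  let ?x = "\<lambda>p. kap q (fst p) * kap q (snd p)"
  let ?e = "\<lambda>p. 1 / (real (fst p) * sqrt (fst p)) * (1 / (real (snd p) * sqrt (snd p)))"
  have nn: "(\<Sum>p\<in>S. ?x p) \<ge> 0" for S by (intro sum_nonneg) (simp add: kap_nonneg)
  have "(\<Sum>b\<in>{1..<q}. (\<Sum>p\<in>ratio_class q H b. ?x p) ^ 3)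
      \<le> (\<Sum>b\<in>{1..<q}. harm H ^ 3 * (180\<^sup>2 * (\<Sum>p\<in>coprime_ratios q H b. ?e p)))"
  proof (rule sum_mono)
    fix b
    have "(\<Sum>p\<in>ratio_class q H b. ?x p) ^ 3 \<le> (harm H * (\<Sum>p\<in>coprime_ratios q H b. ?x p)) ^ 3"
      using assms nn by (intro power_mono sum_kap_ratio_class_le)
    also have "\<dots> = harm H ^ 3 * (\<Sum>p\<in>coprime_ratios q H b. ?x p) ^ 3" by (rule power_mult_distrib)
    also have "\<dots> \<le> harm H ^ 3 * (180\<^sup>2 * (\<Sum>p\<in>coprime_ratios q H b. ?e p))"
      by (intro mult_left_mono sum_kap_coprime_cube zero_le_power harm_nonneg)
    finally show "(\<Sum>p\<in>ratio_class q H b. ?x p) ^ 3 \<le> harm H ^ 3 * (180\<^sup>2 * (\<Sum>p\<in>coprime_ratios q H b. ?e p))" .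
  qed
  also have "\<dots> = harm H ^ 3 * (180\<^sup>2 * (\<Sum>b\<in>{1..<q}. \<Sum>p\<in>coprime_ratios q H b. ?e p))"
    by (simp add: sum_distrib_left)
  also have "\<dots> \<le> harm H ^ 3 * (180\<^sup>2 * 9)"
    by (intro mult_left_mono sum_coprime_ratios_three_halves assms zero_le_power harm_nonneg) auto
  finally show ?thesis by simp
qed

end

section \<open>Trigonometric sums\<close>

lemma abel_summation_bound:
  fixes u :: "nat \<Rightarrow> real" and c :: "nat \<Rightarrow> complex"
  assumes dec: "\<And>n. n \<ge> M \<Longrightarrow> u (Suc n) \<le> u n" and nonneg: "\<And>n. n \<ge> M \<Longrightarrow> 0 \<le> u n"
    and bnd: "\<And>k. norm (\<Sum>n\<in>{M..k}. c n) \<le> B"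
  shows "norm (\<Sum>n\<in>{M..K}. of_real (u n) * c n) \<le> B * u M"
proof -
  have B: "B \<ge> 0" using bnd[of M] norm_ge_zero order_trans by blast
  define S where "S k = (\<Sum>n\<in>{M..k}. c n)" for k
  \<comment> \<open>The induction follows the weighted sum minus its boundary term: each step adds
    (u(n) - u(n+1)) S(n), and these bounds telescope.\<close>
  have step: "norm ((\<Sum>n\<in>{M..M+j}. of_real (u n) * c n) - of_real (u (M + j)) * S (M + j)) \<le> B * (u M - u (M + j))" for j
  proof (induction j)
    case (Suc j)
    let ?T = "\<lambda>j. (\<Sum>n\<in>{M..M+j}. of_real (u n) * c n)"
    have T: "?T (Suc j) = ?T j + of_real (u (M + Suc j)) * c (M + Suc j)"
      and S: "S (M + Suc j) = S (M + j) + c (M + Suc j)"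
      by (simp_all add: S_def)
    have "?T (Suc j) - of_real (u (M + Suc j)) * S (M + Suc j)
        = (?T j - of_real (u (M + j)) * S (M + j)) + of_real (u (M + j) - u (M + Suc j)) * S (M + j)"
      unfolding T S by (simp add: algebra_simps)
    also have "norm \<dots> \<le> norm (?T j - of_real (u (M + j)) * S (M + j)) + norm (of_real (u (M + j) - u (M + Suc j)) * S (M + j))"
      by (rule norm_triangle_ineq)
    also have "norm (of_real (u (M + j) - u (M + Suc j)) * S (M + j)) = (u (M + j) - u (M + Suc j)) * norm (S (M + j))"
      using dec[of "M + j"] by (simp only: norm_mult norm_of_real) simp
    also have "\<dots> \<le> (u (M + j) - u (M + Suc j)) * B"
      using dec[of "M + j"] bnd unfolding S_def by (intro mult_left_mono) auto
    also have "norm (?T j - of_real (u (M + j)) * S (M + j)) \<le> B * (u M - u (M + j))" by (rule Suc.IH)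
    finally show ?case by (simp add: algebra_simps)
  qed (simp add: S_def)
  show ?thesis
  proof (cases "K \<ge> M")
    case True
    then obtain j where K: "K = M + j" using le_Suc_ex by blast
    let ?T = "(\<Sum>n\<in>{M..K}. of_real (u n) * c n)"
    have "?T = (?T - of_real (u K) * S K) + of_real (u K) * S K" by simp
    also have "norm \<dots> \<le> norm (?T - of_real (u K) * S K) + norm (of_real (u K) * S K)" by (rule norm_triangle_ineq)
    also have "norm (of_real (u K) * S K) = u K * norm (S K)" using nonneg[of K] True by (simp add: norm_mult)
    also have "\<dots> \<le> u K * B" using nonneg[of K] True bnd unfolding S_def by (intro mult_left_mono) auto
    also have "norm (?T - of_real (u K) * S K) \<le> B * (u M - u K)" using step[of j] K by simp
    finally show ?thesis by (simp add: algebra_simps)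
  qed (use B nonneg in simp)
qed

lemma sum_inverse_sqrt: "(\<Sum>n\<in>{1..N}. 1 / sqrt (real n)) \<le> 2 * sqrt (real N)"
proof (induction N)
  case (Suc N)
  define x where "x = sqrt (real N)"
  define y where "y = sqrt (real (Suc N))"
  have y: "y > 0" and xy: "y\<^sup>2 = x\<^sup>2 + 1" and le: "x \<le> y" by (simp_all add: x_def y_def)
  have "(y - x) * (y + x) = 1" using xy by (simp add: power2_eq_square algebra_simps)
  moreover have "(y - x) * (y + x) \<le> (y - x) * (2 * y)" using le by (intro mult_left_mono) auto
  ultimately have "1 \<le> 2 * (y - x) * y" by (simp add: mult_ac)
  hence "1 / y \<le> 2 * (y - x)" using y by (simp add: divide_le_eq)
  hence "1 / sqrt (real (Suc N)) \<le> 2 * sqrt (real (Suc N)) - 2 * sqrt (real N)" by (simp add: x_def y_def)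
  moreover have "(\<Sum>n\<in>{1..Suc N}. 1 / sqrt (real n)) = (\<Sum>n\<in>{1..N}. 1 / sqrt (real n)) + 1 / sqrt (real (Suc N))" by simp
  ultimately show ?case using Suc.IH by linarith
qed simp

lemma norm_geometric_sum_le:
  fixes z :: complex
  assumes "norm z = 1" "z \<noteq> 1"
  shows "norm (\<Sum>n\<in>{M..k}. z ^ n) \<le> 2 / norm (1 - z)"
proof (cases "M \<le> k")
  case True
  have "norm ((1 - z) * (\<Sum>n\<in>{M..k}. z ^ n)) = norm (z ^ M - z ^ Suc k)"
    using True by (subst sum_gp_multiplied) auto
  also have "\<dots> \<le> norm (z ^ M) + norm (z ^ Suc k)" by (rule norm_triangle_ineq4)
  also have "\<dots> = 2" using assms by (simp add: norm_power norm_mult)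
  finally show ?thesis using assms by (simp add: norm_mult le_divide_eq mult.commute)
qed (use assms in simp)

text \<open>Cut at N of order 1 / |1 - z|: the trivial estimate 2 sqrt N up to there, Abel summation
  against a geometric sum beyond. The two parts contribute 4 and 2.\<close>

lemma trig_sum_bound_sqrt:
  fixes z :: complex and u :: "nat \<Rightarrow> real"
  assumes z: "norm z = 1" "z \<noteq> 1"
    and dec: "\<And>n. n \<ge> 1 \<Longrightarrow> u (Suc n) \<le> u n" and nonneg: "\<And>n. n \<ge> 1 \<Longrightarrow> 0 \<le> u n"
    and le: "\<And>n. n \<ge> 1 \<Longrightarrow> u n \<le> 1 / sqrt (real n)"
  shows "norm (\<Sum>n\<in>{1..K}. of_real (u n) * z ^ n) \<le> 6 / sqrt (norm (1 - z))"
proof -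
  define d where "d = norm (1 - z)"
  have d: "d > 0" "d \<le> 2" using z norm_triangle_ineq4[of 1 z] by (auto simp: d_def)
  define N where "N = nat \<lceil>1 / d\<rceil>"
  have N1: "real N \<ge> 1 / d" unfolding N_def by (rule real_nat_ceiling_ge)
  have "real N \<le> 1 / d + 1" unfolding N_def using d by simp
  hence N2: "real N \<le> 3 / d" using d by (simp add: field_simps)
  have N: "N \<ge> 1" using N1 d by (metis divide_pos_pos gr0I less_numeral_extra(1) not_less of_nat_0 One_nat_def Suc_leI)
  have small: "norm (\<Sum>n\<in>{1..k}. of_real (u n) * z ^ n) \<le> 2 * sqrt (real k)" for k
  proof -
    have "norm (\<Sum>n\<in>{1..k}. of_real (u n) * z ^ n) \<le> (\<Sum>n\<in>{1..k}. 1 / sqrt (real n))"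
      using z le nonneg by (intro sum_norm_le) (simp add: norm_mult norm_power)
    thus ?thesis using sum_inverse_sqrt[of k] by linarith
  qed
  have sq: "2 * sqrt (real N) \<le> 4 / sqrt d"
  proof -
    have "sqrt (real N) \<le> sqrt (4 / d)" using N2 d by (intro real_sqrt_le_mono) (use divide_right_mono[of 3 4 d] in linarith)
    also have "\<dots> = 2 / sqrt d" by (simp add: real_sqrt_divide)
    finally show ?thesis by simp
  qed
  show ?thesis
  proof (cases "K \<le> N")
    case True
    have "norm (\<Sum>n\<in>{1..K}. of_real (u n) * z ^ n) \<le> 2 * sqrt (real K)" by (rule small)
    also have "\<dots> \<le> 2 * sqrt (real N)" using True by simp
    also have "\<dots> \<le> 4 / sqrt d" by (rule sq)
    also have "\<dots> \<le> 6 / sqrt d" using d by (intro divide_right_mono) auto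
    finally show ?thesis by (simp add: d_def)
  next
    case False
    have tail: "norm (\<Sum>n\<in>{Suc N..K}. of_real (u n) * z ^ n) \<le> 2 / d * u (Suc N)"
    proof (rule abel_summation_bound)
      show "norm (\<Sum>n = Suc N..k. z ^ n) \<le> 2 / d" for k unfolding d_def using z by (rule norm_geometric_sum_le)
    qed (use dec nonneg N in auto)
    have "u (Suc N) \<le> 1 / sqrt (real (Suc N))" by (rule le) simp
    also have "\<dots> \<le> 1 / sqrt (1 / d)" using N1 d by (intro divide_left_mono real_sqrt_le_mono) auto
    also have "\<dots> = sqrt d" by (simp add: real_sqrt_divide)
    finally have "2 / d * u (Suc N) \<le> 2 / d * sqrt d" using d by (intro mult_left_mono) auto
    also have "\<dots> = 2 / sqrt d" using d real_sqrt_mult_self[of d] by (simp add: field_simps)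
    finally have tail': "norm (\<Sum>n\<in>{Suc N..K}. of_real (u n) * z ^ n) \<le> 2 / sqrt d" using tail by linarith
    have "{1..K} = {1..N} \<union> {Suc N..K}" using False N by auto
    hence "(\<Sum>n\<in>{1..K}. of_real (u n) * z ^ n) = (\<Sum>n\<in>{1..N}. of_real (u n) * z ^ n) + (\<Sum>n\<in>{Suc N..K}. of_real (u n) * z ^ n)"
      by (simp only:) (intro sum.union_disjoint; auto)
    hence "norm (\<Sum>n\<in>{1..K}. of_real (u n) * z ^ n)
        = norm ((\<Sum>n\<in>{1..N}. of_real (u n) * z ^ n) + (\<Sum>n\<in>{Suc N..K}. of_real (u n) * z ^ n))"
      by (rule arg_cong)
    hence "norm (\<Sum>n\<in>{1..K}. of_real (u n) * z ^ n) \<le> 2 * sqrt (real N) + 2 / sqrt d"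
      using small[of N] tail' norm_triangle_ineq[of "\<Sum>n\<in>{1..N}. of_real (u n) * z ^ n" "\<Sum>n\<in>{Suc N..K}. of_real (u n) * z ^ n"]
      by linarith
    also have "\<dots> \<le> 4 / sqrt d + 2 / sqrt d" using sq by simp
    also have "\<dots> = 6 / sqrt d" by (simp add: add_divide_distrib[symmetric])
    finally show ?thesis by (simp add: d_def)
  qed
qed

text \<open>Two summations by parts at once: multiplying by (1 - z)^2 takes second differences of
  the coefficients. The value \<open>d 0 = 0\<close> lets the coefficient of z^2 be a second
  difference as well.\<close>

lemma second_difference_identity:
  fixes z :: complex and d :: "nat \<Rightarrow> real"
  assumes "d 0 = 0"
  shows "(1 - z)\<^sup>2 * (\<Sum>n\<in>{1..Suc K}. of_real (d n) * z ^ n)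
    = of_real (d 1) * z + (\<Sum>n<K. of_real (d (n + 2) - 2 * d (n + 1) + d n) * z ^ (n + 2))
      + of_real (d K - 2 * d (Suc K)) * z ^ (K + 2) + of_real (d (Suc K)) * z ^ (K + 3)"
proof (induction K)
  case 0
  show ?case using assms by (simp add: power2_eq_square power3_eq_cube algebra_simps eval_nat_numeral)
next
  case (Suc K)
  have "(1 - z)\<^sup>2 * (\<Sum>n\<in>{1..Suc (Suc K)}. of_real (d n) * z ^ n)
      = (1 - z)\<^sup>2 * (\<Sum>n\<in>{1..Suc K}. of_real (d n) * z ^ n) + (1 - z)\<^sup>2 * (of_real (d (K + 2)) * z ^ (K + 2))"
    by (simp add: ring_distribs)
  thus ?case unfolding Suc.IH by (simp add: power2_eq_square algebra_simps eval_nat_numeral)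
qed

text \<open>Decay |1 - z|^(-2) instead of the |1 - z|^(-1/2) available from monotonicity. The two
  boundary terms cost 3e and e.\<close>

lemma second_difference_bound:
  fixes z :: complex and d :: "nat \<Rightarrow> real"
  assumes z: "norm z = 1" and "d 0 = 0" and eps: "\<bar>d K\<bar> \<le> e" "\<bar>d (Suc K)\<bar> \<le> e"
  shows "(norm (1 - z))\<^sup>2 * norm (\<Sum>n\<in>{1..Suc K}. of_real (d n) * z ^ n)
    \<le> \<bar>d 1\<bar> + (\<Sum>n<K. \<bar>d (n + 2) - 2 * d (n + 1) + d n\<bar>) + 4 * e"
proof -
  let ?S = "\<Sum>n<K. of_real (d (n + 2) - 2 * d (n + 1) + d n) * z ^ (n + 2)"
  have "(norm (1 - z))\<^sup>2 * norm (\<Sum>n\<in>{1..Suc K}. of_real (d n) * z ^ n)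
      = norm (of_real (d 1) * z + ?S + of_real (d K - 2 * d (Suc K)) * z ^ (K + 2) + of_real (d (Suc K)) * z ^ (K + 3))"
    by (subst second_difference_identity[where K = K and d = d and z = z, OF assms(2), symmetric]) (simp add: norm_mult norm_power)
  also have "\<dots> \<le> norm (of_real (d 1) * z) + norm ?S + norm (of_real (d K - 2 * d (Suc K)) * z ^ (K + 2)) + norm (of_real (d (Suc K)) * z ^ (K + 3))"
    by (intro norm_triangle_le add_mono order_refl)
  also have "norm (of_real (d 1) * z) = \<bar>d 1\<bar>" using z by (simp add: norm_mult)
  also have "norm (of_real (d K - 2 * d (Suc K)) * z ^ (K + 2)) = \<bar>d K - 2 * d (Suc K)\<bar>"
    using z by (simp only: norm_mult norm_power norm_of_real) simp
  also have "norm (of_real (d (Suc K)) * z ^ (K + 3)) = \<bar>d (Suc K)\<bar>"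
    using z by (simp only: norm_mult norm_power norm_of_real) simp
  also have "norm ?S \<le> (\<Sum>n<K. \<bar>d (n + 2) - 2 * d (n + 1) + d n\<bar>)"
    using z by (intro sum_norm_le) (simp only: norm_mult norm_power norm_of_real, simp)
  finally show ?thesis using eps by linarith
qed

text \<open>
  The splitting \<open>n\<^sup>-\<^sup>1\<^sup>/\<^sup>2 = fall + rise\<close> at \<open>Y \<approx> \<surd>q\<close>: \<open>fall\<close> is supported on \<open>n \<le> Y\<close>, and the parabola in \<open>rise\<close>
  keeps its total second difference as small as \<open>Y\<^sup>-\<^sup>3\<^sup>/\<^sup>2\<close>, so that its dual sum decays beyond \<open>\<surd>q\<close>.
\<close>

definition rise :: "nat \<Rightarrow> nat \<Rightarrow> real" where
  "rise Y n = (if n \<le> Y then (real n)\<^sup>2 / ((real Y)\<^sup>2 * sqrt Y) else 1 / sqrt n)"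

definition fall :: "nat \<Rightarrow> nat \<Rightarrow> real" where
  "fall Y n = 1 / sqrt n - rise Y n"

lemma rise_at: "Y \<ge> 1 \<Longrightarrow> rise Y Y = 1 / sqrt Y"
  by (simp add: rise_def)

lemma rise_nonneg: "rise Y n \<ge> 0"
  by (simp add: rise_def)

lemma fall_nonneg:
  assumes "n \<ge> 1"
  shows "fall Y n \<ge> 0"
proof (cases "n \<le> Y")
  case True
  have "(real n)\<^sup>2 * sqrt n \<le> (real Y)\<^sup>2 * sqrt Y" using True by (intro mult_mono power_mono) auto
  thus ?thesis using True assms by (simp add: fall_def rise_def field_simps)
qed (simp add: fall_def rise_def)

lemma rise_le: "n \<ge> 1 \<Longrightarrow> rise Y n \<le> 1 / sqrt n"
  using fall_nonneg[of n Y] by (simp add: fall_def)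

lemma fall_le: "fall Y n \<le> 1 / sqrt n"
  using rise_nonneg[of Y n] by (simp add: fall_def)

lemma fall_eq_0: "n > Y \<Longrightarrow> fall Y n = 0"
  by (simp add: fall_def rise_def)

lemma fall_decreasing:
  assumes "n \<ge> 1"
  shows "fall Y (Suc n) \<le> fall Y n"
proof (cases "Suc n \<le> Y")
  case True
  have "1 / sqrt (Suc n) \<le> 1 / sqrt n" using assms by (intro divide_left_mono) auto
  moreover have "(real n)\<^sup>2 / ((real Y)\<^sup>2 * sqrt Y) \<le> (real (Suc n))\<^sup>2 / ((real Y)\<^sup>2 * sqrt Y)"
    by (intro divide_right_mono power_mono) auto
  ultimately show ?thesis using True by (simp add: fall_def rise_def)
next
  case False
  hence "fall Y (Suc n) = 0" by (intro fall_eq_0) simp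
  thus ?thesis using fall_nonneg[OF assms] by simp
qed

text \<open>The middle value c satisfies c^2 \<le> a b, because n (n + 2) \<le> (n + 1)^2, and the
  inequality of the means gives 2 c \<le> a + b.\<close>

lemma inverse_sqrt_convex:
  assumes "n \<ge> (1::nat)"
  shows "1 / sqrt (n + 2) - 2 * (1 / sqrt (n + 1)) + 1 / sqrt n \<ge> 0"
proof -
  define a where "a = 1 / sqrt (real n)"
  define b where "b = 1 / sqrt (real n + 2)"
  define c where "c = 1 / sqrt (real n + 1)"
  have pos: "a > 0" "b > 0" "c > 0" using assms by (simp_all add: a_def b_def c_def)
  have "(c\<^sup>2)\<^sup>2 \<le> (a * b)\<^sup>2"
  proof -
    have "(c\<^sup>2)\<^sup>2 = 1 / (real n + 1)\<^sup>2" by (simp add: c_def power_divide)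
    also have "\<dots> \<le> 1 / (real n * (real n + 2))"
      using assms by (intro divide_left_mono mult_pos_pos zero_less_power) (auto simp: power2_eq_square algebra_simps)
    also have "\<dots> = (a * b)\<^sup>2" by (simp add: a_def b_def power_divide power_mult_distrib)
    finally show ?thesis .
  qed
  hence "c\<^sup>2 \<le> a * b" by (rule power2_le_imp_le) (use pos in simp)
  moreover have "4 * (a * b) \<le> (a + b)\<^sup>2"
    using zero_le_power2[of "a - b"] by (simp add: power2_eq_square algebra_simps)
  ultimately have "(2 * c)\<^sup>2 \<le> (a + b)\<^sup>2" by (simp add: power_mult_distrib)
  hence "2 * c \<le> a + b" by (rule power2_le_imp_le) (use pos in simp)
  thus ?thesis by (simp add: a_def b_def c_def add.commute)
qed

text \<open>In units of s = Y^(-3/2): the first value costs at most 1; the parabola has constant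
  second difference 2 s / Y and costs at most 2 over its length; the junction costs 3; the convex
  part beyond \<open>Y\<close> telescopes and costs 1.\<close>

lemma sum_second_difference_rise:
  assumes Y: "Y \<ge> 1"
  shows "\<bar>rise Y 1\<bar> + (\<Sum>n<K. \<bar>rise Y (n + 2) - 2 * rise Y (n + 1) + rise Y n\<bar>) \<le> 7 / (real Y * sqrt Y)"
proof -
  define s where "s = 1 / (real Y * sqrt Y)"
  have s: "s > 0" using Y by (simp add: s_def)
  define D where "D n = rise Y (n + 2) - 2 * rise Y (n + 1) + rise Y n" for n
  have low: "rise Y n = (real n)\<^sup>2 * (s / Y)" if "n \<le> Y" for n
    using that by (simp add: rise_def s_def power2_eq_square)
  have r1: "\<bar>rise Y 1\<bar> \<le> s"
    using Y s by (simp add: low divide_le_eq)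
  have d1: "(\<Sum>n\<in>{..<Y-1}. \<bar>D n\<bar>) \<le> 2 * s"
  proof -
    have "(\<Sum>n\<in>{..<Y-1}. \<bar>D n\<bar>) = (\<Sum>n\<in>{..<Y-1}. 2 * (s / Y))"
    proof (intro sum.cong refl)
      fix n assume "n \<in> {..<Y-1}"
      hence "n + 2 \<le> Y" "n + 1 \<le> Y" "n \<le> Y" by auto
      hence "D n = 2 * (s / Y)" unfolding D_def by (simp only: low) (simp add: power2_eq_square algebra_simps)
      thus "\<bar>D n\<bar> = 2 * (s / Y)" using s by simp
    qed
    also have "\<dots> = real (Y - 1) * (2 * (s / Y))" by simp
    also have "\<dots> \<le> real Y * (2 * (s / Y))" using s by (intro mult_right_mono) auto
    also have "\<dots> = 2 * s" using Y by simp
    finally show ?thesis .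
  qed
  have stepY: "0 \<le> rise Y Y - rise Y (Suc Y)" "rise Y Y - rise Y (Suc Y) \<le> s"
  proof -
    have "rise Y (Suc Y) = 1 / sqrt (Suc Y)" by (simp add: rise_def)
    moreover have "1 / sqrt (Suc Y) \<le> 1 / sqrt Y" using Y by (intro divide_left_mono) auto
    ultimately show "0 \<le> rise Y Y - rise Y (Suc Y)" using Y by (simp add: rise_at)
    define x where "x = sqrt (real Y)"
    define y where "y = sqrt (real (Suc Y))"
    have xy: "x \<ge> 1" "y\<^sup>2 = x\<^sup>2 + 1" "y \<ge> x" using Y by (simp_all add: x_def y_def)
    have x: "x > 0" "y > 0" using xy by auto
    have "(y - x) * (y + x) = 1" using xy by (simp add: power2_eq_square algebra_simps)
    moreover have "(y - x) * x \<le> (y - x) * (y + x)" using xy x by (intro mult_left_mono) auto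
    ultimately have "(y - x) * x \<le> 1" by simp
    hence "(y - x) * x * x \<le> 1 * y" using xy x by (intro mult_mono) auto
    hence "(y - x) * x * x / (x\<^sup>2 * x * y) \<le> 1 * y / (x\<^sup>2 * x * y)" using x by (intro divide_right_mono) auto
    moreover have "(y - x) * x * x / (x\<^sup>2 * x * y) = 1 / x - 1 / y" "1 * y / (x\<^sup>2 * x * y) = 1 / (x\<^sup>2 * x)"
      using x by (simp_all add: field_simps power2_eq_square)
    ultimately have "1 / x - 1 / y \<le> 1 / (x\<^sup>2 * x)" by simp
    hence "1 / x - 1 / y \<le> s" by (simp add: s_def x_def)
    thus "rise Y Y - rise Y (Suc Y) \<le> s" using Y by (simp add: rise_at rise_def x_def y_def)
  qed
  \<comment> \<open>The junction: the three values at \<open>Y - 1\<close>, \<open>Y\<close>,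
    \<open>Y + 1\<close> combine the slope of the parabola, at most 2 s, with the drop of 1 / sqrt
    n, at most s.\<close>
  have d2: "\<bar>D (Y - 1)\<bar> \<le> 3 * s"
  proof -
    have "0 \<le> rise Y Y - rise Y (Y - 1)" "rise Y Y - rise Y (Y - 1) \<le> 2 * s"
    proof -
      have "rise Y Y - rise Y (Y - 1) = ((real Y)\<^sup>2 - (real (Y - 1))\<^sup>2) * (s / Y)"
        by (simp add: low algebra_simps)
      also have "(real Y)\<^sup>2 - (real (Y - 1))\<^sup>2 = 2 * real Y - 1"
        using Y by (simp add: of_nat_diff power2_eq_square algebra_simps)
      finally have *: "rise Y Y - rise Y (Y - 1) = (2 * real Y - 1) * (s / Y)" .
      show "0 \<le> rise Y Y - rise Y (Y - 1)" unfolding * using Y s by (intro mult_nonneg_nonneg) auto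
      have "(2 * real Y - 1) * (s / Y) \<le> (2 * real Y) * (s / Y)" using s by (intro mult_right_mono) auto
      thus "rise Y Y - rise Y (Y - 1) \<le> 2 * s" unfolding * using Y by simp
    qed
    moreover have "D (Y - 1) = (rise Y (Suc Y) - rise Y Y) - (rise Y Y - rise Y (Y - 1))"
      using Y by (simp add: D_def)
    ultimately show ?thesis using stepY by linarith
  qed
  have d3: "(\<Sum>n\<in>{Y..<K}. \<bar>D n\<bar>) \<le> s"
  proof (cases "K \<ge> Y")
    case True
    have hi: "rise Y n = 1 / sqrt n" if "n \<ge> Y" for n
      using that rise_at[OF Y] by (cases "n = Y") (auto simp: rise_def)
    have "(\<Sum>n\<in>{Y..<K}. \<bar>D n\<bar>) = (\<Sum>n\<in>{Y..<K}. (rise Y (Suc n + 1) - rise Y (Suc n)) - (rise Y (n + 1) - rise Y n))"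
    proof (intro sum.cong refl)
      fix n assume "n \<in> {Y..<K}"
      hence n: "n \<ge> Y" by simp
      have "D n = 1 / sqrt (n + 2) - 2 * (1 / sqrt (n + 1)) + 1 / sqrt n" unfolding D_def using n by (simp add: hi)
      hence "D n \<ge> 0" using inverse_sqrt_convex[of n] n Y by simp
      thus "\<bar>D n\<bar> = (rise Y (Suc n + 1) - rise Y (Suc n)) - (rise Y (n + 1) - rise Y n)" by (simp add: D_def)
    qed
    also have "\<dots> = (rise Y (K + 1) - rise Y K) - (rise Y (Y + 1) - rise Y Y)"
      using True by (rule sum_Suc_diff'[where f = "\<lambda>n. rise Y (n + 1) - rise Y n"])
    also have "rise Y (K + 1) - rise Y K \<le> 0"
    proof -
      have "1 / sqrt (K + 1) \<le> 1 / sqrt K" using True Y by (intro divide_left_mono) auto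
      thus ?thesis using True by (simp add: hi)
    qed
    finally show ?thesis using stepY by simp
  qed (use s in simp)
  have "(\<Sum>n<K. \<bar>D n\<bar>) \<le> (\<Sum>n\<in>({..<Y-1} \<union> {Y - 1}) \<union> {Y..<K}. \<bar>D n\<bar>)"
    by (rule sum_mono2) auto
  also have "\<dots> \<le> (\<Sum>n\<in>{..<Y-1} \<union> {Y - 1}. \<bar>D n\<bar>) + (\<Sum>n\<in>{Y..<K}. \<bar>D n\<bar>)"
    by (intro eq_refl sum.union_disjoint) (use Y in auto)
  also have "(\<Sum>n\<in>{..<Y-1} \<union> {Y - 1}. \<bar>D n\<bar>) \<le> (\<Sum>n\<in>{..<Y-1}. \<bar>D n\<bar>) + \<bar>D (Y - 1)\<bar>"
    by simp
  finally have "(\<Sum>n<K. \<bar>D n\<bar>) \<le> 6 * s" using d1 d2 d3 by linarith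
  hence "\<bar>rise Y 1\<bar> + (\<Sum>n<K. \<bar>D n\<bar>) \<le> 7 * s" using r1 by linarith
  thus ?thesis unfolding D_def s_def by simp
qed

text \<open>\<open>rise\<close> is not monotone, but it is the difference of the two decreasing
  sequences 1 / sqrt n and \<open>fall\<close>, whence 6 + 6. The second bound is 7 from the second
  differences plus 1 for the truncation at \<open>K\<close>, which is assumed to be large
  enough.\<close>

lemma rise_sum_bounds:
  fixes z :: complex
  assumes z: "norm z = 1" "z \<noteq> 1" and Y: "Y \<ge> 1" and K: "K \<ge> 1" "4 / sqrt K \<le> 1 / (real Y * sqrt Y)"
  shows "norm (\<Sum>n\<in>{1..Suc K}. of_real (rise Y n) * z ^ n) \<le> 12 / sqrt (norm (1 - z))"
    and "norm (\<Sum>n\<in>{1..Suc K}. of_real (rise Y n) * z ^ n) \<le> 8 / (real Y * sqrt Y) / (norm (1 - z))\<^sup>2"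
proof -
  let ?S = "\<lambda>u. (\<Sum>n\<in>{1..Suc K}. of_real (u n) * z ^ n)"
  have "?S (rise Y) = ?S (\<lambda>n. 1 / sqrt n) - ?S (fall Y)"
    unfolding fall_def by (simp only: sum_subtractf[symmetric] of_real_diff algebra_simps) simp
  also have "norm \<dots> \<le> norm (?S (\<lambda>n. 1 / sqrt n)) + norm (?S (fall Y))" by (rule norm_triangle_ineq4)
  also have "norm (?S (\<lambda>n. 1 / sqrt n)) \<le> 6 / sqrt (norm (1 - z))"
    using z by (rule trig_sum_bound_sqrt) (auto intro!: divide_left_mono)
  also have "norm (?S (fall Y)) \<le> 6 / sqrt (norm (1 - z))"
    using z by (rule trig_sum_bound_sqrt) (auto intro: fall_decreasing fall_nonneg fall_le)
  finally show "norm (?S (rise Y)) \<le> 12 / sqrt (norm (1 - z))" by simp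
  define e where "e = 1 / sqrt K"
  have e1: "\<bar>rise Y K\<bar> \<le> e" using K rise_le[of K Y] rise_nonneg[of Y K] by (simp add: e_def)
  have "1 / sqrt (Suc K) \<le> e" using K unfolding e_def by (intro divide_left_mono) auto
  hence e2: "\<bar>rise Y (Suc K)\<bar> \<le> e" using rise_le[of "Suc K" Y] rise_nonneg[of Y "Suc K"] by simp
  have "(norm (1 - z))\<^sup>2 * norm (?S (rise Y))
      \<le> \<bar>rise Y 1\<bar> + (\<Sum>n<K. \<bar>rise Y (n + 2) - 2 * rise Y (n + 1) + rise Y n\<bar>) + 4 * e"
    by (rule second_difference_bound[OF z(1) _ e1 e2]) (simp add: rise_def)
  also have "\<dots> \<le> 7 / (real Y * sqrt Y) + 1 / (real Y * sqrt Y)"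
    using sum_second_difference_rise[OF Y, of K] K(2) unfolding e_def by (intro add_mono) auto
  also have "\<dots> = 8 / (real Y * sqrt Y)" by (simp add: add_divide_distrib[symmetric])
  finally show "norm (?S (rise Y)) \<le> 8 / (real Y * sqrt Y) / (norm (1 - z))\<^sup>2"
    using z(2) by (metis mult.commute pos_le_divide_eq right_minus_eq zero_less_norm_iff zero_less_power)
qed

section \<open>Gauss sums and the dual sum\<close>

text \<open>The cubic Maclaurin bound suffices: x \<le> 1.7 gives x^2 \<le> 3, hence x^3 / 6 \<le> x
  / 2.\<close>

lemma half_le_sin:
  assumes "0 \<le> x" "x \<le> pi / 2"
  shows "x / 2 \<le> sin x"
proof -
  have "\<bar>sin x - (\<Sum>m<3. sin_coeff m * x ^ m)\<bar> \<le> inverse (fact 3) * \<bar>x\<bar> ^ 3"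
    by (rule Maclaurin_sin_bound)
  hence "\<bar>sin x - x\<bar> \<le> x ^ 3 / 6"
    using assms by (simp add: numeral_3_eq_3 sin_coeff_def)
  moreover have "x ^ 3 / 6 \<le> x / 2"
  proof -
    have "x \<le> 17 / 10" using assms pi_less_4 pi_approx by simp
    hence "x * x \<le> 17 / 10 * (17 / 10)" using assms by (intro mult_mono) auto
    hence "x * (x * x) \<le> x * 3" using assms by (intro mult_left_mono) auto
    thus ?thesis by (simp add: power3_eq_cube)
  qed
  ultimately show ?thesis by linarith
qed

lemma norm_one_minus_cis: "norm (1 - cis t) = 2 * \<bar>sin (t / 2)\<bar>"
proof -
  have "(norm (1 - cis t))\<^sup>2 = (1 - cos t)\<^sup>2 + (sin t)\<^sup>2"
    by (simp add: cmod_power2)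
  also have "\<dots> = 2 - 2 * cos t"
    using sin_cos_squared_add[of t] by (simp add: power2_eq_square algebra_simps)
  also have "cos t = 1 - 2 * (sin (t / 2))\<^sup>2"
    using cos_double_sin[of "t / 2"] by simp
  finally have "(norm (1 - cis t))\<^sup>2 = (2 * \<bar>sin (t / 2)\<bar>)\<^sup>2" by (simp add: power_mult_distrib)
  thus ?thesis by (rule power2_eq_imp_eq) auto
qed

definition unit_root :: "nat \<Rightarrow> nat \<Rightarrow> complex" where
  "unit_root q a = cis (2 * pi * real a / real q)"

lemma norm_root [simp]: "norm (unit_root q a) = 1"
  by (simp add: unit_root_def)

lemma root_power: "unit_root q a ^ n = unit_root q (n * a)"
proof -
  have "unit_root q a ^ n = cis (real n * (2 * pi * real a / real q))" unfolding unit_root_def by (rule Complex.DeMoivre)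
  also have "real n * (2 * pi * real a / real q) = 2 * pi * real (n * a) / real q" by simp
  finally show ?thesis by (simp only: unit_root_def)
qed

lemma root_add: "unit_root q (a + b) = unit_root q a * unit_root q b"
  by (simp add: unit_root_def cis_mult add_divide_distrib ring_distribs)

lemma root_multiple:
  assumes "q > 0"
  shows "unit_root q (q * k) = 1"
  using assms cis_multiple_2pi[of "of_nat k"] by (simp add: unit_root_def field_simps)

lemma root_mod:
  assumes "q > 0"
  shows "unit_root q (n mod q) = unit_root q n"
  using root_add[of q "n mod q" "q * (n div q)"] unfolding root_multiple[OF assms] by simp

lemma root_diff:
  assumes "a \<le> q" "q > 0"
  shows "unit_root q (q - a) = cnj (unit_root q a)"
proof -
  have "unit_root q (q - a) * unit_root q a = unit_root q (q - a + a)" by (rule root_add[symmetric])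
  also have "\<dots> = 1" using root_multiple[of q 1] assms by simp
  finally have "unit_root q (q - a) * unit_root q a = 1" .
  moreover have "cnj (unit_root q a) * unit_root q a = 1"
    using complex_norm_square[of "unit_root q a"] by (simp add: mult.commute)
  ultimately have "unit_root q (q - a) * unit_root q a = cnj (unit_root q a) * unit_root q a" by simp
  moreover have "unit_root q a \<noteq> 0" by (simp add: unit_root_def)
  ultimately show ?thesis by simp
qed

lemma root_eq_imp:
  assumes "a < q" "b < q" "unit_root q a = unit_root q b"
  shows "a = b"
proof -
  have wlog: "a = b" if "b \<le> a" "a < q" "unit_root q a = unit_root q b" for a b
  proof -
    have "unit_root q (a - b) * unit_root q b = unit_root q (a - b + b)" by (rule root_add[symmetric])
    also have "a - b + b = a" using that(1) by simp
    finally have "unit_root q (a - b) * unit_root q b = 1 * unit_root q b" unfolding that(3) mult_1 .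
    moreover have "unit_root q b \<noteq> 0" by (simp add: unit_root_def)
    ultimately have "unit_root q (a - b) = 1" using mult_right_cancel[of "unit_root q b"] by blast
    hence "cos (2 * pi * real (a - b) / real q) = 1" by (simp add: unit_root_def complex_eq_iff)
    then obtain m :: int where "2 * pi * real (a - b) / real q = of_int m * 2 * pi"
      by (auto simp: cos_one_2pi_int)
    hence "real (a - b) = of_int m * real q" using that by (simp add: field_simps del: of_nat_diff)
    hence "real_of_int (int (a - b)) = of_int (m * int q)" by (simp del: of_nat_diff)
    hence "int (a - b) = m * int q" by (simp only: of_int_eq_iff)
    hence "int q dvd int (a - b)" by simp
    hence "q dvd a - b" by (simp only: int_dvd_int_iff)
    hence "a - b = 0" using that nat_dvd_not_less[of "a - b" q] by linarith
    thus ?thesis using that by simp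
  qed
  show ?thesis
  proof (cases "b \<le> a")
    case True
    from wlog[OF True assms(1,3)] show ?thesis .
  next
    case False
    hence "a \<le> b" by simp
    from wlog[OF this assms(2) assms(3)[symmetric]] show ?thesis by (rule sym)
  qed
qed

definition gauss_sum :: "nat \<Rightarrow> (nat \<Rightarrow> complex) \<Rightarrow> complex" where
  "gauss_sum q chi = (\<Sum>a\<in>{1..<q}. chi a * unit_root q a)"

context odd_prime_modulus
begin

text \<open>For \<open>n\<close> prime to \<open>q\<close> substitute n a for a. If \<open>q\<close>
  divides \<open>n\<close>, all roots become 1 and both sides vanish, since \<open>chi\<close> sums
  to 0 over the residues.\<close>

lemma gauss_sum_twist:
  assumes chi: "chi \<in> characters q" "chi \<noteq> principal_char q"
  shows "(\<Sum>a\<in>{1..<q}. chi a * unit_root q a ^ n) = cnj (chi n) * gauss_sum q chi"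
proof (cases "coprime n q")
  case True
  have "gauss_sum q chi = (\<Sum>a\<in>{1..<q}. chi (n * a mod q) * unit_root q (n * a mod q))"
    unfolding gauss_sum_def by (rule sum.reindex_bij_betw[OF bij_mult_mod[OF True], symmetric])
  also have "\<dots> = chi n * (\<Sum>a\<in>{1..<q}. chi a * unit_root q a ^ n)"
    using q_pos by (simp add: character_mod[OF chi(1)] character_mult[OF chi(1)] root_mod root_power sum_distrib_left mult.assoc)
  finally have "cnj (chi n) * gauss_sum q chi = (cnj (chi n) * chi n) * (\<Sum>a\<in>{1..<q}. chi a * unit_root q a ^ n)"
    by (simp add: mult.assoc)
  moreover have "cnj (chi n) * chi n = 1"
    using complex_norm_square[of "chi n"] norm_character[OF chi(1) True] by (simp add: mult.commute)
  ultimately show ?thesis by simp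
next
  case False
  then obtain k where k: "n = q * k" using coprime_q_iff by (auto simp: dvd_def)
  have "unit_root q a ^ n = 1" for a
    unfolding root_power k using root_multiple[OF q_pos(1), of "k * a"] by (simp add: mult.assoc)
  moreover have "chi n = 0" using False character_eq_0_iff[OF chi(1)] by simp
  ultimately show ?thesis using sum_character[OF chi] by simp
qed

lemma root_orthogonality:
  assumes "a < q" "b < q"
  shows "(\<Sum>n<q. unit_root q a ^ n * cnj (unit_root q b ^ n)) = (if a = b then of_nat q else 0)"
proof -
  define w where "w = unit_root q a * cnj (unit_root q b)"
  have eq: "unit_root q a ^ n * cnj (unit_root q b ^ n) = w ^ n" for n by (simp add: w_def power_mult_distrib)
  have one: "unit_root q b * cnj (unit_root q b) = 1" using complex_norm_square[of "unit_root q b"] by simp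
  show ?thesis
  proof (cases "a = b")
    case True
    hence "w = 1" using one by (simp add: w_def)
    thus ?thesis using True unfolding eq by simp
  next
    case False
    have "w \<noteq> 1"
    proof
      assume "w = 1"
      hence "unit_root q a * (cnj (unit_root q b) * unit_root q b) = unit_root q b" by (simp add: w_def flip: mult.assoc)
      hence "unit_root q a = unit_root q b" using one by (simp add: mult.commute)
      thus False using root_eq_imp assms False by blast
    qed
    moreover have "w ^ q = 1"
      using eq[of q, symmetric] by (simp only: root_power root_multiple[OF q_pos(1)]) simp
    ultimately show ?thesis using False unfolding eq by (simp add: geometric_sum)
  qed
qed

text \<open>Two evaluations of the sum of |G(n)|^2 over n modulo \<open>q\<close>: the twist gives
  (q - 1) times the squared norm of the Gauss sum, additive orthogonality gives (q - 1) q.\<close>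

lemma norm_gauss_sum:
  assumes chi: "chi \<in> characters q" "chi \<noteq> principal_char q"
  shows "norm (gauss_sum q chi) = sqrt q"
proof -
  let ?I = "{1..<q}"
  let ?G = "\<lambda>n. \<Sum>a\<in>?I. chi a * unit_root q a ^ n"
  have unit: "chi a * cnj (chi a) = 1" if "a \<in> ?I" for a
    using complex_norm_square[of "chi a"] norm_character[OF chi(1) coprime_q[OF that]] by simp
  have split: "{..<q} = insert 0 ?I" using q_pos by auto
  have "chi 0 = 0" using character_eq_0_iff[OF chi(1), of 0] q_gt_2 by simp
  have "(\<Sum>n<q. ?G n * cnj (?G n)) = (\<Sum>n<q. (chi n * cnj (chi n)) * (gauss_sum q chi * cnj (gauss_sum q chi)))"
    unfolding gauss_sum_twist[OF chi] by (intro sum.cong refl) (simp add: mult_ac)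
  also have "\<dots> = (\<Sum>n\<in>?I. gauss_sum q chi * cnj (gauss_sum q chi))"
    unfolding split using \<open>chi 0 = 0\<close> unit by simp
  also have "\<dots> = of_nat (q - 1) * (gauss_sum q chi * cnj (gauss_sum q chi))" by simp
  finally have 1: "(\<Sum>n<q. ?G n * cnj (?G n)) = of_nat (q - 1) * (gauss_sum q chi * cnj (gauss_sum q chi))" .
  have "(\<Sum>n<q. ?G n * cnj (?G n)) = (\<Sum>n<q. \<Sum>a\<in>?I. \<Sum>b\<in>?I. chi a * cnj (chi b) * (unit_root q a ^ n * cnj (unit_root q b ^ n)))"
    unfolding cnj_sum sum_product by (intro sum.cong refl) (simp add: mult_ac)
  also have "\<dots> = (\<Sum>a\<in>?I. \<Sum>n<q. \<Sum>b\<in>?I. chi a * cnj (chi b) * (unit_root q a ^ n * cnj (unit_root q b ^ n)))"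
    by (rule sum.swap)
  also have "\<dots> = (\<Sum>a\<in>?I. \<Sum>b\<in>?I. \<Sum>n<q. chi a * cnj (chi b) * (unit_root q a ^ n * cnj (unit_root q b ^ n)))"
    by (intro sum.cong refl sum.swap)
  also have "\<dots> = (\<Sum>a\<in>?I. \<Sum>b\<in>?I. if a = b then of_nat q else 0)"
  proof (intro sum.cong refl)
    fix a b assume ab: "a \<in> ?I" "b \<in> ?I"
    have "(\<Sum>n<q. chi a * cnj (chi b) * (unit_root q a ^ n * cnj (unit_root q b ^ n))) = chi a * cnj (chi b) * (if a = b then of_nat q else 0)"
      using root_orthogonality[of a b] ab by (simp only: sum_distrib_left[symmetric] atLeastLessThan_iff)
    also have "\<dots> = (if a = b then of_nat q else 0)" using unit[OF ab(1)] by auto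
    finally show "(\<Sum>n<q. chi a * cnj (chi b) * (unit_root q a ^ n * cnj (unit_root q b ^ n))) = (if a = b then of_nat q else 0)" .
  qed
  also have "\<dots> = of_nat (q - 1) * of_nat q" by simp
  finally have 2: "(\<Sum>n<q. ?G n * cnj (?G n)) = of_nat (q - 1) * of_nat q" .
  have "gauss_sum q chi * cnj (gauss_sum q chi) = of_nat q"
    using 1 2 q_gt_2 by (simp del: of_nat_diff)
  hence "complex_of_real ((norm (gauss_sum q chi))\<^sup>2) = complex_of_real (real q)"
    unfolding complex_norm_square by simp
  hence "(norm (gauss_sum q chi))\<^sup>2 = real q" by (simp only: of_real_eq_iff)
  thus ?thesis by (intro real_sqrt_unique[symmetric]) auto
qed

text \<open>Takes the place of the functional equation. Exchanging sums and twisting gives the Gauss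
  sum times the conjugate of the character sum, as \<open>c\<close> is real; only norms are
  compared, so the argument of the Gauss sum is irrelevant.\<close>

lemma norm_character_sum_dual:
  fixes c :: "nat \<Rightarrow> real"
  assumes chi: "chi \<in> characters q" "chi \<noteq> principal_char q"
  shows "norm (\<Sum>n\<in>A. of_real (c n) * chi n)
    = norm (fourier q (\<lambda>a. (\<Sum>n\<in>A. of_real (c n) * unit_root q a ^ n) / sqrt q) chi)"
proof -
  have "fourier q (\<lambda>a. (\<Sum>n\<in>A. of_real (c n) * unit_root q a ^ n) / sqrt q) chi
      = (\<Sum>a\<in>{1..<q}. \<Sum>n\<in>A. of_real (c n) * (chi a * unit_root q a ^ n)) / sqrt q"
    unfolding fourier_def sum_divide_distrib sum_distrib_right by (intro sum.cong refl) (simp add: mult_ac)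
  also have "(\<Sum>a\<in>{1..<q}. \<Sum>n\<in>A. of_real (c n) * (chi a * unit_root q a ^ n))
      = (\<Sum>n\<in>A. of_real (c n) * (\<Sum>a\<in>{1..<q}. chi a * unit_root q a ^ n))"
    by (subst sum.swap) (simp only: sum_distrib_left)
  also have "\<dots> = gauss_sum q chi * cnj (\<Sum>n\<in>A. of_real (c n) * chi n)"
    unfolding gauss_sum_twist[OF chi] cnj_sum sum_distrib_left by (intro sum.cong refl) (simp add: mult_ac)
  finally show ?thesis
    using q_pos by (simp add: norm_mult norm_divide norm_gauss_sum[OF chi] complex_mod_cnj del: cnj_sum)
qed

section \<open>Majorants for the coefficients of the dual sum\<close>

definition half :: nat where "half = (q - 1) div 2"

lemma q_eq_half: "q = 2 * half + 1"
  using odd_q by (auto simp: half_def elim: oddE)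

lemma norm_one_minus_root:
  assumes "a \<in> {1..half}"
  shows "2 * real a / q \<le> norm (1 - unit_root q a)" "2 * real a / q \<le> norm (1 - unit_root q (q - a))"
proof -
  have aq: "2 * a < q" "a > 0" using assms q_eq_half by auto
  have "real a / q \<le> 1 / 2" using aq by (simp add: field_simps)
  hence "pi * (real a / q) \<le> pi * (1 / 2)" by (intro mult_left_mono) auto
  hence x: "0 \<le> pi * real a / q" "pi * real a / q \<le> pi / 2" by simp_all
  have "2 * real a / q \<le> 2 * ((pi * real a / q) / 2)"
  proof -
    have "2 * real a \<le> pi * real a" using pi_gt3 by (intro mult_right_mono) auto
    from divide_right_mono[OF this, of "real q"] show ?thesis by simp
  qed
  also have "\<dots> \<le> 2 * sin (pi * real a / q)" using half_le_sin[OF x] by simp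
  also have "\<dots> \<le> norm (1 - unit_root q a)" by (simp add: unit_root_def norm_one_minus_cis)
  finally show 1: "2 * real a / q \<le> norm (1 - unit_root q a)" .
  have "norm (1 - unit_root q (q - a)) = norm (cnj (1 - unit_root q a))"
    using aq q_pos root_diff[of a q] by simp
  thus "2 * real a / q \<le> norm (1 - unit_root q (q - a))" using 1 unfolding complex_mod_cnj by simp
qed

text \<open>The two estimates for the sum over \<open>rise\<close>, evaluated at |1 - z| \<ge> 2 a /
  q, become the two branches of \<open>kap\<close>. The second uses Y \<ge> sqrt q / 2, that is
  Y^(3/2) \<ge> q^(3/4) / 4.\<close>

lemma dual_coefficient_bound:
  fixes z :: complex
  assumes a: "a \<in> {1..half}" and Y: "Y \<ge> 1" "q < (Y + 1)\<^sup>2"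
    and K: "K \<ge> 1" "4 / sqrt K \<le> 1 / (real Y * sqrt Y)"
    and z: "norm z = 1" "2 * real a / q \<le> norm (1 - z)"
  shows "norm ((\<Sum>n\<in>{1..Suc K}. of_real (rise Y n) * z ^ n) / sqrt q) \<le> 12 * kap q a"
proof -
  define S where "S = norm (\<Sum>n\<in>{1..Suc K}. of_real (rise Y n) * z ^ n)"
  define d where "d = norm (1 - z)"
  define r where "r = sqrt (sqrt (real q))"
  have r: "r > 0" "r\<^sup>2 = sqrt q" "sqrt q > 0" using q_pos by (simp_all add: r_def)
  have a0: "real a > 0" using a by simp
  have d: "d \<ge> 2 * real a / q" "2 * real a / q > 0" using z a0 q_pos by (auto simp: d_def)
  hence d0: "d > 0" by linarith
  have z1: "z \<noteq> 1" using d0 by (auto simp: d_def)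
  have "S / sqrt q \<le> 12 / sqrt a"
  proof -
    have "S \<le> 12 / sqrt d" unfolding S_def d_def by (rule rise_sum_bounds(1)[OF z(1) z1 Y(1) K])
    also have "\<dots> \<le> 12 / sqrt (real a / q)"
      using d d0 a0 q_pos by (intro divide_left_mono real_sqrt_le_mono mult_pos_pos) (auto simp: field_simps)
    also have "\<dots> = 12 / sqrt a * sqrt q" by (simp add: real_sqrt_divide)
    finally show ?thesis using r by (simp add: pos_divide_le_eq)
  qed
  moreover have "S / sqrt q \<le> 12 * (r ^ 3 / (real a)\<^sup>2)"
  proof -
    have "q \<le> (2 * Y)\<^sup>2"
    proof -
      have "(Y + 1)\<^sup>2 \<le> (2 * Y)\<^sup>2" using Y(1) by (intro power_mono) auto
      thus ?thesis using Y(2) by linarith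
    qed
    hence "real q \<le> (2 * real Y)\<^sup>2" by (metis of_nat_le_iff of_nat_mult of_nat_numeral of_nat_power)
    hence "sqrt q \<le> 2 * real Y" by (intro real_le_lsqrt) auto
    hence Yr: "r\<^sup>2 / 2 \<le> real Y" using r by simp
    have "r / 2 \<le> sqrt Y"
    proof (rule real_le_rsqrt)
      have "(r / 2)\<^sup>2 = r\<^sup>2 / 4" by (simp add: power_divide)
      thus "(r / 2)\<^sup>2 \<le> real Y" using Yr zero_le_power2[of r] by linarith
    qed
    hence "r\<^sup>2 / 2 * (r / 2) \<le> real Y * sqrt Y" using Yr r by (intro mult_mono) auto
    hence YY: "r ^ 3 / 4 \<le> real Y * sqrt Y" by (simp add: power2_eq_square power3_eq_cube)
    have q6: "real q * sqrt q = r ^ 6"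
    proof -
      have "r ^ 6 = (r\<^sup>2) * (r\<^sup>2) * (r\<^sup>2)" by (simp add: eval_nat_numeral)
      thus ?thesis using r by simp
    qed
    have "S \<le> 8 / (real Y * sqrt Y) / d\<^sup>2" unfolding S_def d_def by (rule rise_sum_bounds(2)[OF z(1) z1 Y(1) K])
    also have "\<dots> \<le> 8 / (r ^ 3 / 4) / (2 * real a / q)\<^sup>2"
      using YY d d0 r by (intro frac_le divide_left_mono power_mono divide_nonneg_pos mult_pos_pos zero_less_power) auto
    also have "\<dots> = 8 * (real q)\<^sup>2 / (r ^ 3 * (real a)\<^sup>2)" using r by (simp add: power_divide power_mult_distrib)
    finally have "S / sqrt q \<le> 8 * (real q)\<^sup>2 / (r ^ 3 * (real a)\<^sup>2) / sqrt q" using r by (intro divide_right_mono) auto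
    also have "(real q)\<^sup>2 = r ^ 6 * sqrt q" unfolding q6[symmetric] by (simp add: power2_eq_square)
    also have "8 * (r ^ 6 * sqrt q) / (r ^ 3 * (real a)\<^sup>2) / sqrt q = 8 * (r ^ 3 / (real a)\<^sup>2)"
      using r a0 by (simp add: field_simps eval_nat_numeral)
    also have "\<dots> \<le> 12 * (r ^ 3 / (real a)\<^sup>2)" using r by (intro mult_right_mono) auto
    finally show ?thesis .
  qed
  ultimately show ?thesis
    unfolding S_def kap_def r_def by (simp add: norm_divide min_def)
qed

text \<open>Up to \<open>Y\<close>, hence up to sqrt q, the minimum in \<open>kap\<close> is
  attained by 1 / sqrt a, which bounds \<open>fall\<close>.\<close>

lemma fall_le_kap:
  assumes "a \<ge> 1" "a \<le> Y" "Y\<^sup>2 \<le> q"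
  shows "fall Y a \<le> kap q a"
proof -
  define r where "r = sqrt (sqrt (real q))"
  have "a\<^sup>2 \<le> q" using assms by (meson le_trans power_mono zero_le)
  hence "(real a)\<^sup>2 \<le> real q" by (metis of_nat_le_iff of_nat_power)
  hence "real a \<le> sqrt q" by (rule real_le_rsqrt)
  hence "sqrt a \<le> r" unfolding r_def by (rule real_sqrt_le_mono)
  hence "sqrt a ^ 3 \<le> r ^ 3" by (intro power_mono) auto
  hence "sqrt a ^ 3 / (real a)\<^sup>2 \<le> r ^ 3 / (real a)\<^sup>2" by (intro divide_right_mono) auto
  moreover have "sqrt a ^ 3 / (real a)\<^sup>2 = 1 / sqrt a"
    using assms by (simp add: power3_eq_cube power2_eq_square field_simps)
  ultimately show ?thesis using fall_le[of Y a] by (simp add: kap_def r_def)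
qed

text \<open>The dual coefficients decay with the distance of the residue from 0 modulo
  \<open>q\<close>, and this is \<open>q - a\<close> in the upper half. The upper half is therefore
  reflected, at the price of the unimodular factor \<open>chi (q - 1)\<close>, the value at
  -1.\<close>

lemma fourier_split:
  assumes chi: "chi \<in> characters q"
  shows "fourier q u chi = fourier q (\<lambda>a. if a \<in> {1..half} then u a else 0) chi
    + chi (q - 1) * fourier q (\<lambda>a. if a \<in> {1..half} then u (q - a) else 0) chi"
proof -
  have restr: "fourier q (\<lambda>a. if a \<in> {1..half} then v a else 0) chi = (\<Sum>a\<in>{1..half}. v a * chi a)" for v
  proof -
    have "fourier q (\<lambda>a. if a \<in> {1..half} then v a else 0) chi = (\<Sum>a\<in>{1..<q}. if a \<in> {1..half} then v a * chi a else 0)"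
      unfolding fourier_def by (intro sum.cong) auto
    also have "\<dots> = (\<Sum>a\<in>{1..<q} \<inter> {1..half}. v a * chi a)" by (simp add: sum.inter_restrict)
    also have "{1..<q} \<inter> {1..half} = {1..half}" using q_eq_half by auto
    finally show ?thesis .
  qed
  have "{1..<q} = {1..half} \<union> {half+1..<q}" using q_eq_half by auto
  hence "fourier q u chi = (\<Sum>a\<in>{1..half} \<union> {half+1..<q}. u a * chi a)" by (simp add: fourier_def)
  also have "\<dots> = (\<Sum>a\<in>{1..half}. u a * chi a) + (\<Sum>a\<in>{half+1..<q}. u a * chi a)"
    by (rule sum.union_disjoint) auto
  also have "(\<Sum>a\<in>{half+1..<q}. u a * chi a) = (\<Sum>a\<in>{1..half}. u (q - a) * chi (q - a))"
    by (rule sum.reindex_bij_witness[of _ "\<lambda>a. q - a" "\<lambda>a. q - a"]) (use q_eq_half in auto)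
  also have "\<dots> = chi (q - 1) * (\<Sum>a\<in>{1..half}. u (q - a) * chi a)"
    unfolding sum_distrib_left
  proof (intro sum.cong refl)
    fix a assume "a \<in> {1..half}"
    hence a: "1 \<le> a" "a < q" using q_eq_half by auto
    have "(q - a) + (a - 1) * q = (q - 1) * a"
      using a q_pos by (simp add: algebra_simps diff_mult_distrib)
    hence "((q - 1) * a) mod q = (q - a) mod q" by (metis mod_mult_self1)
    hence "chi (q - a) = chi ((q - 1) * a)" by (metis character_mod[OF chi])
    thus "u (q - a) * chi (q - a) = chi (q - 1) * (u (q - a) * chi a)"
      by (simp add: character_mult[OF chi])
  qed
  finally show ?thesis by (simp only: restr)
qed

end

section \<open>The second moment of triples\<close>

text \<open>The multiplicative autocorrelation of \<open>u\<close>; its transform is the squared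
  norm of the transform of \<open>u\<close>.\<close>

definition correlation :: "nat \<Rightarrow> (nat \<Rightarrow> complex) \<Rightarrow> nat \<Rightarrow> complex" where
  "correlation q u b = (\<Sum>p\<in>{p \<in> {1..<q} \<times> {1..<q}. [fst p = b * snd p] (mod q)}. u (fst p) * cnj (u (snd p)))"

definition L_half_partial :: "nat \<Rightarrow> (nat \<Rightarrow> complex) \<Rightarrow> complex" where
  "L_half_partial K chi = (\<Sum>n\<in>{1..K}. of_real (1 / sqrt n) * chi n)"

lemma dirichlet_L_half: "dirichlet_L chi (1/2) = lim (\<lambda>K. L_half_partial K chi)"
proof -
  have "of_nat n powr (1/2) = complex_of_real (sqrt n)" for n
    using csqrt_conv_powr[of "of_nat n"] csqrt_of_real_nonneg[of "of_nat n"] by simp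
  hence "chi n / of_nat n powr (1/2) = of_real (1 / sqrt n) * chi n" for n by simp
  thus ?thesis unfolding dirichlet_L_def L_half_partial_def by (simp only:)
qed

context odd_prime_modulus
begin

text \<open>Full periods cancel, so every initial segment is bounded by \<open>q\<close>; an
  interval is the difference of two initial segments.\<close>

lemma norm_sum_character_le:
  assumes chi: "chi \<in> characters q" "chi \<noteq> principal_char q"
  shows "norm (\<Sum>n\<in>{M..k}. chi n) \<le> 2 * real q"
proof -
  have "chi 0 = 0" using character_eq_0_iff[OF chi(1), of 0] q_gt_2 by simp
  have split: "{..<q} = insert 0 {1..<q}" using q_pos by auto
  have full: "(\<Sum>n<q. chi n) = 0" unfolding split using sum_character[OF chi] \<open>chi 0 = 0\<close> by simp
  have per: "chi (j * q + n) = chi n" for j n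
    by (rule character_cong[OF chi(1)]) (simp add: cong_def)
  have shift: "(\<Sum>n<q + k. chi n) = (\<Sum>n<q. chi n) + (\<Sum>n<k. chi (q + n))" for k
    by (induction k) (simp_all add: add.assoc)
  have blocks: "(\<Sum>n<j * q + r. chi n) = (\<Sum>n<r. chi n)" for j r
  proof (induction j)
    case (Suc j)
    have "(\<Sum>n<Suc j * q + r. chi n) = (\<Sum>n<q + (j * q + r). chi n)" by (simp add: algebra_simps)
    also have "\<dots> = (\<Sum>n<q. chi n) + (\<Sum>n<j * q + r. chi (q + n))"
      by (rule shift)
    also have "(\<Sum>n<j * q + r. chi (q + n)) = (\<Sum>n<j * q + r. chi n)"
    proof (intro sum.cong refl)
      show "chi (q + n) = chi n" for n using per[of 1 n] unfolding mult_1 .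
    qed
    finally show ?case using full Suc by simp
  qed simp
  have init: "norm (\<Sum>n<k. chi n) \<le> real q" for k
  proof -
    have "(\<Sum>n<k. chi n) = (\<Sum>n<k mod q. chi n)" using blocks[of "k div q" "k mod q"] by simp
    also have "norm \<dots> \<le> (\<Sum>n<k mod q. 1)" by (intro sum_norm_le norm_character_le[OF chi(1)])
    also have "\<dots> \<le> real q" using mod_less_divisor[OF q_pos(1), of k] by simp
    finally show ?thesis .
  qed
  show ?thesis
  proof (cases "M \<le> k")
    case True
    have "{..<Suc k} = {..<M} \<union> {M..k}" using True by auto
    hence "(\<Sum>n<Suc k. chi n) = (\<Sum>n\<in>{..<M} \<union> {M..k}. chi n)" by (simp only:)
    also have "\<dots> = (\<Sum>n<M. chi n) + (\<Sum>n\<in>{M..k}. chi n)" by (rule sum.union_disjoint) auto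
    finally have "(\<Sum>n\<in>{M..k}. chi n) = (\<Sum>n<Suc k. chi n) - (\<Sum>n<M. chi n)" by simp
    also have "norm \<dots> \<le> norm (\<Sum>n<Suc k. chi n) + norm (\<Sum>n<M. chi n)" by (rule norm_triangle_ineq4)
    finally show ?thesis using init[of "Suc k"] init[of M] by linarith
  qed simp
qed

text \<open>Bounded character sums against the decreasing 1 / sqrt n give a Cauchy sequence by Abel
  summation. Convergence is what gives meaning to the \<open>lim\<close> in
  \<open>dirichlet_L\<close>.\<close>

lemma L_half_partial_tendsto:
  assumes chi: "chi \<in> characters q" "chi \<noteq> principal_char q"
  shows "(\<lambda>K. L_half_partial K chi) \<longlonglongrightarrow> dirichlet_L chi (1/2)"
proof -
  have "Cauchy (\<lambda>K. L_half_partial K chi)"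
  proof (rule CauchyI')
    fix e :: real assume e: "e > 0"
    obtain M where M: "(2 * real q / e)\<^sup>2 < real M" using reals_Archimedean2 by blast
    show "\<exists>M. \<forall>m\<ge>M. \<forall>n>m. dist (L_half_partial m chi) (L_half_partial n chi) < e"
      unfolding dist_norm
    proof (intro exI allI impI)
      fix m n assume mn: "M \<le> m" "m < n"
      have split: "{1..n} = {1..m} \<union> {Suc m..n}" using mn by auto
      have "L_half_partial n chi = L_half_partial m chi + (\<Sum>k\<in>{Suc m..n}. of_real (1 / sqrt k) * chi k)"
        unfolding L_half_partial_def split by (rule sum.union_disjoint) auto
      hence "norm (L_half_partial m chi - L_half_partial n chi) = norm (\<Sum>k\<in>{Suc m..n}. of_real (1 / sqrt k) * chi k)"
        by (simp add: norm_minus_commute)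
      also have "\<dots> \<le> 2 * real q * (1 / sqrt (Suc m))"
        by (rule abel_summation_bound) (auto intro!: divide_left_mono norm_sum_character_le[OF chi])
      also have "\<dots> < e"
      proof -
        have "2 * real q / e < sqrt (Suc m)" using M mn by (intro real_less_rsqrt) simp
        thus ?thesis using e by (simp add: field_simps)
      qed
      finally show "norm (L_half_partial m chi - L_half_partial n chi) < e" .
    qed
  qed
  hence "convergent (\<lambda>K. L_half_partial K chi)" by (rule Cauchy_convergent)
  thus ?thesis unfolding dirichlet_L_half by (simp add: convergent_LIMSEQ_iff)
qed

text \<open>Group the pairs (m, n) of the double sum by the class b with m = b n modulo
  \<open>q\<close>; on it \<open>chi\<close> at m times the conjugate at n equals
  \<open>chi b\<close>.\<close>

lemma fourier_correlation:
  assumes chi: "chi \<in> characters q"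
  shows "complex_of_real ((norm (fourier q u chi))\<^sup>2) = fourier q (correlation q u) chi"
proof -
  let ?I = "{1..<q}"
  have ex: "\<exists>b\<in>?I. [fst p = b * snd p] (mod q)" if p: "p \<in> ?I \<times> ?I" for p
  proof -
    have "bij_betw (\<lambda>b. snd p * b mod q) ?I ?I" using p by (intro bij_mult_mod coprime_q) auto
    moreover have "fst p \<in> ?I" using p by auto
    ultimately obtain b where "b \<in> ?I" "fst p = snd p * b mod q" unfolding bij_betw_def by blast
    thus ?thesis by (intro bexI[of _ b]) (simp_all add: cong_def mult.commute)
  qed
  define g where "g p = (SOME b. b \<in> ?I \<and> [fst p = b * snd p] (mod q))" for p :: "nat \<times> nat"
  have g: "g p \<in> ?I" "[fst p = g p * snd p] (mod q)" if "p \<in> ?I \<times> ?I" for p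
    using someI_ex[OF ex[OF that, unfolded Bex_def]] unfolding g_def by blast+
  have fibre: "{p \<in> ?I \<times> ?I. g p = b} = {p \<in> ?I \<times> ?I. [fst p = b * snd p] (mod q)}" if b: "b \<in> ?I" for b
  proof (intro Collect_cong conj_cong refl iffI)
    fix p assume p: "p \<in> ?I \<times> ?I"
    show "[fst p = b * snd p] (mod q)" if "g p = b" using g(2)[OF p] that by simp
    assume "[fst p = b * snd p] (mod q)"
    hence "[g p * snd p = b * snd p] (mod q)" using g(2)[OF p] cong_sym cong_trans by blast
    moreover have "coprime (snd p) q" using p by (intro coprime_q) auto
    ultimately have "[g p = b] (mod q)" by (simp add: cong_mult_rcancel_nat)
    thus "g p = b" using cong_imp_eq[OF g(1)[OF p] b] by blast
  qed
  have val: "chi (fst p) * cnj (chi (snd p)) = chi b" if p: "p \<in> ?I \<times> ?I" "[fst p = b * snd p] (mod q)" for p b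
  proof -
    have "coprime (snd p) q" using p by (intro coprime_q) auto
    hence "chi (snd p) * cnj (chi (snd p)) = 1"
      using complex_norm_square[of "chi (snd p)"] norm_character[OF chi] by simp
    moreover have "chi (fst p) = chi b * chi (snd p)"
      using character_cong[OF chi p(2)] character_mult[OF chi] by simp
    ultimately show ?thesis by (simp add: mult.assoc)
  qed
  have "complex_of_real ((norm (fourier q u chi))\<^sup>2) = fourier q u chi * cnj (fourier q u chi)"
    by (rule complex_norm_square)
  also have "\<dots> = (\<Sum>p\<in>?I \<times> ?I. (u (fst p) * chi (fst p)) * cnj (u (snd p) * chi (snd p)))"
    unfolding fourier_def cnj_sum sum_product sum.cartesian_product case_prod_unfold by (rule refl)
  also have "\<dots> = (\<Sum>b\<in>?I. \<Sum>p\<in>{p \<in> ?I \<times> ?I. g p = b}. (u (fst p) * chi (fst p)) * cnj (u (snd p) * chi (snd p)))"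
    by (rule sum.group[symmetric]) (use g in auto)
  also have "\<dots> = (\<Sum>b\<in>?I. \<Sum>p\<in>{p \<in> ?I \<times> ?I. [fst p = b * snd p] (mod q)}. (u (fst p) * cnj (u (snd p))) * chi b)"
  proof (intro sum.cong fibre)
    fix b p assume "p \<in> {p \<in> ?I \<times> ?I. [fst p = b * snd p] (mod q)}"
    hence "chi (fst p) * cnj (chi (snd p)) = chi b" by (intro val) auto
    thus "(u (fst p) * chi (fst p)) * cnj (u (snd p) * chi (snd p)) = (u (fst p) * cnj (u (snd p))) * chi b"
      by (simp add: mult_ac)
  qed auto
  also have "\<dots> = fourier q (correlation q u) chi"
    unfolding fourier_def correlation_def sum_distrib_right by (rule refl)
  finally show ?thesis .
qed

lemma norm_correlation_le:
  assumes "\<And>a. norm (u a) \<le> (if a \<in> {1..half} then c * kap q a else 0)" "c \<ge> 0"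
  shows "norm (correlation q u b) \<le> c\<^sup>2 * (\<Sum>p\<in>ratio_class q half b. kap q (fst p) * kap q (snd p))"
proof -
  let ?S = "{p \<in> {1..<q} \<times> {1..<q}. [fst p = b * snd p] (mod q)}"
  have sub: "ratio_class q half b \<subseteq> ?S" using q_eq_half by (auto simp: ratio_class_def)
  have "norm (correlation q u b) \<le> (\<Sum>p\<in>?S. norm (u (fst p) * cnj (u (snd p))))"
    unfolding correlation_def by (rule norm_sum)
  also have "\<dots> = (\<Sum>p\<in>ratio_class q half b. norm (u (fst p) * cnj (u (snd p))))"
  proof (rule sum.mono_neutral_right[OF _ sub])
    show "\<forall>p\<in>?S - ratio_class q half b. norm (u (fst p) * cnj (u (snd p))) = 0"
    proof
      fix p assume "p \<in> ?S - ratio_class q half b"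
      hence "fst p \<notin> {1..half} \<or> snd p \<notin> {1..half}" by (cases p) (auto simp: ratio_class_def)
      hence "norm (u (fst p)) \<le> 0 \<or> norm (u (snd p)) \<le> 0" using assms(1)[of "fst p"] assms(1)[of "snd p"] by (elim disjE) (simp_all only: if_False simp_thms)
      thus "norm (u (fst p) * cnj (u (snd p))) = 0" by auto
    qed
  qed simp
  also have "\<dots> \<le> (\<Sum>p\<in>ratio_class q half b. (c * kap q (fst p)) * (c * kap q (snd p)))"
  proof (rule sum_mono)
    fix p assume "p \<in> ratio_class q half b"
    hence "fst p \<in> {1..half}" "snd p \<in> {1..half}" by (auto simp: ratio_class_def)
    hence "norm (u (fst p)) \<le> c * kap q (fst p)" "norm (u (snd p)) \<le> c * kap q (snd p)"
      using assms(1)[of "fst p"] assms(1)[of "snd p"] by simp_all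
    thus "norm (u (fst p) * cnj (u (snd p))) \<le> (c * kap q (fst p)) * (c * kap q (snd p))"
      unfolding norm_mult complex_mod_cnj using assms(2) kap_nonneg by (intro mult_mono) auto
  qed
  finally show ?thesis by (simp add: sum_distrib_left power2_eq_square mult_ac)
qed

text \<open>After \<open>fourier_triple\<close> the character \<open>psi\<close> appears only as a
  factor of norm at most 1, which makes the bound uniform in \<open>psi\<close>.\<close>

lemma triple_sum_le:
  assumes psi: "psi \<in> characters q" and f: "\<And>chi. chi \<in> characters q \<Longrightarrow> complex_of_real (f chi) = fourier q rho chi"
  shows "(\<Sum>chi1\<in>characters q. \<Sum>chi2\<in>characters q. f chi1 * f chi2 * f (\<lambda>n. psi n * cnj (chi1 n) * cnj (chi2 n)))
    \<le> real (q - 1) ^ 2 * (\<Sum>b\<in>{1..<q}. norm (rho b) ^ 3)"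
proof -
  let ?X = "characters q"
  have third: "(\<lambda>n. psi n * cnj (chi1 n) * cnj (chi2 n)) \<in> ?X" if "chi1 \<in> ?X" "chi2 \<in> ?X" for chi1 chi2
    using that psi by (intro characters_mult characters_cnj)
  have "complex_of_real (\<Sum>chi1\<in>?X. \<Sum>chi2\<in>?X. f chi1 * f chi2 * f (\<lambda>n. psi n * cnj (chi1 n) * cnj (chi2 n)))
      = (\<Sum>chi1\<in>?X. \<Sum>chi2\<in>?X. fourier q rho chi1 * fourier q rho chi2 *
            fourier q rho (\<lambda>n. psi n * cnj (chi1 n) * cnj (chi2 n)))"
    unfolding of_real_sum of_real_mult by (intro sum.cong refl) (simp only: f third)
  also have "\<dots> = of_nat (q - 1) ^ 2 * (\<Sum>a\<in>{1..<q}. psi a * rho a ^ 3)" by (rule fourier_triple[OF psi])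
  finally have "norm (complex_of_real (\<Sum>chi1\<in>?X. \<Sum>chi2\<in>?X. f chi1 * f chi2 * f (\<lambda>n. psi n * cnj (chi1 n) * cnj (chi2 n))))
      = real (q - 1) ^ 2 * norm (\<Sum>a\<in>{1..<q}. psi a * rho a ^ 3)"
    by (simp add: norm_mult norm_power del: of_nat_diff)
  also have "norm (\<Sum>a\<in>{1..<q}. psi a * rho a ^ 3) \<le> (\<Sum>a\<in>{1..<q}. norm (rho a) ^ 3)"
  proof (rule sum_norm_le)
    fix a assume "a \<in> {1..<q}"
    show "norm (psi a * rho a ^ 3) \<le> norm (rho a) ^ 3"
      using norm_character_le[OF psi, of a] by (simp add: norm_mult norm_power mult_left_le_one_le)
  qed
  finally show ?thesis unfolding norm_of_real by (simp add: mult_left_mono)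
qed

text \<open>\<open>c1\<close> is the direct sum over \<open>fall\<close>; \<open>c2\<close> and
  \<open>c3\<close> are the two halves of the dual sum over \<open>rise\<close>. \<open>Y\<close> is
  the integer part of sqrt q, and K \<ge> Y keeps the support of \<open>fall\<close> inside the
  truncated series. All three share one majorant, valid for every large \<open>K\<close>.\<close>

lemma L_half_partial_majorant:
  assumes Y: "Y \<ge> 1" "Y\<^sup>2 \<le> q" "q < (Y + 1)\<^sup>2" and K: "K \<ge> 1" "K \<ge> Y" "4 / sqrt K \<le> 1 / (real Y * sqrt Y)"
  obtains c1 c2 c3 :: "nat \<Rightarrow> complex" where
    "\<And>a. norm (c1 a) \<le> (if a \<in> {1..half} then 12 * kap q a else 0)"
    "\<And>a. norm (c2 a) \<le> (if a \<in> {1..half} then 12 * kap q a else 0)"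
    "\<And>a. norm (c3 a) \<le> (if a \<in> {1..half} then 12 * kap q a else 0)"
    "\<And>chi. chi \<in> characters q \<Longrightarrow> chi \<noteq> principal_char q \<Longrightarrow> (norm (L_half_partial (Suc K) chi))\<^sup>2 \<le>
       3 * ((norm (fourier q c1 chi))\<^sup>2 + (norm (fourier q c2 chi))\<^sup>2 + (norm (fourier q c3 chi))\<^sup>2)"
proof
  define D where "D a = (\<Sum>n\<in>{1..Suc K}. of_real (rise Y n) * unit_root q a ^ n) / sqrt q" for a
  define c1 where "c1 a = (if a \<in> {1..half} then complex_of_real (fall Y a) else 0)" for a
  define c2 where "c2 a = (if a \<in> {1..half} then D a else 0)" for a
  define c3 where "c3 a = (if a \<in> {1..half} then D (q - a) else 0)" for a
  have YH: "Y \<le> half"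
  proof (rule ccontr)
    assume "\<not> Y \<le> half"
    hence "half + 1 \<le> Y" by simp
    hence "(half + 1)\<^sup>2 \<le> Y\<^sup>2" by (intro power_mono) auto
    hence "(half + 1)\<^sup>2 \<le> 2 * half + 1" using Y(2) q_eq_half by linarith
    hence "half = 0" by (simp add: power2_eq_square)
    thus False using q_eq_half q_gt_2 by simp
  qed
  show "norm (c1 a) \<le> (if a \<in> {1..half} then 12 * kap q a else 0)" for a
  proof (cases "a \<in> {1..half}")
    case a: True
    have "fall Y a \<le> kap q a"
      using a Y fall_le_kap[of a Y] fall_eq_0[of Y a] kap_nonneg[of q a] by (cases "a \<le> Y") auto
    thus ?thesis using a fall_nonneg[of a Y] kap_nonneg[of q a] by (simp add: c1_def)
  next
    case False
    hence "c1 a = 0" unfolding c1_def by (rule if_not_P)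
    thus ?thesis using kap_nonneg[of q a] by simp
  qed
  show "norm (c2 a) \<le> (if a \<in> {1..half} then 12 * kap q a else 0)" for a
  proof (cases "a \<in> {1..half}")
    case a: True
    have "norm (D a) \<le> 12 * kap q a"
      unfolding D_def by (rule dual_coefficient_bound[OF a Y(1,3) K(1,3) norm_root norm_one_minus_root(1)[OF a]])
    thus ?thesis using a by (simp add: c2_def)
  next
    case False
    hence "c2 a = 0" unfolding c2_def by (rule if_not_P)
    thus ?thesis using kap_nonneg[of q a] by simp
  qed
  show "norm (c3 a) \<le> (if a \<in> {1..half} then 12 * kap q a else 0)" for a
  proof (cases "a \<in> {1..half}")
    case a: True
    have "norm (D (q - a)) \<le> 12 * kap q a"
      unfolding D_def by (rule dual_coefficient_bound[OF a Y(1,3) K(1,3) norm_root norm_one_minus_root(2)[OF a]])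
    thus ?thesis using a by (simp add: c3_def)
  next
    case False
    hence "c3 a = 0" unfolding c3_def by (rule if_not_P)
    thus ?thesis using kap_nonneg[of q a] by simp
  qed
  fix chi assume chi: "chi \<in> characters q" "chi \<noteq> principal_char q"
  have "L_half_partial (Suc K) chi
      = (\<Sum>n\<in>{1..Suc K}. of_real (fall Y n) * chi n) + (\<Sum>n\<in>{1..Suc K}. of_real (rise Y n) * chi n)"
    unfolding L_half_partial_def sum.distrib[symmetric] by (intro sum.cong refl) (simp add: fall_def algebra_simps)
  hence "norm (L_half_partial (Suc K) chi) \<le> norm (\<Sum>n\<in>{1..Suc K}. of_real (fall Y n) * chi n)
      + norm (\<Sum>n\<in>{1..Suc K}. of_real (rise Y n) * chi n)" by (simp only: norm_triangle_ineq)
  also have "(\<Sum>n\<in>{1..Suc K}. of_real (fall Y n) * chi n) = fourier q c1 chi"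
  proof -
    have "(\<Sum>n\<in>{1..Suc K}. of_real (fall Y n) * chi n) = (\<Sum>n\<in>{1..Y}. of_real (fall Y n) * chi n)"
      by (rule sum.mono_neutral_right) (use K fall_eq_0 in auto)
    also have "\<dots> = (\<Sum>n\<in>{1..Y}. c1 n * chi n)"
      by (intro sum.cong refl) (use YH in \<open>auto simp: c1_def\<close>)
    also have "\<dots> = (\<Sum>n\<in>{1..<q}. c1 n * chi n)"
      by (rule sum.mono_neutral_left) (use YH q_eq_half fall_eq_0 in \<open>auto simp: c1_def\<close>)
    finally show ?thesis by (simp add: fourier_def)
  qed
  also have "norm (\<Sum>n\<in>{1..Suc K}. of_real (rise Y n) * chi n) = norm (fourier q D chi)"
    unfolding D_def by (rule norm_character_sum_dual[OF chi])
  also have "\<dots> \<le> norm (fourier q c2 chi) + norm (fourier q c3 chi)"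
  proof -
    have "norm (fourier q D chi) = norm (fourier q c2 chi + chi (q - 1) * fourier q c3 chi)"
      using fourier_split[OF chi(1), of D] unfolding c2_def c3_def by simp
    also have "\<dots> \<le> norm (fourier q c2 chi) + norm (chi (q - 1) * fourier q c3 chi)" by (rule norm_triangle_ineq)
    also have "norm (chi (q - 1) * fourier q c3 chi) \<le> 1 * norm (fourier q c3 chi)"
      unfolding norm_mult by (intro mult_right_mono norm_character_le[OF chi(1)]) auto
    finally show ?thesis by simp
  qed
  finally have "norm (L_half_partial (Suc K) chi) \<le> norm (fourier q c1 chi) + (norm (fourier q c2 chi) + norm (fourier q c3 chi))" by simp
  hence "(norm (L_half_partial (Suc K) chi))\<^sup>2 \<le> (norm (fourier q c1 chi) + (norm (fourier q c2 chi) + norm (fourier q c3 chi)))\<^sup>2"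
    by (intro power_mono) auto
  moreover have "(x + (y + z))\<^sup>2 \<le> 3 * (x\<^sup>2 + y\<^sup>2 + z\<^sup>2)" for x y z :: real
  proof -
    have "3 * (x\<^sup>2 + y\<^sup>2 + z\<^sup>2) - (x + (y + z))\<^sup>2 = (x - y)\<^sup>2 + (y - z)\<^sup>2 + (x - z)\<^sup>2"
      by (simp add: power2_eq_square algebra_simps)
    moreover have "\<dots> \<ge> 0" by simp
    ultimately show ?thesis by linarith
  qed
  ultimately show "(norm (L_half_partial (Suc K) chi))\<^sup>2 \<le>
       3 * ((norm (fourier q c1 chi))\<^sup>2 + (norm (fourier q c2 chi))\<^sup>2 + (norm (fourier q c3 chi))\<^sup>2)"
    by (rule order_trans)
qed

text \<open>For the principal character the partial sums diverge, so the limit is an unspecified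
  value there; it is replaced by 0.\<close>

definition L_square :: "(nat \<Rightarrow> complex) \<Rightarrow> real" where
  "L_square chi = (if chi = principal_char q then 0 else (norm (dirichlet_L chi (1/2)))\<^sup>2)"

text \<open>The bound is proved for truncated series, uniformly in the truncation, and survives the
  limit. 1296 = 3 * 3 * 12^2: three from the square of a sum of three terms, three correlations, and
  the constant 12 of the majorants squared.\<close>

lemma triple_second_moment:
  assumes psi: "psi \<in> characters q"
  shows "(\<Sum>chi1\<in>characters q. \<Sum>chi2\<in>characters q. L_square chi1 * L_square chi2 * L_square (\<lambda>n. psi n * cnj (chi1 n) * cnj (chi2 n)))
    \<le> 1296 ^ 3 * 291600 * real (q - 1) ^ 2 * harm half ^ 3"
proof -
  let ?X = "characters q"
  define Y where "Y = (LEAST y. q < (y + 1)\<^sup>2)"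
  have "q < (q + 1)\<^sup>2" by (simp add: power2_eq_square)
  hence Y3: "q < (Y + 1)\<^sup>2" unfolding Y_def by (rule LeastI)
  have Y1: "Y \<ge> 1"
  proof (rule ccontr)
    assume "\<not> Y \<ge> 1"
    thus False using Y3 q_gt_2 by (simp add: not_le)
  qed
  have Y2: "Y\<^sup>2 \<le> q"
  proof (rule ccontr)
    assume "\<not> Y\<^sup>2 \<le> q"
    hence "q < (Y - 1 + 1)\<^sup>2" using Y1 by simp
    hence "Y \<le> Y - 1" unfolding Y_def by (rule Least_le)
    thus False using Y1 by simp
  qed
  define M where "M K chi = (if chi = principal_char q then 0 else (norm (L_half_partial (Suc K) chi))\<^sup>2)" for K chi
  have M0: "M K chi \<ge> 0" for K chi by (simp add: M_def)
  have lim1: "(\<lambda>K. M K chi) \<longlonglongrightarrow> L_square chi" if chi: "chi \<in> ?X" for chi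
  proof (cases "chi = principal_char q")
    case False
    have "(\<lambda>K. L_half_partial (Suc K) chi) \<longlonglongrightarrow> dirichlet_L chi (1/2)"
      using L_half_partial_tendsto[OF chi False] by (rule LIMSEQ_Suc)
    hence "(\<lambda>K. (norm (L_half_partial (Suc K) chi))\<^sup>2) \<longlonglongrightarrow> (norm (dirichlet_L chi (1/2)))\<^sup>2"
      by (intro tendsto_intros)
    thus ?thesis using False by (simp add: M_def L_square_def)
  qed (simp add: M_def L_square_def)
  have third: "(\<lambda>n. psi n * cnj (chi1 n) * cnj (chi2 n)) \<in> ?X" if "chi1 \<in> ?X" "chi2 \<in> ?X" for chi1 chi2
    using that psi by (intro characters_mult characters_cnj)
  let ?T = "\<lambda>F. \<Sum>chi1\<in>?X. \<Sum>chi2\<in>?X. F chi1 * F chi2 * F (\<lambda>n. psi n * cnj (chi1 n) * cnj (chi2 n)) :: real"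
  have lim: "(\<lambda>K. ?T (M K)) \<longlonglongrightarrow> ?T L_square"
    by (intro tendsto_sum tendsto_mult lim1 third)
  have bound: "?T (M K) \<le> 1296 ^ 3 * 291600 * real (q - 1) ^ 2 * harm half ^ 3"
    if K: "K \<ge> 1" "K \<ge> Y" "4 / sqrt K \<le> 1 / (real Y * sqrt Y)" for K
  proof -
    obtain c1 c2 c3 where c1: "\<And>a. norm (c1 a) \<le> (if a \<in> {1..half} then 12 * kap q a else 0)"
      and c2: "\<And>a. norm (c2 a) \<le> (if a \<in> {1..half} then 12 * kap q a else 0)"
      and c3: "\<And>a. norm (c3 a) \<le> (if a \<in> {1..half} then 12 * kap q a else 0)"
      and maj: "\<And>chi. chi \<in> ?X \<Longrightarrow> chi \<noteq> principal_char q \<Longrightarrow> (norm (L_half_partial (Suc K) chi))\<^sup>2 \<le>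
         3 * ((norm (fourier q c1 chi))\<^sup>2 + (norm (fourier q c2 chi))\<^sup>2 + (norm (fourier q c3 chi))\<^sup>2)"
      by (rule L_half_partial_majorant[OF Y1 Y2 Y3 K]) blast
    define f where "f chi = 3 * ((norm (fourier q c1 chi))\<^sup>2 + (norm (fourier q c2 chi))\<^sup>2 + (norm (fourier q c3 chi))\<^sup>2)" for chi
    define rho where "rho b = 3 * (correlation q c1 b + correlation q c2 b + correlation q c3 b)" for b
    let ?R = "\<lambda>b. \<Sum>p\<in>ratio_class q half b. kap q (fst p) * kap q (snd p)"
    have f0: "f chi \<ge> 0" for chi by (simp add: f_def)
    have Mf: "M K chi \<le> f chi" if "chi \<in> ?X" for chi
      using maj[OF that] f0[of chi] by (simp add: M_def f_def)
    have "complex_of_real (f chi) = fourier q rho chi" if chi: "chi \<in> ?X" for chi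
    proof -
      have "complex_of_real (f chi) = 3 * (fourier q (correlation q c1) chi + fourier q (correlation q c2) chi + fourier q (correlation q c3) chi)"
        unfolding f_def of_real_mult of_real_add fourier_correlation[OF chi] by simp
      also have "\<dots> = fourier q rho chi"
        unfolding fourier_def rho_def by (simp add: sum.distrib sum_distrib_left algebra_simps)
      finally show ?thesis .
    qed
    hence "?T f \<le> real (q - 1) ^ 2 * (\<Sum>b\<in>{1..<q}. norm (rho b) ^ 3)"
      by (intro triple_sum_le[OF psi])
    \<comment> \<open>Nonnegativity allows all three factors to be replaced by their majorants; from
      here on they are transforms of explicit correlations.\<close>
    moreover have "?T (M K) \<le> ?T f"
      by (intro sum_mono mult_mono Mf third M0 f0 mult_nonneg_nonneg)
    moreover have "(\<Sum>b\<in>{1..<q}. norm (rho b) ^ 3) \<le> (\<Sum>b\<in>{1..<q}. 1296 ^ 3 * ?R b ^ 3)"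
    proof (rule sum_mono)
      fix b
      have "norm (rho b) \<le> 3 * (norm (correlation q c1 b) + norm (correlation q c2 b) + norm (correlation q c3 b))"
        unfolding rho_def norm_mult
        using norm_triangle_ineq[of "correlation q c1 b + correlation q c2 b" "correlation q c3 b"]
          norm_triangle_ineq[of "correlation q c1 b" "correlation q c2 b"] by simp
      also have "\<dots> \<le> 3 * (12\<^sup>2 * ?R b + 12\<^sup>2 * ?R b + 12\<^sup>2 * ?R b)"
        by (intro mult_left_mono add_mono norm_correlation_le c1 c2 c3) auto
      also have "\<dots> = 1296 * ?R b" by (simp add: power2_eq_square)
      finally have "norm (rho b) ^ 3 \<le> (1296 * ?R b) ^ 3" by (intro power_mono) auto
      thus "norm (rho b) ^ 3 \<le> 1296 ^ 3 * ?R b ^ 3" by (simp only: power_mult_distrib)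
    qed
    moreover have "(\<Sum>b\<in>{1..<q}. 1296 ^ 3 * ?R b ^ 3) \<le> 1296 ^ 3 * (291600 * harm half ^ 3)"
      unfolding sum_distrib_left[symmetric]
      by (intro mult_left_mono sum_kap_ratio_class_cube) (use q_eq_half in auto)
    ultimately have "?T (M K) \<le> real (q - 1) ^ 2 * (\<Sum>b\<in>{1..<q}. norm (rho b) ^ 3)"
      and "(\<Sum>b\<in>{1..<q}. norm (rho b) ^ 3) \<le> 1296 ^ 3 * (291600 * harm half ^ 3)" by linarith+
    note this(1)
    also have "real (q - 1) ^ 2 * (\<Sum>b\<in>{1..<q}. norm (rho b) ^ 3)
        \<le> real (q - 1) ^ 2 * (1296 ^ 3 * (291600 * harm half ^ 3))"
      by (rule mult_left_mono[OF \<open>(\<Sum>b\<in>{1..<q}. norm (rho b) ^ 3) \<le> 1296 ^ 3 * (291600 * harm half ^ 3)\<close>]) simp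
    also have "\<dots> = 1296 ^ 3 * 291600 * real (q - 1) ^ 2 * harm half ^ 3" by (simp only: mult_ac)
    finally show ?thesis .
  qed
  have "eventually (\<lambda>K. 4 / sqrt (real K) < 1 / (real Y * sqrt Y)) sequentially"
  proof (rule order_tendstoD)
    show "(\<lambda>K. 4 / sqrt (real K)) \<longlonglongrightarrow> 0"
      by (intro tendsto_divide_0[OF tendsto_const] filterlim_at_top_imp_at_infinity
            filterlim_compose[OF sqrt_at_top] filterlim_real_sequentially)
  qed (use Y1 in simp)
  hence "eventually (\<lambda>K. ?T (M K) \<le> 1296 ^ 3 * 291600 * real (q - 1) ^ 2 * harm half ^ 3) sequentially"
    using eventually_ge_at_top[of "max 1 Y"]
  proof eventually_elim
    case (elim K)
    thus ?case by (intro bound) auto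
  qed
  thus ?thesis by (rule tendsto_upperbound[OF lim]) simp
qed

end

section \<open>The L-series over odd integers\<close>

lemma sum_lessThan_add:
  fixes f :: "nat \<Rightarrow> complex"
  shows "(\<Sum>n<m + k. f n) = (\<Sum>n<m. f n) + (\<Sum>n<k. f (m + n))"
  by (induction k) (simp_all add: add.assoc)

lemma sum_odd_terms:
  fixes f :: "nat \<Rightarrow> complex"
  shows "(\<Sum>i<J. f (2 * i + 1)) = (\<Sum>n\<in>{1..2 * J}. f n) - (\<Sum>n\<in>{1..J}. f (2 * n))"
  by (induction J) simp_all

context odd_prime_modulus
begin

text \<open>As \<open>q\<close> is odd, exactly one of a and a + q is odd. For a in
  \<open>{1..<q}\<close> the positive odd integers congruent to a are
  \<open>odd_lift a + 2 * q * k\<close>.\<close>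

definition odd_lift :: "nat \<Rightarrow> nat" where
  "odd_lift a = (if odd a then a else a + q)"

text \<open>
  The subtracted terms do not depend on \<open>a\<close>, hence are annihilated by every nonprincipal character;
  they make the series over the class of \<open>a\<close> converge.
\<close>

definition odd_tail :: "nat \<Rightarrow> nat \<Rightarrow> real" where
  "odd_tail a k = 1 / sqrt (real (odd_lift a + 2 * q * Suc k)) - 1 / sqrt (real (2 * q * Suc k))"

text \<open>The regularised sum of n^(-1/2) over the odd n congruent to a modulo
  \<open>q\<close>.\<close>

definition odd_coeff :: "nat \<Rightarrow> real" where
  "odd_coeff a = 1 / sqrt (odd_lift a) + (\<Sum>k. odd_tail a k)"

text \<open>Since \<open>odd_lift a\<close> is at most 2 q, the k-th point lies between the
  multiples k + 1 and k + 2 of 2 q, so the k-th term is dominated by a difference that telescopes to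
  1 / sqrt(2 q).\<close>

lemma odd_tail_bounds:
  assumes "a < q"
  shows "summable (odd_tail a)" "\<bar>\<Sum>k. odd_tail a k\<bar> \<le> 1 / sqrt q"
proof -
  define t where "t k = 1 / sqrt (real (2 * q * Suc k))" for k
  have "filterlim (\<lambda>k. real (2 * q) * real (Suc k)) at_top sequentially"
    using q_pos by (intro filterlim_tendsto_pos_mult_at_top[OF tendsto_const]
        filterlim_compose[OF filterlim_real_sequentially] filterlim_Suc) simp
  hence "filterlim (\<lambda>k. sqrt (real (2 * q * Suc k))) at_top sequentially"
    by (intro filterlim_compose[OF sqrt_at_top]) (simp only: of_nat_mult)
  hence "t \<longlonglongrightarrow> 0" unfolding t_def
    by (intro tendsto_divide_0[OF tendsto_const] filterlim_at_top_imp_at_infinity)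
  hence tel: "(\<lambda>k. t k - t (Suc k)) sums t 0" using telescope_sums'[of t 0] by simp
  have le: "norm (odd_tail a k) \<le> t k - t (Suc k)" for k
  proof -
    have "odd_lift a \<le> 2 * q" using assms by (simp add: odd_lift_def)
    hence "odd_lift a + 2 * q * Suc k \<le> 2 * q * Suc (Suc k)" by simp
    hence "real (odd_lift a + 2 * q * Suc k) \<le> real (2 * q * Suc (Suc k))" by (rule of_nat_mono)
    moreover have pos: "0 < real (2 * q * Suc k)" unfolding of_nat_0_less_iff using q_pos by simp
    moreover have ge: "real (2 * q * Suc k) \<le> real (odd_lift a + 2 * q * Suc k)" by (rule of_nat_mono) simp
    ultimately have "t (Suc k) \<le> 1 / sqrt (real (odd_lift a + 2 * q * Suc k))"
      unfolding t_def by (intro divide_left_mono real_sqrt_le_mono mult_pos_pos) auto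
    moreover have "1 / sqrt (real (odd_lift a + 2 * q * Suc k)) \<le> t k"
      unfolding t_def using pos ge by (intro divide_left_mono real_sqrt_le_mono mult_pos_pos) auto
    ultimately show ?thesis unfolding odd_tail_def t_def[symmetric] real_norm_def by linarith
  qed
  have sumn: "summable (\<lambda>k. norm (odd_tail a k))"
    by (rule summable_comparison_test'[OF sums_summable[OF tel], of 0]) (use le in simp)
  thus summ: "summable (odd_tail a)" by (rule summable_norm_cancel)
  have "norm (\<Sum>k. odd_tail a k) \<le> (\<Sum>k. norm (odd_tail a k))" by (rule summable_norm[OF sumn])
  also have "\<dots> \<le> (\<Sum>k. t k - t (Suc k))" by (rule suminf_le[OF le sumn sums_summable[OF tel]])
  also have "\<dots> = t 0" using sums_unique[OF tel] by simp
  also have "\<dots> \<le> 1 / sqrt q" using q_pos unfolding t_def by (intro divide_left_mono real_sqrt_le_mono) auto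
  finally show "\<bar>\<Sum>k. odd_tail a k\<bar> \<le> 1 / sqrt q" by simp
qed

lemma sum_odd_residues:
  fixes f :: "nat \<Rightarrow> complex"
  assumes chi: "chi \<in> characters q"
  shows "(\<Sum>i<q. f (2 * i + 1) * chi (2 * i + 1)) = (\<Sum>a\<in>{1..<q}. f (odd_lift a) * chi a)"
proof -
  have chiq: "chi q = 0" using character_eq_0_iff[OF chi, of q] q_gt_2 by simp
  \<comment> \<open>The index \<open>half\<close> gives the odd number \<open>q\<close> itself,
    where \<open>chi\<close> vanishes; the other odd numbers below 2 q meet every reduced class
    once.\<close>
  have "(\<Sum>i<q. f (2 * i + 1) * chi (2 * i + 1)) = (\<Sum>i\<in>{..<q} - {half}. f (2 * i + 1) * chi (2 * i + 1))"
    by (rule sum.mono_neutral_right) (use chiq q_eq_half in auto)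
  also have "\<dots> = (\<Sum>a\<in>{1..<q}. f (odd_lift a) * chi a)"
  proof (rule sum.reindex_bij_witness[of _ "\<lambda>a. (odd_lift a - 1) div 2" "\<lambda>i. if 2 * i + 1 < q then 2 * i + 1 else 2 * i + 1 - q"])
    fix i assume "i \<in> {..<q} - {half}"
    hence i: "i < 2 * half + 1" "i \<noteq> half" using q_eq_half by auto
    let ?j = "if 2 * i + 1 < q then 2 * i + 1 else 2 * i + 1 - q"
    have lift: "odd_lift ?j = 2 * i + 1"
    proof (cases "2 * i + 1 < q")
      case False
      have "even (2 * i + 1 - q)" using False odd_q by simp
      thus ?thesis using False by (simp add: odd_lift_def)
    qed (simp add: odd_lift_def)
    show "(odd_lift ?j - 1) div 2 = i" unfolding lift by simp
    show "?j \<in> {1..<q}" using i q_eq_half by auto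
    have "[?j = 2 * i + 1] (mod q)" by (simp add: cong_def le_mod_geq)
    from character_cong[OF chi this]
    show "f (odd_lift ?j) * chi ?j = f (2 * i + 1) * chi (2 * i + 1)" unfolding lift by (simp only:)
  next
    fix a assume "a \<in> {1..<q}"
    hence a: "1 \<le> a" "a < 2 * half + 1" using q_eq_half by auto
    have o: "odd (odd_lift a)" using odd_q by (simp add: odd_lift_def)
    then obtain k where k: "odd_lift a = 2 * k + 1" by (elim oddE)
    hence hk: "(odd_lift a - 1) div 2 = k" by simp
    show "(if 2 * ((odd_lift a - 1) div 2) + 1 < q then 2 * ((odd_lift a - 1) div 2) + 1
           else 2 * ((odd_lift a - 1) div 2) + 1 - q) = a"
      unfolding hk k[symmetric] using a q_eq_half by (auto simp: odd_lift_def)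
    have "k < q" "k \<noteq> half"
      using k a q_eq_half by (auto simp: odd_lift_def split: if_splits)
    thus "(odd_lift a - 1) div 2 \<in> {..<q} - {half}" unfolding hk by simp
  qed
  finally show ?thesis .
qed

text \<open>Multiplying the series up to J by chi(2) / sqrt 2 yields the even terms up to 2 J, so
  the difference is the odd part. With J a multiple of \<open>q\<close> it consists of whole blocks
  of \<open>q\<close> odd numbers; the first block supplies the leading term and the others the
  tails.\<close>

lemma odd_part_partial:
  assumes chi: "chi \<in> characters q" "chi \<noteq> principal_char q"
  shows "L_half_partial (2 * (q * Suc K)) chi - chi 2 / sqrt 2 * L_half_partial (q * Suc K) chi
    = fourier q (\<lambda>a. of_real (1 / sqrt (odd_lift a) + (\<Sum>k<K. odd_tail a k))) chi"
proof -
  define f where "f n = complex_of_real (1 / sqrt (real n))" for n :: nat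
  have even: "chi 2 / sqrt 2 * L_half_partial J chi = (\<Sum>n\<in>{1..J}. f (2 * n) * chi (2 * n))" for J
    unfolding L_half_partial_def sum_distrib_left
    by (intro sum.cong refl) (simp only: character_mult[OF chi(1)] f_def of_nat_mult real_sqrt_mult, simp)
  have per: "chi (2 * (q * k + i) + 1) = chi (2 * i + 1)" for k i
  proof (rule character_cong[OF chi(1)])
    have "2 * (q * k + i) + 1 = (2 * i + 1) + (2 * k) * q" by (simp add: algebra_simps)
    thus "[2 * (q * k + i) + 1 = 2 * i + 1] (mod q)" by (simp only: cong_def mod_mult_self1)
  qed
  have block: "(\<Sum>i<q. f (2 * (q * k + i) + 1) * chi (2 * (q * k + i) + 1)) = (\<Sum>a\<in>{1..<q}. f (odd_lift a + 2 * q * k) * chi a)" for k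
  proof -
    have "(\<Sum>i<q. f (2 * (q * k + i) + 1) * chi (2 * (q * k + i) + 1)) = (\<Sum>i<q. f ((2 * i + 1) + 2 * q * k) * chi (2 * i + 1))"
      unfolding per by (intro sum.cong refl) (simp add: algebra_simps)
    also have "\<dots> = (\<Sum>a\<in>{1..<q}. f (odd_lift a + 2 * q * k) * chi a)"
      by (rule sum_odd_residues[OF chi(1), of "\<lambda>n. f (n + 2 * q * k)"])
    finally show ?thesis .
  qed
  have tail: "(\<Sum>a\<in>{1..<q}. f (odd_lift a + 2 * q * Suc k) * chi a) = (\<Sum>a\<in>{1..<q}. of_real (odd_tail a k) * chi a)" for k
  proof -
    have "(\<Sum>a\<in>{1..<q}. of_real (odd_tail a k) * chi a)
        = (\<Sum>a\<in>{1..<q}. f (odd_lift a + 2 * q * Suc k) * chi a) - f (2 * q * Suc k) * (\<Sum>a\<in>{1..<q}. chi a)"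
      unfolding sum_distrib_left sum_subtractf[symmetric] odd_tail_def f_def of_real_diff
      by (intro sum.cong refl) (simp only: left_diff_distrib)
    thus ?thesis using sum_character[OF chi] by simp
  qed
  have "L_half_partial (2 * (q * Suc K)) chi - chi 2 / sqrt 2 * L_half_partial (q * Suc K) chi
      = (\<Sum>i<q * Suc K. f (2 * i + 1) * chi (2 * i + 1))"
    unfolding even sum_odd_terms[of "\<lambda>n. f n * chi n" "q * Suc K"] by (simp add: L_half_partial_def f_def)
  also have "\<dots> = (\<Sum>a\<in>{1..<q}. of_real (1 / sqrt (odd_lift a) + (\<Sum>k<K. odd_tail a k)) * chi a)"
  proof (induction K)
    case 0
    show ?case using block[of 0] by (simp add: f_def)
  next
    case (Suc K)
    have "q * Suc (Suc K) = q * Suc K + q" by simp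
    hence "(\<Sum>i<q * Suc (Suc K). f (2 * i + 1) * chi (2 * i + 1))
        = (\<Sum>i<q * Suc K. f (2 * i + 1) * chi (2 * i + 1)) + (\<Sum>i<q. f (2 * (q * Suc K + i) + 1) * chi (2 * (q * Suc K + i) + 1))"
      by (simp only: sum_lessThan_add)
    also have "\<dots> = (\<Sum>a\<in>{1..<q}. of_real (1 / sqrt (odd_lift a) + (\<Sum>k<K. odd_tail a k)) * chi a)
        + (\<Sum>a\<in>{1..<q}. of_real (odd_tail a K) * chi a)"
      by (simp only: Suc.IH block tail)
    also have "\<dots> = (\<Sum>a\<in>{1..<q}. of_real (1 / sqrt (odd_lift a) + (\<Sum>k<Suc K. odd_tail a k)) * chi a)"
      unfolding sum.distrib[symmetric] sum.lessThan_Suc of_real_add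
      by (intro sum.cong refl) (simp only: distrib_right add.assoc)
    finally show ?case .
  qed
  finally show ?thesis unfolding fourier_def .
qed

lemma fourier_odd_coeff:
  assumes chi: "chi \<in> characters q" "chi \<noteq> principal_char q"
  shows "fourier q (\<lambda>a. of_real (odd_coeff a)) chi = (1 - chi 2 / sqrt 2) * dirichlet_L chi (1/2)"
proof -
  let ?L = "dirichlet_L chi (1/2)"
  have sub: "(\<lambda>K. L_half_partial (c * (q * Suc K)) chi) \<longlonglongrightarrow> ?L" if "c > 0" for c
  proof -
    have "strict_mono (\<lambda>K. c * (q * Suc K))"
      using that q_pos by (intro strict_monoI) simp
    from LIMSEQ_subseq_LIMSEQ[OF L_half_partial_tendsto[OF chi] this] show ?thesis by (simp only: o_def)
  qed
  have "(\<lambda>K. L_half_partial (2 * (q * Suc K)) chi - chi 2 / sqrt 2 * L_half_partial (1 * (q * Suc K)) chi)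
      \<longlonglongrightarrow> ?L - chi 2 / sqrt 2 * ?L"
    by (intro tendsto_diff tendsto_mult tendsto_const sub) auto
  hence 1: "(\<lambda>K. fourier q (\<lambda>a. of_real (1 / sqrt (odd_lift a) + (\<Sum>k<K. odd_tail a k))) chi)
      \<longlonglongrightarrow> ?L - chi 2 / sqrt 2 * ?L"
    by (simp only: mult_1 odd_part_partial[OF chi])
  have 2: "(\<lambda>K. fourier q (\<lambda>a. of_real (1 / sqrt (odd_lift a) + (\<Sum>k<K. odd_tail a k))) chi)
      \<longlonglongrightarrow> fourier q (\<lambda>a. of_real (odd_coeff a)) chi"
    unfolding fourier_def odd_coeff_def
    by (intro tendsto_sum tendsto_mult tendsto_of_real tendsto_add tendsto_const summable_LIMSEQ odd_tail_bounds(1)) auto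
  show ?thesis using LIMSEQ_unique[OF 2 1] by (simp add: algebra_simps)
qed

section \<open>Approximation of the centered coefficients\<close>

definition odd_main :: "nat \<Rightarrow> real" where
  "odd_main a = (if odd a then 1 / sqrt a else 0)"

text \<open>Subtracting the mean makes the transform vanish at the principal character and leaves it
  unchanged at all others, so complete sums over characters can be used.\<close>

definition centered_coeff :: "nat \<Rightarrow> real" where
  "centered_coeff a = odd_coeff a - (\<Sum>b\<in>{1..<q}. odd_coeff b) / real (q - 1)"

definition centered_odd_L :: "(nat \<Rightarrow> complex) \<Rightarrow> complex" where
  "centered_odd_L chi = fourier q (\<lambda>a. of_real (centered_coeff a)) chi"

lemma centered_odd_L_eq:
  assumes chi: "chi \<in> characters q"
  shows "centered_odd_L chi = (if chi = principal_char q then 0 else (1 - chi 2 / sqrt 2) * dirichlet_L chi (1/2))"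
proof -
  define mu where "mu = (\<Sum>b\<in>{1..<q}. odd_coeff b) / real (q - 1)"
  have eq: "centered_odd_L chi = fourier q (\<lambda>a. of_real (odd_coeff a)) chi - of_real mu * (\<Sum>a\<in>{1..<q}. chi a)"
    unfolding centered_odd_L_def fourier_def centered_coeff_def mu_def[symmetric] sum_distrib_left
      sum_subtractf[symmetric] of_real_diff left_diff_distrib ..
  show ?thesis
  proof (cases "chi = principal_char q")
    case True
    have "fourier q (\<lambda>a. of_real (odd_coeff a)) chi = (\<Sum>a\<in>{1..<q}. complex_of_real (odd_coeff a))"
      unfolding fourier_def by (intro sum.cong refl) (simp add: True principal_char_def coprime_q)
    also have "\<dots> = of_real (mu * real (q - 1))" using q_gt_2 unfolding mu_def of_real_sum[symmetric] by simp
    also have "\<dots> = of_real mu * of_nat (q - 1)" by (simp only: of_real_mult of_real_of_nat_eq)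
    finally show ?thesis using eq True by (simp only: sum_principal_char) simp
  next
    case False
    thus ?thesis using eq sum_character[OF chi False] fourier_odd_coeff[OF chi False] by simp
  qed
qed

lemma sum_odd_main: "(\<Sum>a\<in>{1..<q}. odd_main a) \<le> 2 * sqrt q"
proof -
  have "(\<Sum>a\<in>{1..<q}. odd_main a) \<le> (\<Sum>a\<in>{1..q}. 1 / sqrt (real a))"
    unfolding odd_main_def by (intro order_trans[OF sum_mono sum_mono2]) auto
  thus ?thesis using sum_inverse_sqrt[of q] by linarith
qed

text \<open>Replacing the lift and dropping the tail cost 1 / sqrt q each; the mean is at most 6 /
  sqrt q, of which 4 come from the sum of \<open>odd_main\<close> and 2 from these errors.\<close>

lemma centered_coeff_approx:
  assumes a: "a \<in> {1..<q}"
  shows "\<bar>centered_coeff a - odd_main a\<bar> \<le> 8 / sqrt q"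
proof -
  define mu where "mu = (\<Sum>b\<in>{1..<q}. odd_coeff b) / real (q - 1)"
  have sq: "sqrt (real q) > 0" using q_pos by simp
  have approx: "\<bar>odd_coeff b - odd_main b\<bar> \<le> 2 / sqrt q" if b: "b \<in> {1..<q}" for b
  proof -
    have "\<bar>1 / sqrt (odd_lift b) - odd_main b\<bar> \<le> 1 / sqrt q"
      using q_pos by (auto simp: odd_lift_def odd_main_def intro!: divide_left_mono)
    moreover have "\<bar>\<Sum>k. odd_tail b k\<bar> \<le> 1 / sqrt q" using b by (intro odd_tail_bounds) simp
    moreover have "2 / sqrt q = 1 / sqrt q + 1 / sqrt q" by simp
    ultimately show ?thesis unfolding odd_coeff_def by linarith
  qed
  have "\<bar>\<Sum>b\<in>{1..<q}. odd_coeff b\<bar> \<le> (\<Sum>b\<in>{1..<q}. odd_main b + 2 / sqrt q)"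
  proof (rule order_trans[OF sum_abs sum_mono])
    fix b assume b: "b \<in> {1..<q}"
    have "odd_main b \<ge> 0" by (simp add: odd_main_def)
    thus "\<bar>odd_coeff b\<bar> \<le> odd_main b + 2 / sqrt q" using approx[OF b] by linarith
  qed
  also have "\<dots> = (\<Sum>b\<in>{1..<q}. odd_main b) + real (q - 1) * (2 / sqrt q)" by (simp add: sum.distrib)
  also have "\<dots> \<le> 2 * sqrt q + real (q - 1) * (2 / sqrt q)" using sum_odd_main by simp
  also have "2 * sqrt q \<le> real (q - 1) * (4 / sqrt q)"
  proof -
    have "sqrt q * sqrt q = real q" by simp
    hence "2 * sqrt q * sqrt q = 2 * real q" by (simp only: mult.assoc)
    moreover have "2 * real q \<le> real (q - 1) * 4" using q_gt_2 by (simp add: of_nat_diff)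
    ultimately have "2 * sqrt q * sqrt q \<le> real (q - 1) * 4" by (simp only:)
    hence "2 * sqrt q \<le> real (q - 1) * 4 / sqrt q" unfolding pos_le_divide_eq[OF sq] .
    thus ?thesis by (simp only: times_divide_eq_right)
  qed
  finally have "\<bar>\<Sum>b\<in>{1..<q}. odd_coeff b\<bar> \<le> real (q - 1) * (6 / sqrt q)" by (simp add: algebra_simps)
  hence "\<bar>mu\<bar> \<le> 6 / sqrt q"
    using q_gt_2 unfolding mu_def abs_divide by (simp add: divide_le_eq mult.commute)
  moreover have "8 / sqrt q = 6 / sqrt q + 2 / sqrt q" by simp
  ultimately show ?thesis using approx[OF a] unfolding centered_coeff_def mu_def[symmetric] by linarith
qed

end

section \<open>First, second and cubic moments\<close>

lemma harm_le_ln: "n \<ge> 1 \<Longrightarrow> harm n \<le> 1 + ln (real n)"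
  using euler_mascheroni_sequence_decreasing[of 1 n] by (simp add: harm_def)

text \<open>Cauchy-Schwarz as a support count: a large sum with a small second moment forces many
  nonzero terms. It is applied to single characters and to triples.\<close>

lemma norm_sum_square_le:
  fixes f :: "'a \<Rightarrow> complex"
  assumes fin: "finite S" and sub: "T \<subseteq> S" and zero: "\<And>x. x \<in> S - T \<Longrightarrow> f x = 0"
  shows "(norm (\<Sum>x\<in>S. f x))\<^sup>2 \<le> real (card T) * (\<Sum>x\<in>S. (norm (f x))\<^sup>2)"
proof -
  have "(\<Sum>x\<in>S. f x) = (\<Sum>x\<in>T. f x)" using fin sub zero by (intro sum.mono_neutral_right) auto
  hence "norm (\<Sum>x\<in>S. f x) \<le> (\<Sum>x\<in>T. 1 * norm (f x))" using norm_sum[of f T] by simp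
  hence "(norm (\<Sum>x\<in>S. f x))\<^sup>2 \<le> (\<Sum>x\<in>T. 1 * norm (f x))\<^sup>2" by (intro power_mono) auto
  also have "\<dots> \<le> (\<Sum>x\<in>T. 1\<^sup>2) * (\<Sum>x\<in>T. (norm (f x))\<^sup>2)" by (rule Cauchy_Schwarz_ineq_sum)
  also have "\<dots> \<le> real (card T) * (\<Sum>x\<in>S. (norm (f x))\<^sup>2)"
    using fin sub by (simp add: mult_left_mono sum_mono2)
  finally show ?thesis .
qed

context odd_prime_modulus
begin

lemma odd_main_nonneg: "odd_main a \<ge> 0"
  by (simp add: odd_main_def)

text \<open>The coefficient 1/2 of the logarithm is the gain from the odd series: 1 / (2 k + 3) is
  compared with half of 1 / (k + 1).\<close>

lemma sum_odd_main_square: "(\<Sum>a\<in>{1..<q}. odd_main a ^ 2) \<le> 3 / 2 + ln q / 2"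
proof -
  have main: "(\<Sum>a\<in>{1..<2 * k + 3}. odd_main a ^ 2) \<le> 1 + harm k / 2" for k
  proof (induction k)
    case 0
    have "{1..<3::nat} = {1, 2}" by auto
    thus ?case by (simp add: odd_main_def harm_def)
  next
    case (Suc k)
    have set: "{1..<2 * Suc k + 3} = insert (2 * k + 3) (insert (2 * k + 4) {1..<2 * k + 3})" by auto
    have "(\<Sum>a\<in>{1..<2 * Suc k + 3}. odd_main a ^ 2)
        = odd_main (2 * k + 3) ^ 2 + (odd_main (2 * k + 4) ^ 2 + (\<Sum>a\<in>{1..<2 * k + 3}. odd_main a ^ 2))"
      unfolding set by simp
    also have "odd_main (2 * k + 4) ^ 2 = 0" by (simp add: odd_main_def)
    also have "odd_main (2 * k + 3) ^ 2 = 1 / (2 * real k + 3)" by (simp add: odd_main_def power_divide)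
    also have "\<dots> \<le> 1 / (2 * (real k + 1))" by (intro divide_left_mono) auto
    also have "\<dots> = inverse (real (Suc k)) / 2" by (simp add: inverse_eq_divide add.commute)
    finally have "(\<Sum>a\<in>{1..<2 * Suc k + 3}. odd_main a ^ 2)
        \<le> inverse (real (Suc k)) / 2 + (0 + (\<Sum>a\<in>{1..<2 * k + 3}. odd_main a ^ 2))" by simp
    also have "\<dots> \<le> inverse (real (Suc k)) / 2 + (0 + (1 + harm k / 2))" using Suc by simp
    also have "\<dots> = 1 + harm (Suc k) / 2" by (simp add: harm_Suc add_divide_distrib)
    finally show ?case .
  qed
  have "half \<ge> 1" using q_gt_2 q_eq_half by linarith
  then obtain k where k: "half = Suc k" by (cases half) auto
  hence q: "q = 2 * k + 3" using q_eq_half by simp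
  have "harm k \<le> (harm q :: real)" unfolding q by (rule harm_mono) simp
  moreover have "harm q \<le> 1 + ln (real q)" using q_pos by (intro harm_le_ln)
  ultimately have "1 + harm k / 2 \<le> 3 / 2 + ln (real q) / 2" by simp
  with main[of k] show ?thesis unfolding q[symmetric] by (rule order_trans)
qed

text \<open>Any bound below 1, the term at \<open>a = 1\<close>, would do. Comparison with 1 / x - 1
  / y, where y^2 = x^2 + 2, telescopes over odd integers; sqrt 3 \<ge> 5/3 makes 4/5 sufficient at
  the start.\<close>

lemma sum_odd_main_cube_tail: "(\<Sum>a\<in>{2..<q}. odd_main a ^ 3) \<le> 4 / 5"
proof -
  have cube: "odd_main (2 * k + 3) ^ 3 = 1 / (sqrt (2 * real k + 3) * (2 * real k + 3))" for k
    by (simp add: odd_main_def power_divide power3_eq_cube)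
  have base: "1 / (sqrt 3 * 3) \<le> 4 / 5 - 1 / sqrt (3::real)"
  proof -
    have "5 / 3 \<le> sqrt (3::real)" by (rule real_le_rsqrt) (simp add: power2_eq_square)
    hence "1 / sqrt 3 \<le> 3 / (5::real)" using divide_left_mono[of "5/3" "sqrt 3" "1::real"] by simp
    moreover have "1 / (sqrt 3 * 3) = (1 / sqrt 3) / (3::real)" by simp
    ultimately show ?thesis by linarith
  qed
  have main: "(\<Sum>a\<in>{2..<2 * k + 5}. odd_main a ^ 3) \<le> 4 / 5 - 1 / sqrt (2 * real k + 3)" for k
  proof (induction k)
    case 0
    have "{2..<5::nat} = {2, 3, 4}" by auto
    thus ?case using base cube[of 0] by (simp add: odd_main_def)
  next
    case (Suc k)
    define x where "x = sqrt (2 * real k + 3)"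
    define y where "y = sqrt (2 * real k + 5)"
    have pos: "x > 0" "y > 0" and le: "x \<le> y" and xy: "y * y = x * x + 2" and yy: "y * y = 2 * real k + 5"
      by (simp_all add: x_def y_def)
    have "(y - x) * (y + x) = 2" using xy by (simp add: algebra_simps)
    moreover have "(y - x) * (y + x) \<le> (y - x) * (2 * y)" using le by (intro mult_left_mono) auto
    ultimately have "1 \<le> (y - x) * y" by simp
    hence "1 * x \<le> ((y - x) * y) * y" using le pos by (intro mult_mono) auto
    hence "1 * x / (x * y * y * y) \<le> ((y - x) * y) * y / (x * y * y * y)" using pos by (intro divide_right_mono) auto
    moreover have "1 * x / (x * y * y * y) = 1 / (y * (y * y))" "((y - x) * y) * y / (x * y * y * y) = 1 / x - 1 / y"
      using pos by (simp_all add: field_simps)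
    ultimately have step: "1 / (y * (y * y)) \<le> 1 / x - 1 / y" by simp
    have set: "{2..<2 * Suc k + 5} = insert (2 * Suc k + 3) (insert (2 * k + 6) {2..<2 * k + 5})" by auto
    have "(\<Sum>a\<in>{2..<2 * Suc k + 5}. odd_main a ^ 3)
        = odd_main (2 * Suc k + 3) ^ 3 + (odd_main (2 * k + 6) ^ 3 + (\<Sum>a\<in>{2..<2 * k + 5}. odd_main a ^ 3))"
      unfolding set by simp
    also have "odd_main (2 * k + 6) ^ 3 = 0" by (simp add: odd_main_def)
    also have "odd_main (2 * Suc k + 3) ^ 3 = 1 / (y * (y * y))"
      unfolding cube[of "Suc k"] yy by (simp add: y_def add.commute)
    also have "1 / (y * (y * y)) + (0 + (\<Sum>a\<in>{2..<2 * k + 5}. odd_main a ^ 3)) \<le> 4 / 5 - 1 / y"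
      using step Suc unfolding x_def[symmetric] by linarith
    also have "y = sqrt (2 * real (Suc k) + 3)" by (simp add: y_def)
    finally show ?case .
  qed
  have "half \<ge> 1" using q_gt_2 q_eq_half by linarith
  then obtain j where j: "half = Suc j" by (cases half) auto
  have "(\<Sum>a\<in>{2..<q}. odd_main a ^ 3) \<le> (\<Sum>a\<in>{2..<2 * j + 5}. odd_main a ^ 3)"
    by (rule sum_mono2) (use j q_eq_half odd_main_nonneg in auto)
  also have "\<dots> \<le> 4 / 5 - 1 / sqrt (2 * real j + 3)" by (rule main)
  also have "\<dots> \<le> 4 / 5" by simp
  finally show ?thesis .
qed

lemma centered_coeff_1: "centered_coeff 1 \<ge> 1 - 8 / sqrt q"
  using centered_coeff_approx[of 1] q_gt_2 by (simp add: odd_main_def)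

text \<open>98 covers 3/2 from the main part, 32 from the cross term and 64 from the squared error;
  the coefficient of the logarithm stays 1/2.\<close>

lemma sum_centered_coeff_square: "(\<Sum>a\<in>{1..<q}. centered_coeff a ^ 2) \<le> 98 + ln q / 2"
proof -
  define d where "d = 8 / sqrt (real q)"
  have d: "d \<ge> 0" "d * sqrt q = 8" "d\<^sup>2 * real q = 64" using q_pos by (simp_all add: d_def power_divide)
  have "(\<Sum>a\<in>{1..<q}. centered_coeff a ^ 2) \<le> (\<Sum>a\<in>{1..<q}. odd_main a ^ 2 + 2 * d * odd_main a + d\<^sup>2)"
  proof (rule sum_mono)
    fix a assume a: "a \<in> {1..<q}"
    have "\<bar>centered_coeff a\<bar> \<le> odd_main a + d"
      using centered_coeff_approx[OF a] odd_main_nonneg[of a] unfolding d_def by linarith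
    hence "\<bar>centered_coeff a\<bar> ^ 2 \<le> (odd_main a + d) ^ 2" by (intro power_mono) auto
    thus "centered_coeff a ^ 2 \<le> odd_main a ^ 2 + 2 * d * odd_main a + d\<^sup>2" by (simp add: power2_eq_square algebra_simps)
  qed
  also have "\<dots> = (\<Sum>a\<in>{1..<q}. odd_main a ^ 2) + 2 * d * (\<Sum>a\<in>{1..<q}. odd_main a) + d\<^sup>2 * real (q - 1)"
    by (simp add: sum.distrib sum_distrib_left)
  also have "\<dots> \<le> (3 / 2 + ln q / 2) + 2 * d * (2 * sqrt q) + d\<^sup>2 * real q"
    using d by (intro add_mono sum_odd_main_square mult_left_mono sum_odd_main) auto
  also have "2 * d * (2 * sqrt q) = 4 * (d * sqrt q)" by simp
  finally show ?thesis using d by simp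
qed

text \<open>The main part has norm at least 1 - 4/5. The cubes differ by the uniform error 8 / sqrt
  q times a sum of squares, so the total error has order log q / sqrt q.\<close>

lemma cubic_sum_lower_bound:
  assumes psi: "psi \<in> characters q"
  shows "norm (\<Sum>a\<in>{1..<q}. psi a * of_real (centered_coeff a) ^ 3) \<ge> 1 / 5 - 8 / sqrt q * (3 * (98 + ln q / 2))"
proof -
  let ?I = "{1..<q}"
  have diff: "\<bar>centered_coeff a ^ 3 - odd_main a ^ 3\<bar> \<le> 8 / sqrt q * (3 / 2 * (centered_coeff a ^ 2 + odd_main a ^ 2))"
    if a: "a \<in> ?I" for a
  proof -
    define x where "x = centered_coeff a"
    define y where "y = odd_main a"
    have "x ^ 3 - y ^ 3 = (x - y) * (x\<^sup>2 + x * y + y\<^sup>2)"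
      by (simp add: power2_eq_square power3_eq_cube algebra_simps)
    hence "\<bar>x ^ 3 - y ^ 3\<bar> = \<bar>x - y\<bar> * \<bar>x\<^sup>2 + x * y + y\<^sup>2\<bar>" by (simp only: abs_mult)
    also have "\<dots> \<le> 8 / sqrt q * (3 / 2 * (x\<^sup>2 + y\<^sup>2))"
    proof (rule mult_mono)
      show "\<bar>x - y\<bar> \<le> 8 / sqrt q" unfolding x_def y_def by (rule centered_coeff_approx[OF a])
      have "(x - y)\<^sup>2 \<ge> 0" "(x + y)\<^sup>2 \<ge> 0" by simp_all
      thus "\<bar>x\<^sup>2 + x * y + y\<^sup>2\<bar> \<le> 3 / 2 * (x\<^sup>2 + y\<^sup>2)"
        by (simp add: power2_sum power2_diff abs_le_iff)
    qed auto
    finally show ?thesis by (simp only: x_def y_def)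
  qed
  have "norm ((\<Sum>a\<in>?I. psi a * of_real (centered_coeff a) ^ 3) - (\<Sum>a\<in>?I. psi a * of_real (odd_main a) ^ 3))
      = norm (\<Sum>a\<in>?I. psi a * of_real (centered_coeff a ^ 3 - odd_main a ^ 3))"
    by (simp add: sum_subtractf[symmetric] algebra_simps)
  also have "\<dots> \<le> (\<Sum>a\<in>?I. 8 / sqrt q * (3 / 2 * (centered_coeff a ^ 2 + odd_main a ^ 2)))"
  proof (rule sum_norm_le)
    fix a assume a: "a \<in> ?I"
    have "norm (psi a * of_real (centered_coeff a ^ 3 - odd_main a ^ 3)) \<le> 1 * \<bar>centered_coeff a ^ 3 - odd_main a ^ 3\<bar>"
      unfolding norm_mult norm_of_real by (intro mult_right_mono norm_character_le[OF psi]) auto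
    thus "norm (psi a * of_real (centered_coeff a ^ 3 - odd_main a ^ 3)) \<le> 8 / sqrt q * (3 / 2 * (centered_coeff a ^ 2 + odd_main a ^ 2))"
      using diff[OF a] unfolding mult_1 by (rule order_trans)
  qed
  also have "\<dots> = 8 / sqrt q * (3 / 2 * ((\<Sum>a\<in>?I. centered_coeff a ^ 2) + (\<Sum>a\<in>?I. odd_main a ^ 2)))"
    by (simp only: sum_distrib_left[symmetric] sum.distrib)
  also have "\<dots> \<le> 8 / sqrt q * (3 / 2 * ((98 + ln q / 2) + (98 + ln q / 2)))"
    using sum_centered_coeff_square sum_odd_main_square by (intro mult_left_mono add_mono) auto
  also have "3 / 2 * ((98 + ln q / 2) + (98 + ln q / 2)) = 3 * (98 + ln (real q) / 2)" by simp
  finally have near: "norm ((\<Sum>a\<in>?I. psi a * of_real (centered_coeff a) ^ 3) - (\<Sum>a\<in>?I. psi a * of_real (odd_main a) ^ 3))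
      \<le> 8 / sqrt q * (3 * (98 + ln q / 2))" .
  have set: "?I = insert 1 {2..<q}" using q_gt_2 by auto
  have "(\<Sum>a\<in>?I. psi a * of_real (odd_main a) ^ 3) = 1 + (\<Sum>a\<in>{2..<q}. psi a * of_real (odd_main a) ^ 3)"
    unfolding set using character_1[OF psi] by (simp add: odd_main_def)
  moreover have "norm (\<Sum>a\<in>{2..<q}. psi a * of_real (odd_main a) ^ 3) \<le> (\<Sum>a\<in>{2..<q}. odd_main a ^ 3)"
  proof (rule sum_norm_le)
    fix a
    have "norm (psi a * of_real (odd_main a) ^ 3) = norm (psi a) * odd_main a ^ 3"
      using odd_main_nonneg[of a] by (simp add: norm_mult norm_power)
    also have "\<dots> \<le> 1 * odd_main a ^ 3"
      using odd_main_nonneg[of a] by (intro mult_right_mono norm_character_le[OF psi]) auto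
    finally show "norm (psi a * of_real (odd_main a) ^ 3) \<le> odd_main a ^ 3" by simp
  qed
  ultimately have "norm (\<Sum>a\<in>?I. psi a * of_real (odd_main a) ^ 3) \<ge> 1 - 4 / 5"
    using sum_odd_main_cube_tail norm_diff_ineq[of 1 "\<Sum>a\<in>{2..<q}. psi a * complex_of_real (odd_main a) ^ 3"] by simp
  moreover have "norm (\<Sum>a\<in>?I. psi a * of_real (odd_main a) ^ 3) \<le> norm (\<Sum>a\<in>?I. psi a * of_real (centered_coeff a) ^ 3)
     + norm ((\<Sum>a\<in>?I. psi a * of_real (centered_coeff a) ^ 3) - (\<Sum>a\<in>?I. psi a * of_real (odd_main a) ^ 3))"
    using norm_triangle_sub[of "\<Sum>a\<in>?I. psi a * complex_of_real (odd_main a) ^ 3" "\<Sum>a\<in>?I. psi a * complex_of_real (centered_coeff a) ^ 3"]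
    by (simp only: norm_minus_commute)
  ultimately show ?thesis using near by linarith
qed

definition nonvanishing :: "(nat \<Rightarrow> complex) set" where
  "nonvanishing = {chi \<in> characters q. chi \<noteq> principal_char q \<and> dirichlet_L chi (1/2) \<noteq> 0}"

lemma finite_nonvanishing [simp]: "finite nonvanishing"
  by (simp add: nonvanishing_def)

lemma centered_odd_L_nonvanishing: "chi \<in> characters q \<Longrightarrow> chi \<notin> nonvanishing \<Longrightarrow> centered_odd_L chi = 0"
  by (auto simp: centered_odd_L_eq nonvanishing_def)

text \<open>The first moment is (q - 1) times the coefficient at 1, by orthogonality; the second is
  given by Parseval's identity.\<close>

lemma card_nonvanishing_lower_bound:
  assumes "8 / sqrt q \<le> 1"
  shows "real (q - 1) * (1 - 8 / sqrt q)\<^sup>2 \<le> real (card nonvanishing) * (98 + ln q / 2)"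
proof -
  let ?X = "characters q"
  have N: "real (q - 1) > 0" using q_gt_2 by simp
  have "(norm (\<Sum>chi\<in>?X. centered_odd_L chi))\<^sup>2 \<le> real (card nonvanishing) * (\<Sum>chi\<in>?X. (norm (centered_odd_L chi))\<^sup>2)"
    by (rule norm_sum_square_le) (auto simp: nonvanishing_def intro: centered_odd_L_nonvanishing)
  also have "(\<Sum>chi\<in>?X. centered_odd_L chi) = of_nat (q - 1) * of_real (centered_coeff 1)"
    unfolding centered_odd_L_def by (rule fourier_sum)
  also have "norm \<dots> = real (q - 1) * \<bar>centered_coeff 1\<bar>" unfolding norm_mult by simp
  also have "(\<Sum>chi\<in>?X. (norm (centered_odd_L chi))\<^sup>2) = real (q - 1) * (\<Sum>a\<in>{1..<q}. centered_coeff a ^ 2)"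
    unfolding centered_odd_L_def fourier_parseval by simp
  finally have "real (q - 1) * (real (q - 1) * \<bar>centered_coeff 1\<bar>\<^sup>2)
      \<le> real (q - 1) * (real (card nonvanishing) * (\<Sum>a\<in>{1..<q}. centered_coeff a ^ 2))"
    by (simp only: power_mult_distrib power2_eq_square mult_ac)
  hence "real (q - 1) * \<bar>centered_coeff 1\<bar>\<^sup>2 \<le> real (card nonvanishing) * (\<Sum>a\<in>{1..<q}. centered_coeff a ^ 2)"
    using N by (simp only: mult_le_cancel_left_pos)
  also have "\<dots> \<le> real (card nonvanishing) * (98 + ln q / 2)"
    by (intro mult_left_mono sum_centered_coeff_square) auto
  finally have 1: "real (q - 1) * \<bar>centered_coeff 1\<bar>\<^sup>2 \<le> real (card nonvanishing) * (98 + ln q / 2)" .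
  have "(1 - 8 / sqrt q)\<^sup>2 \<le> \<bar>centered_coeff 1\<bar>\<^sup>2"
    using centered_coeff_1 assms by (intro power_mono) auto
  hence "real (q - 1) * (1 - 8 / sqrt q)\<^sup>2 \<le> real (q - 1) * \<bar>centered_coeff 1\<bar>\<^sup>2"
    by (intro mult_left_mono) auto
  thus ?thesis using 1 by linarith
qed

text \<open>A triple with product \<open>psi\<close> is stored as its first two members, which
  determine the third.\<close>

definition triples :: "(nat \<Rightarrow> complex) \<Rightarrow> ((nat \<Rightarrow> complex) \<times> (nat \<Rightarrow> complex)) set" where
  "triples psi = {p \<in> nonvanishing \<times> nonvanishing. (\<lambda>n. psi n * cnj (fst p n) * cnj (snd p n)) \<in> nonvanishing}"

lemma finite_triples [simp]: "finite (triples psi)"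
  by (simp add: triples_def)

text \<open>6400 = 4^3 * 10^2: the Euler factor at 2 has squared norm at most 4 for each of the
  three characters, and the cubic main term is at least 1/10.\<close>

lemma card_triples_lower_bound:
  assumes psi: "psi \<in> characters q" and large: "8 / sqrt q * (3 * (98 + ln q / 2)) \<le> 1 / 10"
  shows "real (card (triples psi)) * (6400 * (1296 ^ 3 * 291600) * harm half ^ 3) \<ge> real (q - 1) ^ 2"
proof -
  let ?X = "characters q" and ?C = "1296 ^ 3 * 291600 :: real"
  let ?third = "\<lambda>p n. psi n * cnj (fst p n) * cnj (snd p n)"
  let ?F = "\<lambda>p. centered_odd_L (fst p) * centered_odd_L (snd p) * centered_odd_L (?third p)"
  have N: "real (q - 1) > 0" using q_gt_2 by simp
  have third: "?third p \<in> ?X" if "p \<in> ?X \<times> ?X" for p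
    using that psi by (intro characters_mult characters_cnj) auto
  have Lsq: "(norm (centered_odd_L chi))\<^sup>2 \<le> 4 * L_square chi" if chi: "chi \<in> ?X" for chi
  proof (cases "chi = principal_char q")
    case False
    have "norm (1 - chi 2 / sqrt 2) \<le> norm (1::complex) + norm (chi 2 / sqrt 2)" by (rule norm_triangle_ineq4)
    also have "norm (chi 2 / sqrt 2) \<le> 1 / 1"
      unfolding norm_divide by (intro frac_le norm_character_le[OF chi]) auto
    finally have "norm (1 - chi 2 / sqrt 2) \<le> 2" by simp
    hence "(norm (1 - chi 2 / sqrt 2))\<^sup>2 \<le> 2\<^sup>2" by (intro power_mono) auto
    thus ?thesis using False chi by (simp add: centered_odd_L_eq L_square_def norm_mult power_mult_distrib mult_right_mono)
  qed (use chi in \<open>simp add: centered_odd_L_eq L_square_def\<close>)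
  have L0: "L_square chi \<ge> 0" for chi by (simp add: L_square_def)
  have S1: "(\<Sum>p\<in>?X \<times> ?X. ?F p) = of_nat (q - 1) ^ 2 * (\<Sum>a\<in>{1..<q}. psi a * of_real (centered_coeff a) ^ 3)"
    using fourier_triple[OF psi, of "\<lambda>a. of_real (centered_coeff a)"]
    unfolding centered_odd_L_def sum.cartesian_product case_prod_unfold .
  have "norm (\<Sum>a\<in>{1..<q}. psi a * of_real (centered_coeff a) ^ 3) \<ge> 1 / 10"
    using cubic_sum_lower_bound[OF psi] large by linarith
  hence "real (q - 1) ^ 2 * (1 / 10) \<le> norm (\<Sum>p\<in>?X \<times> ?X. ?F p)"
    unfolding S1 norm_mult norm_power norm_of_nat by (intro mult_left_mono) auto
  hence "(real (q - 1) ^ 2 * (1 / 10))\<^sup>2 \<le> (norm (\<Sum>p\<in>?X \<times> ?X. ?F p))\<^sup>2" by (intro power_mono) auto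
  also have "\<dots> \<le> real (card (triples psi)) * (\<Sum>p\<in>?X \<times> ?X. (norm (?F p))\<^sup>2)"
  proof (rule norm_sum_square_le)
    show "triples psi \<subseteq> ?X \<times> ?X" by (auto simp: triples_def nonvanishing_def)
    fix p assume p: "p \<in> ?X \<times> ?X - triples psi"
    hence "fst p \<notin> nonvanishing \<or> snd p \<notin> nonvanishing \<or> ?third p \<notin> nonvanishing"
      by (cases p) (auto simp: triples_def)
    thus "?F p = 0"
      using p third[of p] centered_odd_L_nonvanishing[of "fst p"] centered_odd_L_nonvanishing[of "snd p"]
        centered_odd_L_nonvanishing[of "?third p"] by auto
  qed simp
  also have "(\<Sum>p\<in>?X \<times> ?X. (norm (?F p))\<^sup>2) \<le> (\<Sum>p\<in>?X \<times> ?X. 64 * (L_square (fst p) * L_square (snd p) * L_square (?third p)))"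
  proof (rule sum_mono)
    fix p assume p: "p \<in> ?X \<times> ?X"
    have "(norm (?F p))\<^sup>2 = (norm (centered_odd_L (fst p)))\<^sup>2 * (norm (centered_odd_L (snd p)))\<^sup>2 * (norm (centered_odd_L (?third p)))\<^sup>2"
      by (simp only: norm_mult power_mult_distrib)
    also have "\<dots> \<le> (4 * L_square (fst p)) * (4 * L_square (snd p)) * (4 * L_square (?third p))"
      using p third[OF p] L0 by (intro mult_mono Lsq mult_nonneg_nonneg) auto
    finally show "(norm (?F p))\<^sup>2 \<le> 64 * (L_square (fst p) * L_square (snd p) * L_square (?third p))" by simp
  qed
  also have "\<dots> \<le> 64 * (?C * real (q - 1) ^ 2 * harm half ^ 3)"
    using triple_second_moment[OF psi] unfolding sum_distrib_left[symmetric] sum.cartesian_product case_prod_unfold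
    by (intro mult_left_mono) auto
  finally have "(real (q - 1) ^ 2 * (1 / 10))\<^sup>2 \<le> real (card (triples psi)) * (64 * (?C * real (q - 1) ^ 2 * harm half ^ 3))"
    by (simp add: mult_left_mono)
  hence "real (q - 1) ^ 2 * real (q - 1) ^ 2 \<le> real (q - 1) ^ 2 * (real (card (triples psi)) * (6400 * ?C * harm half ^ 3))"
    by (simp add: power_mult_distrib power_divide power2_eq_square mult_ac)
  thus ?thesis using N by (simp only: mult_le_cancel_left_pos zero_less_power)
qed

end

section \<open>Counting tuples\<close>

text \<open>The inverse of the product of the list in the character group; it is the product that
  the completing triple must have.\<close>

fun dual_product :: "nat \<Rightarrow> (nat \<Rightarrow> complex) list \<Rightarrow> nat \<Rightarrow> complex" where
  "dual_product q [] = principal_char q"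
| "dual_product q (c # cs) = (\<lambda>n. cnj (c n) * dual_product q cs n)"

context odd_prime_modulus
begin

lemma dual_product_in_characters: "set cs \<subseteq> characters q \<Longrightarrow> dual_product q cs \<in> characters q"
  by (induction cs) (auto intro: characters_mult characters_cnj principal_char_in_characters[OF q_pos(2)])

lemma dual_product_eq:
  assumes "set cs \<subseteq> characters q" "coprime n q"
  shows "dual_product q cs n * (\<Prod>c\<leftarrow>cs. c n) = 1"
  using assms
proof (induction cs)
  case (Cons c cs)
  have "cnj (c n) * c n = 1"
    using complex_norm_square[of "c n"] norm_character[of c q n] Cons.prems by (simp add: mult.commute)
  moreover have "dual_product q (c # cs) n * (\<Prod>c\<leftarrow>c # cs. c n) = (cnj (c n) * c n) * (dual_product q cs n * (\<Prod>c\<leftarrow>cs. c n))"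
    by (simp only: dual_product.simps list.map prod_list.Cons mult_ac)
  moreover have "dual_product q cs n * (\<Prod>c\<leftarrow>cs. c n) = 1" using Cons by simp
  ultimately show ?case by (simp only: mult_1)
qed (simp add: principal_char_def)

text \<open>The only proper divisor of the prime \<open>q\<close> is 1, and a character induced from
  modulus 1 is principal.\<close>

lemma nonvanishing_primitive:
  assumes "chi \<in> nonvanishing"
  shows "primitive_char q chi"
  unfolding primitive_char_def
proof (intro conjI allI impI)
  have chi: "chi \<in> characters q" "chi \<noteq> principal_char q" using assms by (auto simp: nonvanishing_def)
  show "dirichlet_char q chi" using chi(1) by (simp add: characters_def)
  fix d assume "d dvd q \<and> d < q"
  hence d: "d = 1" using prime by (auto simp: prime_nat_iff)
  show "\<not> (\<forall>a. coprime a q \<and> [a = 1] (mod d) \<longrightarrow> chi a = 1)"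
  proof
    assume all: "\<forall>a. coprime a q \<and> [a = 1] (mod d) \<longrightarrow> chi a = 1"
    have "chi = principal_char q"
    proof
      fix n
      show "chi n = principal_char q n"
      proof (cases "coprime n q")
        case True
        have "[n = 1] (mod d)" unfolding d by (simp add: cong_def)
        thus ?thesis using all True by (simp add: principal_char_def)
      next
        case False
        thus ?thesis using character_eq_0_iff[OF chi(1), of n] by (simp add: principal_char_def)
      qed
    qed
    thus False using chi(2) by blast
  qed
qed

lemma primitive_in_characters: "primitive_char q chi \<Longrightarrow> chi \<in> characters q"
  by (simp add: primitive_char_def characters_def)

text \<open>Free choice of \<open>k\<close> nonvanishing characters and of a triple completing them
  embeds into the tuples: both the chosen list and the first two members of the triple can be read
  off from the result.\<close>

lemma card_wide_star_lower_bound: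
  assumes t: "t \<ge> 0" "\<And>psi. psi \<in> characters q \<Longrightarrow> t \<le> real (card (triples psi))"
  shows "t * real (card nonvanishing) ^ k
    \<le> real (card {cs \<in> wide_star q (k + 3). (\<Prod>chi\<leftarrow>cs. dirichlet_L chi (1/2)) \<noteq> 0})"
proof -
  let ?W = "{cs \<in> wide_star q (k + 3). (\<Prod>chi\<leftarrow>cs. dirichlet_L chi (1/2)) \<noteq> 0}"
  define S where "S = {cs. set cs \<subseteq> nonvanishing \<and> length cs = k}"
  define T where "T = (SIGMA cs : S. triples (dual_product q cs))"
  define third where "third cs p = (\<lambda>n. dual_product q cs n * cnj (fst p n) * cnj (snd p n))"
    for cs and p :: "(nat \<Rightarrow> complex) \<times> (nat \<Rightarrow> complex)"
  define f where "f x = fst (snd x) # snd (snd x) # third (fst x) (snd x) # fst x" for x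
  have nvX: "nonvanishing \<subseteq> characters q" by (auto simp: nonvanishing_def)
  have finS: "finite S" unfolding S_def by (rule finite_lists_length_eq) simp
  have cardS: "card S = card nonvanishing ^ k" unfolding S_def by (rule card_lists_length_eq) simp
  have finW: "finite ?W"
  proof (rule finite_subset)
    show "?W \<subseteq> {cs. set cs \<subseteq> characters q \<and> length cs = k + 3}"
      by (auto simp: wide_star_def intro: primitive_in_characters)
    show "finite {cs. set cs \<subseteq> characters q \<and> length cs = k + 3}" by (rule finite_lists_length_eq) simp
  qed
  have inj: "inj_on f T"
  proof (rule inj_onI)
    fix x y assume "f x = f y"
    hence "fst x = fst y" "fst (snd x) = fst (snd y)" "snd (snd x) = snd (snd y)" by (auto simp: f_def)
    thus "x = y" by (simp add: prod_eq_iff)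
  qed
  have img: "f ` T \<subseteq> ?W"
  proof (rule image_subsetI)
    fix x assume "x \<in> T"
    then obtain cs p where x: "x = (cs, p)" and cs: "cs \<in> S" and p: "p \<in> triples (dual_product q cs)"
      by (auto simp: T_def)
    have mem: "fst p \<in> nonvanishing" "snd p \<in> nonvanishing" "third cs p \<in> nonvanishing"
      using p by (auto simp: triples_def third_def)
    have sub: "set (f x) \<subseteq> nonvanishing" using mem cs by (auto simp: f_def x S_def)
    have "length (f x) = k + 3" using cs by (simp add: f_def x S_def)
    moreover have "\<forall>c\<in>set (f x). primitive_char q c" using sub nonvanishing_primitive by blast
    moreover have "(\<Prod>c\<leftarrow>f x. c n) = principal_char q n" for n
    proof (cases "coprime n q")
      case True
      have unit: "c n * cnj (c n) = 1" if "c \<in> nonvanishing" for c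
        using complex_norm_square[of "c n"] norm_character[of c q n] True that nvX by auto
      have "(\<Prod>c\<leftarrow>f x. c n) = (fst p n * cnj (fst p n)) * (snd p n * cnj (snd p n)) * (dual_product q cs n * (\<Prod>c\<leftarrow>cs. c n))"
        by (simp add: f_def x third_def mult_ac)
      also have "dual_product q cs n * (\<Prod>c\<leftarrow>cs. c n) = 1"
        by (rule dual_product_eq[OF _ True]) (use cs nvX in \<open>auto simp: S_def\<close>)
      also have "(fst p n * cnj (fst p n)) * (snd p n * cnj (snd p n)) * 1 = 1" by (simp only: unit mem mult_1)
      finally show ?thesis using True by (simp add: principal_char_def)
    next
      case False
      have "fst p n = 0" using mem(1) nvX character_eq_0_iff[of "fst p" q n] False by blast
      thus ?thesis using False by (simp add: f_def x principal_char_def)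
    qed
    moreover have "(\<Prod>chi\<leftarrow>f x. dirichlet_L chi (1/2)) \<noteq> 0"
      unfolding prod_list_zero_iff using sub by (auto simp: nonvanishing_def)
    ultimately show "f x \<in> ?W" by (simp add: wide_star_def)
  qed
  have "t * real (card nonvanishing) ^ k = (\<Sum>cs\<in>S. t)" by (simp add: cardS)
  also have "\<dots> \<le> (\<Sum>cs\<in>S. real (card (triples (dual_product q cs))))"
    by (intro sum_mono t(2) dual_product_in_characters) (use nvX in \<open>auto simp: S_def\<close>)
  also have "\<dots> = real (card T)"
    unfolding T_def using finS by (subst card_SigmaI) auto
  also have "\<dots> = real (card (f ` T))" by (simp add: card_image[OF inj])
  also have "\<dots> \<le> real (card ?W)" by (intro of_nat_mono card_mono finW img)
  finally show ?thesis .
qed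

text \<open>The hypothesis \<open>density\<close> gives at least q / log q nonvanishing characters
  with no constant in front, so the power \<open>k\<close> costs nothing. 204800 = 6400 * 2^3 * 2^2,
  from bounding the harmonic number by 2 log q and \<open>q - 1\<close> below by q / 2.\<close>

lemma card_wide_star_ge:
  assumes large: "8 / sqrt q \<le> 1" "8 / sqrt q * (3 * (98 + ln q / 2)) \<le> 1 / 10" "ln q \<ge> 1"
    and density: "real q / ln q * (98 + ln q / 2) \<le> (real q - 1) * (1 - 8 / sqrt q)\<^sup>2"
  shows "1 / (204800 * (1296 ^ 3 * 291600)) * real q ^ (k + 2) / ln q ^ (k + 3)
    \<le> real (card {cs \<in> wide_star q (k + 3). (\<Prod>chi\<leftarrow>cs. dirichlet_L chi (1/2)) \<noteq> 0})"
proof -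
  define C where "C = (1296 ^ 3 * 291600 :: real)"
  have C: "C > 0" by (simp add: C_def)
  define l where "l = ln (real q)"
  have l: "l \<ge> 1" "l > 0" using large(3) by (simp_all add: l_def)
  have q1: "real (q - 1) = real q - 1" using q_pos by (simp add: of_nat_diff)
  have "real q / l * (98 + l / 2) \<le> real (card nonvanishing) * (98 + l / 2)"
    using density card_nonvanishing_lower_bound[OF large(1)] unfolding l_def q1 by linarith
  hence nv: "real q / l \<le> real (card nonvanishing)" using l by (simp only: mult_le_cancel_right_pos)
  have h1: "harm half \<le> 2 * l"
  proof -
    have "harm half \<le> (harm q :: real)" using q_eq_half by (intro harm_mono) linarith
    also have "\<dots> \<le> 1 + l" unfolding l_def using q_pos by (intro harm_le_ln)
    finally show ?thesis using l by linarith
  qed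
  have tri: "real q ^ 2 / (204800 * C * l ^ 3) \<le> real (card (triples psi))" if psi: "psi \<in> characters q" for psi
  proof -
    have "(real q / 2) ^ 2 \<le> real (q - 1) ^ 2" using q_gt_2 unfolding q1 by (intro power_mono) auto
    also have "\<dots> \<le> real (card (triples psi)) * (6400 * C * harm half ^ 3)"
      using card_triples_lower_bound[OF psi large(2)] unfolding C_def .
    also have "\<dots> \<le> real (card (triples psi)) * (6400 * C * (2 * l) ^ 3)"
      using C h1 by (intro mult_left_mono power_mono harm_nonneg) auto
    finally have "real q ^ 2 \<le> real (card (triples psi)) * (204800 * C * l ^ 3)"
      by (simp add: power_divide power_mult_distrib)
    thus ?thesis using C l by (simp add: pos_divide_le_eq)
  qed
  have "1 / (204800 * C) * real q ^ (k + 2) / l ^ (k + 3) = real q ^ 2 / (204800 * C * l ^ 3) * (real q / l) ^ k"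
    by (simp add: power_add power_divide power2_eq_square mult_ac)
  also have "\<dots> \<le> real q ^ 2 / (204800 * C * l ^ 3) * real (card nonvanishing) ^ k"
    using C l nv by (intro mult_left_mono power_mono divide_nonneg_nonneg) auto
  also have "\<dots> \<le> real (card {cs \<in> wide_star q (k + 3). (\<Prod>chi\<leftarrow>cs. dirichlet_L chi (1/2)) \<noteq> 0})"
    using C l tri by (intro card_wide_star_lower_bound divide_nonneg_nonneg) auto
  finally show ?thesis unfolding C_def l_def .
qed

end

theorem theorem1p3:
  "\<exists>c>0. \<forall>M :: nat \<Rightarrow> nat.
     (\<forall>q. M q \<ge> 3) \<and> (\<lambda>q. real (M q)) \<in> o(\<lambda>q. sqrt (real q) * ln (real q)) \<longrightarrow>
     (\<forall>\<^sub>F q in sequentially. prime q \<longrightarrow>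
        real (card {cs \<in> wide_star q (M q).
                 (\<Prod>chi\<leftarrow>cs. dirichlet_L chi (1/2)) \<noteq> 0})
        \<ge> c * real q ^ (M q - 1) / (ln (real q)) ^ (M q))"
proof (intro exI[of _ "1 / (204800 * (1296 ^ 3 * 291600))"] conjI allI impI)
  fix M :: "nat \<Rightarrow> nat"
  assume M: "(\<forall>q. M q \<ge> 3) \<and> (\<lambda>q. real (M q)) \<in> o(\<lambda>q. sqrt (real q) * ln (real q))"
  have "eventually (\<lambda>q::nat. 8 / sqrt q \<le> 1) sequentially" by real_asymp
  moreover have "eventually (\<lambda>q::nat. 8 / sqrt q * (3 * (98 + ln q / 2)) \<le> 1 / 10) sequentially" by real_asymp
  moreover have "eventually (\<lambda>q::nat. ln (real q) \<ge> 1) sequentially" by real_asymp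
  \<comment> \<open>The left side is asymptotic to q / 2 and the right side to q; this is where the
    factor won by the odd series is spent.\<close>
  moreover have "eventually (\<lambda>q::nat. real q / ln q * (98 + ln q / 2) \<le> (real q - 1) * (1 - 8 / sqrt q)\<^sup>2) sequentially"
    by real_asymp
  ultimately show "\<forall>\<^sub>F q in sequentially. prime q \<longrightarrow>
        real (card {cs \<in> wide_star q (M q). (\<Prod>chi\<leftarrow>cs. dirichlet_L chi (1/2)) \<noteq> 0})
        \<ge> 1 / (204800 * (1296 ^ 3 * 291600)) * real q ^ (M q - 1) / (ln (real q)) ^ (M q)"
    using eventually_gt_at_top[of 2]
  proof eventually_elim
    case (elim q)
    show ?case
    proof
      assume "prime q"
      then interpret odd_prime_modulus q
        using elim by unfold_locales (auto simp: prime_odd_nat)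
      obtain k where k: "M q = k + 3" using M by (metis add.commute le_Suc_ex)
      show "real (card {cs \<in> wide_star q (M q). (\<Prod>chi\<leftarrow>cs. dirichlet_L chi (1/2)) \<noteq> 0})
        \<ge> 1 / (204800 * (1296 ^ 3 * 291600)) * real q ^ (M q - 1) / (ln (real q)) ^ (M q)"
        using card_wide_star_ge[OF elim(1-4), of k] by (simp add: k)
    qed
  qed
qed simp

end
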